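(* Let $\hat C$ be a Julia continuum of a disjoint-type entire function $f$. Then $\hat C$ has span zero and $\infty$ is a terminal point of $\hat C$.
   Context: A transcendental entire function is a non-polynomial holomorphic map $f\colon\mathbb{C}\to\mathbb{C}$; $f^n$ denotes its $n$-th iterate. The Fatou set $F(f)$ is the set of points having a neighbourhood on which the family $(f^n)$ is equicontinuous with respect to the spherical metric; the Julia set is $J(f)=\mathbb{C}\setminus F(f)$. $S(f)$ is the closure in $\mathbb{C}$ of the set of all critical and finite asymptotic values of $f$. A transcendental entire function $f$ is hyperbolic if $S(f)$ is bounded and every point of $S(f)$ tends to an attracting periodic cycle of $f$ under iteration; it is of disjoint type if it is hyperbolic and $F(f)$ is connected. A continuum is a non-empty compact connected metric space. If $f$ is of disjoint type and $C$ is a connected component of $J(f)$ (every such $C$ is closed and unbounded), then $\hat C=C\cup\{\infty\}$, a subset of the Riemann sphere, is called a Julia continuum of $f$. A point $x$ of a continuum $X$ is a terminal point of $X$ if for any two subcontinua $A,B\subset X$ with $x\in A\cap B$, either $A\subset B$ or $B\subset A$. A continuum $X$ has span zero if every subcontinuum $\mathcal{A}\subset X\times X$ whose projections to the first and to the second coordinate are the same subcontinuum $A\subset X$ intersects the diagonal, i.e. there is $x\in X$ with $(x,x)\in\mathcal{A}$. *)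

theory Defs
  imports "HOL-Complex_Analysis.Complex_Analysis"
begin

section \<open>Continua\<close>

definition continuum :: "'a::metric_space set \<Rightarrow> bool" where
  "continuum X \<longleftrightarrow> X \<noteq> {} \<and> compact X \<and> connected X"

definition subcontinuum :: "'a::metric_space set \<Rightarrow> 'a set \<Rightarrow> bool" where
  "subcontinuum A X \<longleftrightarrow> continuum A \<and> A \<subseteq> X"

definition terminal_point :: "'a::metric_space set \<Rightarrow> 'a \<Rightarrow> bool" where
  "terminal_point X x \<longleftrightarrow> continuum X \<and> x \<in> X \<and>
     (\<forall>A B. subcontinuum A X \<and> subcontinuum B X \<and> x \<in> A \<inter> B \<longrightarrow> A \<subseteq> B \<or> B \<subseteq> A)"

definition span_zero :: "'a::metric_space set \<Rightarrow> bool" where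
  "span_zero X \<longleftrightarrow> continuum X \<and>
     (\<forall>\<A> A. subcontinuum \<A> (X \<times> X) \<and> subcontinuum A X \<and> fst ` \<A> = A \<and> snd ` \<A> = A
        \<longrightarrow> (\<exists>x\<in>X. (x, x) \<in> \<A>))"


section \<open>The Riemann sphere\<close>

text \<open>The Riemann sphere is the unit sphere of \<open>complex \<times> real\<close> (Euclidean 3-space); the plane is
  embedded in it by inverse stereographic projection from the north pole, which plays the role
  of \<open>\<infinity>\<close>.\<close>

definition sphere_emb :: "complex \<Rightarrow> complex \<times> real" where
  "sphere_emb z =
     ((2 / ((cmod z)\<^sup>2 + 1)) *\<^sub>R z, ((cmod z)\<^sup>2 - 1) / ((cmod z)\<^sup>2 + 1))"

definition sphere_infty :: "complex \<times> real" where
  "sphere_infty = (0, 1)"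

lemma bij_betw_sphere_emb: "bij_betw sphere_emb UNIV (sphere 0 1 - {sphere_infty})"
proof (rule bij_betwI[where g = "\<lambda>(w, t). (1 / (1 - t)) *\<^sub>R w"])
  show "sphere_emb \<in> UNIV \<rightarrow> sphere 0 1 - {sphere_infty}"
  proof
    fix z :: complex
    define r where "r = (cmod z)\<^sup>2"
    have r: "r + 1 > 0" by (simp add: r_def add_nonneg_pos)
    have "(norm (sphere_emb z))\<^sup>2 = (2 / (r + 1))\<^sup>2 * r + ((r - 1) / (r + 1))\<^sup>2"
      by (simp add: sphere_emb_def norm_Pair power_mult_distrib power_divide r_def)
    also have "\<dots> = (4 * r + (r - 1)\<^sup>2) / (r + 1)\<^sup>2"
      by (simp add: power_divide add_divide_distrib)
    also have "4 * r + (r - 1)\<^sup>2 = (r + 1)\<^sup>2"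
      by (simp add: power2_eq_square algebra_simps)
    also have "(r + 1)\<^sup>2 / (r + 1)\<^sup>2 = 1"
      using r by simp
    finally have "norm (sphere_emb z) = 1"
      by (metis norm_ge_zero power2_eq_1_iff zero_le_one le_minus_one_simps(3) order_trans)
    moreover have "(r - 1) / (r + 1) \<noteq> 1" using r by (simp add: divide_simps)
    ultimately show "sphere_emb z \<in> sphere 0 1 - {sphere_infty}"
      by (auto simp: sphere_emb_def sphere_infty_def r_def)
  qed
next
  show "(\<lambda>(w, t). (1 / (1 - t)) *\<^sub>R w) \<in> sphere 0 1 - {sphere_infty} \<rightarrow> UNIV" by simp
next
  fix z :: complex
  have "(cmod z)\<^sup>2 + 1 > 0" by (simp add: add_nonneg_pos)
  then have "1 - ((cmod z)\<^sup>2 - 1) / ((cmod z)\<^sup>2 + 1) = 2 / ((cmod z)\<^sup>2 + 1)"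
    by (simp add: field_simps)
  then show "(case sphere_emb z of (w, t) \<Rightarrow> (1 / (1 - t)) *\<^sub>R w) = z"
    using \<open>(cmod z)\<^sup>2 + 1 > 0\<close> by (simp add: sphere_emb_def)
next
  fix y :: "complex \<times> real"
  assume y: "y \<in> sphere 0 1 - {sphere_infty}"
  obtain w t where wt: "y = (w, t)" by (cases y)
  have n: "(cmod w)\<^sup>2 + t\<^sup>2 = 1"
    using y by (auto simp: wt norm_Pair)
  have "t \<noteq> 1"
    using y n by (auto simp: wt sphere_infty_def)
  moreover have "t \<le> 1"
    using n by (metis abs_le_square_iff abs_one abs_le_D1 le_add_same_cancel2 one_power2 zero_le_power2)
  ultimately have t: "1 - t > 0" by simp
  define r where "r = (cmod ((1 / (1 - t)) *\<^sub>R w))\<^sup>2"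
  have "r = (1 - t\<^sup>2) / (1 - t)\<^sup>2"
    using n t by (simp add: r_def power_divide norm_divide)
  also have "\<dots> = (1 + t) / (1 - t)"
    using t by (simp add: divide_simps power2_eq_square) (simp add: algebra_simps)
  finally have r: "r = (1 + t) / (1 - t)" .
  have 1: "r + 1 = 2 / (1 - t)" and 2: "r - 1 = 2 * t / (1 - t)"
    using t by (simp_all add: r field_simps)
  have "sphere_emb ((1 / (1 - t)) *\<^sub>R w) =
      ((2 / (r + 1)) *\<^sub>R ((1 / (1 - t)) *\<^sub>R w), (r - 1) / (r + 1))"
    by (simp only: sphere_emb_def r_def)
  also have "\<dots> = (w, t)"
    unfolding 1 2 using t by simp
  finally show "sphere_emb (case y of (w, t) \<Rightarrow> (1 / (1 - t)) *\<^sub>R w) = y"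
    by (simp add: wt)
qed

text \<open>Great-circle distance between the images of two points of the plane.\<close>

definition spherical_dist :: "complex \<Rightarrow> complex \<Rightarrow> real" where
  "spherical_dist z w = arccos (sphere_emb z \<bullet> sphere_emb w)"


section \<open>Fatou and Julia sets\<close>

text \<open>Equicontinuity (at every point of \<open>U\<close>) with respect to the spherical metric on the values.
  The Euclidean metric is used on the domain; it induces the same topology on the plane as the
  spherical one, and only that topology matters here.\<close>

definition spherically_equicontinuous_on ::
    "complex set \<Rightarrow> (complex \<Rightarrow> complex) set \<Rightarrow> bool" where
  "spherically_equicontinuous_on U G \<longleftrightarrow>
     (\<forall>z\<in>U. \<forall>\<epsilon>>0. \<exists>\<delta>>0. \<forall>w\<in>U. dist z w < \<delta> \<longrightarrow> (\<forall>g\<in>G. spherical_dist (g z) (g w) < \<epsilon>))"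

definition Fatou_set :: "(complex \<Rightarrow> complex) \<Rightarrow> complex set" where
  "Fatou_set f =
     {z. \<exists>U. open U \<and> z \<in> U \<and> spherically_equicontinuous_on U (range (\<lambda>n. f ^^ n))}"

definition Julia_set :: "(complex \<Rightarrow> complex) \<Rightarrow> complex set" where
  "Julia_set f = - Fatou_set f"


section \<open>Entire functions of disjoint type\<close>

definition transcendental_entire :: "(complex \<Rightarrow> complex) \<Rightarrow> bool" where
  "transcendental_entire f \<longleftrightarrow> f holomorphic_on UNIV \<and> \<not> (\<exists>p. f = poly p)"

definition critical_values :: "(complex \<Rightarrow> complex) \<Rightarrow> complex set" where
  "critical_values f = f ` {z. deriv f z = 0}"

definition asymptotic_values :: "(complex \<Rightarrow> complex) \<Rightarrow> complex set" where
  "asymptotic_values f =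
     {a. \<exists>\<gamma> :: real \<Rightarrow> complex. continuous_on {0..} \<gamma> \<and> filterlim \<gamma> at_infinity at_top
           \<and> ((\<lambda>t. f (\<gamma> t)) \<longlongrightarrow> a) at_top}"

definition singular_set :: "(complex \<Rightarrow> complex) \<Rightarrow> complex set" where
  "singular_set f = closure (critical_values f \<union> asymptotic_values f)"

definition attracting_cycle :: "(complex \<Rightarrow> complex) \<Rightarrow> complex set \<Rightarrow> bool" where
  "attracting_cycle f Z \<longleftrightarrow>
     (\<exists>p n. n > 0 \<and> (f ^^ n) p = p \<and> cmod (deriv (f ^^ n) p) < 1
        \<and> Z = (\<lambda>k. (f ^^ k) p) ` {..<n})"

definition hyperbolic :: "(complex \<Rightarrow> complex) \<Rightarrow> bool" where
  "hyperbolic f \<longleftrightarrow> transcendental_entire f \<and> bounded (singular_set f) \<and>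
     (\<forall>s\<in>singular_set f. \<exists>Z. attracting_cycle f Z \<and> (\<lambda>k. infdist ((f ^^ k) s) Z) \<longlonglongrightarrow> 0)"

definition disjoint_type :: "(complex \<Rightarrow> complex) \<Rightarrow> bool" where
  "disjoint_type f \<longleftrightarrow> hyperbolic f \<and> connected (Fatou_set f)"

definition Julia_continua :: "(complex \<Rightarrow> complex) \<Rightarrow> (complex \<times> real) set set" where
  "Julia_continua f = (\<lambda>C. insert sphere_infty (sphere_emb ` C)) ` components (Julia_set f)"

end

theory Submission
  imports Defs
begin

text \<open>
  Two distinct points of a component of the Julia set are pulled apart by the iterates of \<open>f\<close>: in a
  logarithmic coordinate, their distance at time \<open>n\<close> is at least \<open>2\<pi>\<close> for all large \<open>n\<close>. On the other hand,
  the image of the component at time \<open>n\<close> lies, in this coordinate, in a domain (a tract) that is disjoint from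
  its translates by \<open>2\<pi>\<i>\<close>. In such a domain two points can be moved around
  each other only if at some moment they lie on a vertical line at distance less than \<open>2\<pi>\<close>: to exchange
  left and right they have to come close. A continuum of pairs in which both orders occur therefore
  contains, for every \<open>n\<close>, a pair that is still close at time \<open>n\<close>, and such pairs accumulate on the diagonal.

  If \<open>\<A>\<close> is a continuum of pairs whose projections are the same set \<open>A\<close>, both orders occur: pairs with the
  rightmost point of \<open>A\<close> in the first or in the second place do this, and if \<open>A\<close> contains \<open>\<infinity>\<close>, then
  \<open>\<infinity>\<close> is to the right of everything. This gives span zero. For the second assertion, suppose that \<open>A\<close> and \<open>B\<close>
  are subcontinua that contain \<open>\<infinity>\<close>, and that \<open>a \<in> A - B\<close> and \<open>b \<in> B - A\<close>. The same argument applies to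
  the continuum of pairs \<open>A \<times> {b} \<union> {a} \<times> B\<close>, which contains \<open>(\<infinity>, b)\<close> and \<open>(a, \<infinity>)\<close> but does not meet the
  diagonal.

  Since the Fatou set is connected, it is the basin of one attracting fixed point
  (\<open>connected_Fatou_set_attracting_fixed_point\<close>). Hence there is a continuum \<open>K\<close> that contains all singular
  values, is mapped into its interior, and has a connected complement \<open>W\<close>; the Julia set consists of the points
  whose orbits stay in \<open>W\<close> (\<open>disjoint_type_trap\<close>). A Riemann map of \<open>W \<union> {\<infinity>}\<close> yields a universal cover
  \<open>P\<close> of \<open>W\<close> by the right half-plane, the logarithmic coordinate (\<open>exists_exponential_cover\<close>). As \<open>W\<close> is free of
  singular values, \<open>P\<close> lifts through \<open>f\<close> (\<open>holomorphic_lift_exists_half_plane\<close>), and as \<open>f\<close> is transcendental,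
  the lifts are injective (\<open>inverse_branch_inj\<close>). So a component of the Julia set is described by a sequence
  of self-maps \<open>G n\<close> of the half-plane, each of which has an image disjoint from its translates
  (\<open>itinerary\<close>).

  Order is measured by a continuous choice of the argument of
  \<open>(2\<pi>\<i> - (G u - G v)) / (2\<pi>\<i> + (G u - G v))\<close> (\<open>exists_side_function_half_plane\<close>). That pairs
  which are close at time \<open>n\<close> were extremely close at time \<open>0\<close> follows from the fact that \<open>G n\<close> omits the
  \<open>2\<pi>\<i>\<close>-translates of its values, and thus contracts the hyperbolic metric by a definite factor
  (\<open>pseudo_hyp_contraction\<close>). Both are combined in \<open>meets_diagonal\<close>.
\<close>

section \<open>Contraction in the pseudo-hyperbolic metric\<close>

definition right_half_plane :: "complex set" where
  "right_half_plane = {z. 0 < Re z}"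

text \<open>The hyperbolic tangent of half the hyperbolic distance in the right half-plane.\<close>

definition pseudo_hyp :: "complex \<Rightarrow> complex \<Rightarrow> real" where
  "pseudo_hyp u v = cmod ((u - v) / (u + cnj v))"

lemma right_half_plane_simps [simp]: "z \<in> right_half_plane \<longleftrightarrow> 0 < Re z"
  by (simp add: right_half_plane_def)

lemma open_right_half_plane: "open right_half_plane"
  by (simp add: right_half_plane_def open_halfspace_Re_gt)

lemma convex_right_half_plane: "convex right_half_plane"
  by (simp add: right_half_plane_def convex_halfspace_Re_gt)

lemma add_cnj_nonzero: "0 < Re u \<Longrightarrow> 0 < Re v \<Longrightarrow> u + cnj v \<noteq> 0"
  by (auto simp: complex_eq_iff)

lemma norm_add_cnj_squared: "(cmod (u + cnj v))\<^sup>2 = (cmod (u - v))\<^sup>2 + 4 * Re u * Re v"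
  unfolding cmod_power2 by (simp add: power2_eq_square algebra_simps)

lemma pseudo_hyp_squared:
  assumes "0 < Re u" "0 < Re v"
  shows "1 - (pseudo_hyp u v)\<^sup>2 = 4 * Re u * Re v / ((cmod (u - v))\<^sup>2 + 4 * Re u * Re v)"
proof -
  have pos: "(cmod (u - v))\<^sup>2 + 4 * Re u * Re v > 0"
    using assms by (simp add: add_nonneg_pos)
  have "(pseudo_hyp u v)\<^sup>2 = (cmod (u - v))\<^sup>2 / ((cmod (u - v))\<^sup>2 + 4 * Re u * Re v)"
    by (simp add: pseudo_hyp_def norm_divide power_divide norm_add_cnj_squared)
  then show ?thesis using pos by (simp add: field_simps)
qed

lemma pseudo_hyp_lt_1: "0 < Re u \<Longrightarrow> 0 < Re v \<Longrightarrow> pseudo_hyp u v < 1"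
proof -
  assume *: "0 < Re u" "0 < Re v"
  have "0 < 1 - (pseudo_hyp u v)\<^sup>2"
    unfolding pseudo_hyp_squared[OF *] using * by (simp add: add_nonneg_pos)
  then have "(pseudo_hyp u v)\<^sup>2 < 1\<^sup>2" by simp
  then show ?thesis by (rule power_less_imp_less_base) simp
qed

lemma pseudo_hyp_nonneg: "0 \<le> pseudo_hyp u v"
  by (simp add: pseudo_hyp_def)

lemma pseudo_hyp_le:
  assumes "0 < c" "c \<le> Re u" "c \<le> Re v" "cmod (u - v) \<le> l"
  shows "pseudo_hyp u v \<le> l / sqrt (l\<^sup>2 + 4 * c\<^sup>2)"
proof -
  have l: "0 \<le> l" using assms(4) norm_ge_zero order_trans by blast
  have "c * c \<le> Re u * Re v" using assms by (intro mult_mono) auto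
  then have uv: "4 * c\<^sup>2 \<le> 4 * Re u * Re v" by (simp add: power2_eq_square)
  have c: "0 < 4 * c\<^sup>2" using assms by simp
  have *: "a / (a + B) \<le> L / (L + C)" if "0 \<le> a" "a \<le> L" "0 < C" "C \<le> B" for a L B C :: real
  proof -
    have "a * C \<le> L * B" using that by (intro mult_mono) auto
    then show ?thesis using that by (simp add: divide_simps) (auto simp: algebra_simps)
  qed
  have "(pseudo_hyp u v)\<^sup>2 = (cmod (u - v))\<^sup>2 / ((cmod (u - v))\<^sup>2 + 4 * Re u * Re v)"
    by (simp add: pseudo_hyp_def norm_divide power_divide norm_add_cnj_squared)
  also have "\<dots> \<le> l\<^sup>2 / (l\<^sup>2 + 4 * c\<^sup>2)"
    using assms uv c by (intro *) (auto simp: power_mono)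
  also have "\<dots> = (l / sqrt (l\<^sup>2 + 4 * c\<^sup>2))\<^sup>2"
    using c by (simp add: power_divide)
  finally show ?thesis
    by (rule power2_le_imp_le) (use l in simp)
qed

lemma inverse_Cayley:
  fixes v :: complex
  defines "\<psi> \<equiv> \<lambda>\<zeta>. (v + \<zeta> * cnj v) / (1 - \<zeta>)"
  assumes v: "0 < Re v"
  shows "\<psi> holomorphic_on ball 0 1"
    and "cmod \<zeta> < 1 \<Longrightarrow> 0 < Re (\<psi> \<zeta>)"
    and "0 < Re u \<Longrightarrow> \<psi> ((u - v) / (u + cnj v)) = u"
proof -
  show "\<psi> holomorphic_on ball 0 1"
    unfolding \<psi>_def by (intro holomorphic_intros) auto
  show "0 < Re (\<psi> \<zeta>)" if "cmod \<zeta> < 1"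
  proof -
    have sq: "(cmod \<zeta>)\<^sup>2 < 1" using that by (simp add: power_less_one_iff)
    have ne: "1 - \<zeta> \<noteq> 0" using that by auto
    have "Re (\<psi> \<zeta>) = Re ((v + \<zeta> * cnj v) * cnj (1 - \<zeta>)) / (cmod (1 - \<zeta>))\<^sup>2"
      unfolding \<psi>_def by (metis Re_divide_of_real complex_div_cnj of_real_power)
    also have "Re ((v + \<zeta> * cnj v) * cnj (1 - \<zeta>)) = Re v * (1 - (cmod \<zeta>)\<^sup>2)"
      unfolding cmod_power2 by (simp add: algebra_simps power2_eq_square)
    finally show ?thesis using v sq ne by simp
  qed
  show "\<psi> ((u - v) / (u + cnj v)) = u" if "0 < Re u"
  proof -
    have "u + cnj v \<noteq> 0" "v + cnj v \<noteq> 0" using that v add_cnj_nonzero by auto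
    then show ?thesis unfolding \<psi>_def by (simp add: divide_simps) (simp add: algebra_simps)
  qed
qed

text \<open>Schwarz--Pick for maps from the half-plane to the disc: transport to the disc by the Cayley map
  \<open>u \<mapsto> (u - v) / (u + cnj v)\<close>, which takes \<open>v\<close> to the centre.\<close>

lemma Schwarz_Pick_half_plane_disc:
  assumes q: "q holomorphic_on right_half_plane" "\<And>z. 0 < Re z \<Longrightarrow> cmod (q z) < 1"
    and uv: "0 < Re u" "0 < Re v"
  shows "cmod (Moebius_function 0 (q v) (q u)) \<le> pseudo_hyp u v"
proof -
  define \<psi> where "\<psi> = (\<lambda>\<zeta>. (v + \<zeta> * cnj v) / (1 - \<zeta>))"
  have hol\<psi>: "\<psi> holomorphic_on ball 0 1"
    and Re: "\<And>\<zeta>. cmod \<zeta> < 1 \<Longrightarrow> 0 < Re (\<psi> \<zeta>)" and inv: "\<psi> ((u - v) / (u + cnj v)) = u"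
    unfolding \<psi>_def using inverse_Cayley[OF uv(2)] uv(1) by auto
  define F where "F = Moebius_function 0 (q v) \<circ> q \<circ> \<psi>"
  have "(Moebius_function 0 (q v) \<circ> q) holomorphic_on right_half_plane"
    by (rule holomorphic_on_compose_gen[OF q(1) Moebius_function_holomorphic[of _ 0]])
       (use q(2) uv in auto)
  then have "F holomorphic_on ball 0 1"
    unfolding F_def by (rule holomorphic_on_compose_gen[OF hol\<psi>]) (use Re in auto)
  moreover have "F 0 = 0"
    by (simp add: F_def \<psi>_def Moebius_function_eq_zero)
  moreover have "cmod (F z) < 1" if "cmod z < 1" for z
    unfolding F_def comp_def using Re q(2) uv that by (intro Moebius_function_norm_lt_1) auto
  moreover have lt: "cmod ((u - v) / (u + cnj v)) < 1"
    using pseudo_hyp_lt_1[OF uv] by (simp add: pseudo_hyp_def)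
  ultimately have "cmod (F ((u - v) / (u + cnj v))) \<le> cmod ((u - v) / (u + cnj v))"
    by (rule Schwarz_Lemma(1))
  moreover note inv
  ultimately show ?thesis by (simp add: F_def pseudo_hyp_def)
qed

lemma pseudo_hyp_Cayley:
  assumes "0 < Re a" "0 < Re z" "0 < Re w"
  shows "cmod (Moebius_function 0 ((w - a) / (w + cnj a)) ((z - a) / (z + cnj a))) = pseudo_hyp z w"
proof -
  have nz: "w + cnj a \<noteq> 0" "z + cnj a \<noteq> 0" "z + cnj w \<noteq> 0" "a + cnj a \<noteq> 0"
    using assms add_cnj_nonzero by auto
  have nz': "cnj w + a \<noteq> 0" using nz(1) by (metis complex_cnj_add complex_cnj_cnj complex_cnj_zero_iff)
  have "(z - a) / (z + cnj a) - (w - a) / (w + cnj a) =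
      (z - w) * (a + cnj a) / ((z + cnj a) * (w + cnj a))"
    using nz by (simp add: divide_simps) (simp add: algebra_simps)
  moreover have "1 - cnj ((w - a) / (w + cnj a)) * ((z - a) / (z + cnj a)) =
      (z + cnj w) * (a + cnj a) / ((cnj w + a) * (z + cnj a))"
    using nz nz' by (simp add: divide_simps) (simp add: algebra_simps)
  moreover have "cmod (cnj w + a) = cmod (w + cnj a)"
    by (metis complex_cnj_add complex_cnj_cnj complex_mod_cnj)
  ultimately show ?thesis
    using nz nz' unfolding Moebius_function_simple pseudo_hyp_def
    by (simp add: norm_divide norm_mult divide_simps)
qed

lemma Cayley_lt_1: "0 < Re a \<Longrightarrow> 0 < Re z \<Longrightarrow> cmod ((z - a) / (z + cnj a)) < 1"
  using pseudo_hyp_lt_1[of z a] by (simp add: pseudo_hyp_def)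

lemma norm_one_minus_cnj_mult_squared:
  "(cmod (1 - cnj t * s))\<^sup>2 = (cmod (s - t))\<^sup>2 + (1 - (cmod s)\<^sup>2) * (1 - (cmod t)\<^sup>2)"
  unfolding cmod_power2 by (simp add: power2_eq_square algebra_simps)

text \<open>Both \<open>\<plusminus> t\<close> satisfy \<open>1 - \<bar>Moebius_function 0 (\<plusminus> t) s\<bar>\<^sup>2 = (1 - \<bar>s\<bar>\<^sup>2) (1 - \<bar>t\<bar>\<^sup>2) / \<bar>1 \<mp> cnj t s\<bar>\<^sup>2\<close>. The
  numerators agree, so that the estimate for \<open>t\<close> carries over to \<open>- t\<close> up to the ratio of the denominators.\<close>

lemma Moebius_uminus_le:
  assumes s: "cmod s \<le> b" "b < 1" and t: "cmod t < 1"
    and d: "cmod (Moebius_function 0 t s) \<le> d" "d < 1"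
  shows "cmod (Moebius_function 0 (- t) s) \<le> sqrt (1 - (1 - d\<^sup>2) * (1 - b)\<^sup>2 / 4)"
proof -
  have ts: "cmod (t * s) \<le> b" "cmod (t * s) < 1"
  proof -
    have "cmod t * cmod s \<le> 1 * b" using s t by (intro mult_mono) auto
    then show "cmod (t * s) \<le> b" "cmod (t * s) < 1" using s(2) by (auto simp: norm_mult)
  qed
  have "1 - b \<le> cmod (1 - cnj t * s)"
    using norm_triangle_ineq2[of 1 "cnj t * s"] ts by (simp add: norm_mult)
  then have low: "(1 - b)\<^sup>2 \<le> (cmod (1 - cnj t * s))\<^sup>2" using s by (intro power_mono) auto
  then have pos: "0 < (cmod (1 - cnj t * s))\<^sup>2"
    using s(2) by (smt (verit) zero_less_power2)
  have up: "(cmod (1 + cnj t * s))\<^sup>2 \<le> 4"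
  proof -
    have "cmod (1 + cnj t * s) \<le> 2"
      using norm_triangle_ineq[of 1 "cnj t * s"] ts by (simp add: norm_mult)
    then have "(cmod (1 + cnj t * s))\<^sup>2 \<le> 2\<^sup>2" by (intro power_mono) auto
    then show ?thesis by simp
  qed
  have "0 < cmod (1 + cnj t * s)"
    using norm_triangle_ineq2[of 1 "- (cnj t * s)"] ts by (auto simp: norm_mult)
  then have pos': "0 < (cmod (1 + cnj t * s))\<^sup>2" by simp
  have d0: "0 \<le> d" using d(1) norm_ge_zero order_trans by blast
  define P where "P = (1 - (cmod s)\<^sup>2) * (1 - (cmod t)\<^sup>2)"
  have "(cmod (s - t))\<^sup>2 \<le> d\<^sup>2 * (cmod (1 - cnj t * s))\<^sup>2"
  proof -
    have "(cmod (Moebius_function 0 t s))\<^sup>2 \<le> d\<^sup>2" using d by (intro power_mono) auto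
    then show ?thesis
      using pos by (simp add: Moebius_function_simple norm_divide power_divide divide_simps)
  qed
  then have "(1 - d\<^sup>2) * (cmod (1 - cnj t * s))\<^sup>2 \<le> P"
    using norm_one_minus_cnj_mult_squared[of t s] by (simp add: P_def algebra_simps)
  moreover have d2: "d\<^sup>2 < 1" using d d0 by (simp add: power_less_one_iff)
  ultimately have P: "(1 - d\<^sup>2) * (1 - b)\<^sup>2 \<le> P"
    using low by (smt (verit) mult_left_mono)
  then have P0: "0 \<le> P" using d2 by (smt (verit) mult_nonneg_nonneg zero_le_power2)
  have "(cmod (Moebius_function 0 (- t) s))\<^sup>2 = 1 - P / (cmod (1 + cnj t * s))\<^sup>2"
    using pos' norm_one_minus_cnj_mult_squared[of "- t" s]
    by (simp add: Moebius_function_simple norm_divide power_divide P_def field_simps)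
  also have "\<dots> \<le> 1 - P / 4"
    using up pos' P0 by (smt (verit) divide_left_mono mult_pos_pos zero_less_numeral)
  also have "\<dots> \<le> 1 - (1 - d\<^sup>2) * (1 - b)\<^sup>2 / 4" using P by simp
  finally show ?thesis by (rule real_le_rsqrt)
qed

text \<open>A self-map of the half-plane that omits the value \<open>a\<close> factors through the two-fold cover
  branched over \<open>a\<close>: it is the square of a holomorphic map \<open>q\<close>, once \<open>a\<close> has been moved to the
  centre of the disc. Squaring multiplies the distance of \<open>s\<close> and \<open>t\<close> by that of \<open>s\<close> and \<open>- t\<close>, and
  the latter is bounded away from \<open>1\<close> as long as all points involved are at bounded distance.\<close>

proposition pseudo_hyp_contraction:
  assumes G: "G holomorphic_on right_half_plane" "\<And>z. 0 < Re z \<Longrightarrow> 0 < Re (G z)"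
    and a: "0 < Re a" "\<And>z. 0 < Re z \<Longrightarrow> G z \<noteq> a"
    and uv: "0 < Re u" "0 < Re v"
    and d: "pseudo_hyp u v \<le> d" "pseudo_hyp (G u) a \<le> d" "d < 1"
  shows "pseudo_hyp (G u) (G v) \<le> sqrt (1 - (1 - d\<^sup>2) * (1 - sqrt d)\<^sup>2 / 4) * pseudo_hyp u v"
proof -
  define Q where "Q = (\<lambda>z. (G z - a) / (G z + cnj a))"
  have nz: "G z + cnj a \<noteq> 0" if "0 < Re z" for z
    using G(2)[OF that] a(1) add_cnj_nonzero by blast
  have holQ: "Q holomorphic_on right_half_plane"
    unfolding Q_def using nz G by (intro holomorphic_intros) auto
  have "contractible right_half_plane"
    by (simp add: convex_imp_contractible convex_right_half_plane)
  moreover have "Q z \<noteq> 0" if "z \<in> right_half_plane" for z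
    using that nz a by (simp add: Q_def)
  ultimately obtain l where l: "l holomorphic_on right_half_plane"
      "\<And>z. z \<in> right_half_plane \<Longrightarrow> Q z = exp (l z)"
    using contractible_imp_holomorphic_log[OF holQ] by metis
  define q where "q = (\<lambda>z. exp (l z / 2))"
  have q2: "(q z)\<^sup>2 = Q z" if "0 < Re z" for z
    using l(2)[of z] that by (simp add: q_def flip: exp_double)
  have holq: "q holomorphic_on right_half_plane"
    unfolding q_def using l(1) by (intro holomorphic_intros) auto
  have Qlt: "cmod (Q z) < 1" if "0 < Re z" for z
    unfolding Q_def using Cayley_lt_1[OF a(1) G(2)[OF that]] .
  have qlt: "cmod (q z) < 1" if "0 < Re z" for z
  proof -
    have "(cmod (q z))\<^sup>2 < 1\<^sup>2" using Qlt[OF that] q2[OF that] by (metis norm_power one_power2)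
    then show ?thesis by (rule power_less_imp_less_base) simp
  qed
  define s t where "s = q u" and "t = q v"
  have st: "cmod (Moebius_function 0 t s) \<le> pseudo_hyp u v"
    unfolding s_def t_def by (rule Schwarz_Pick_half_plane_disc[OF holq qlt uv])
  have "cmod s \<le> sqrt d"
  proof (rule real_le_rsqrt)
    show "(cmod s)\<^sup>2 \<le> d"
      using d(2) q2[OF uv(1)] unfolding s_def Q_def pseudo_hyp_def by (metis norm_power)
  qed
  moreover have "sqrt d < 1" using d(3) by simp
  ultimately have mst: "cmod (Moebius_function 0 (- t) s) \<le> sqrt (1 - (1 - d\<^sup>2) * (1 - sqrt d)\<^sup>2 / 4)"
    using qlt uv st d unfolding t_def by (intro Moebius_uminus_le) auto
  have "pseudo_hyp (G u) (G v) = cmod (Moebius_function 0 (Q v) (Q u))"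
    unfolding Q_def using G(2) uv a by (subst pseudo_hyp_Cayley) auto
  also have "\<dots> = cmod (Moebius_function 0 (t\<^sup>2) (s\<^sup>2))"
    using q2 uv by (simp add: s_def t_def)
  also have "Moebius_function 0 (t\<^sup>2) (s\<^sup>2) = Moebius_function 0 t s * Moebius_function 0 (- t) s"
  proof -
    have "s\<^sup>2 - t\<^sup>2 = (s - t) * (s + t)" "1 - cnj (t\<^sup>2) * s\<^sup>2 = (1 - cnj t * s) * (1 + cnj t * s)"
      by (simp_all add: power2_eq_square algebra_simps)
    then show ?thesis by (simp add: Moebius_function_simple)
  qed
  also have "cmod \<dots> \<le> pseudo_hyp u v * sqrt (1 - (1 - d\<^sup>2) * (1 - sqrt d)\<^sup>2 / 4)"
    unfolding norm_mult using st mst by (intro mult_mono) (auto simp: pseudo_hyp_nonneg)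
  finally show ?thesis by (simp add: mult.commute)
qed

section \<open>Left and right in a domain disjoint from its translates\<close>

text \<open>Suppose that \<open>G\<close> parametrises a set that is disjoint from its translates by \<open>\<plusminus> 2\<pi>\<i>\<close>. Then
  \<open>1 - (G u - G v) / (2\<pi>\<i>)\<close> has a continuous logarithm \<open>L\<close>, and the function
  \<open>side (u, v) = Im (L (u, v) - L (v, u))\<close> says on which side of \<open>G v\<close>, as seen inside the set, the point
  \<open>G u\<close> lies. Its sign can change only when \<open>G u\<close> passes \<open>G v\<close> vertically at distance less
  than \<open>2\<pi>\<close>: by construction, \<open>exp (\<i> side)\<close> is the direction of
  \<open>(2\<pi>\<i> - (G u - G v)) / (2\<pi>\<i> + (G u - G v))\<close>, and this number is positive only if \<open>G u - G v\<close> lies on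
  the segment between \<open>- 2\<pi>\<i>\<close> and \<open>2\<pi>\<i>\<close>.\<close>

lemma exists_side_function:
  fixes G :: "complex \<Rightarrow> complex"
  assumes Z: "convex Z" and G: "continuous_on Z G"
    and ne: "\<And>u v. u \<in> Z \<Longrightarrow> v \<in> Z \<Longrightarrow> G u \<noteq> G v + 2 * pi * \<i>"
  obtains side :: "complex \<times> complex \<Rightarrow> real" where
    "continuous_on (Z \<times> Z) side"
    "\<And>u v. side (u, v) = - side (v, u)"
    "\<And>u v. u \<in> Z \<Longrightarrow> v \<in> Z \<Longrightarrow> \<exists>r>0.
       (2 * pi * \<i> - (G u - G v)) / (2 * pi * \<i> + (G u - G v)) = of_real r * cis (side (u, v))"
proof -
  define h where "h = (\<lambda>(u, v). 1 - (G u - G v) / (2 * pi * \<i>))"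
  have cont: "continuous_on (Z \<times> Z) (\<lambda>x. G (fst x))" "continuous_on (Z \<times> Z) (\<lambda>x. G (snd x))"
    by (rule continuous_on_compose2[OF G]; auto intro: continuous_intros)+
  have conth: "continuous_on (Z \<times> Z) h"
    unfolding h_def case_prod_unfold by (intro continuous_intros cont) auto
  have "contractible (Z \<times> Z)"
    by (intro convex_imp_contractible convex_Times Z)
  moreover have hnz: "h z \<noteq> 0" if "z \<in> Z \<times> Z" for z
    using that ne by (auto simp: h_def field_simps) (metis mult.commute)+
  ultimately obtain L where L: "continuous_on (Z \<times> Z) L" "\<And>z. z \<in> Z \<times> Z \<Longrightarrow> h z = exp (L z)"
    using continuous_logarithm_on_contractible[OF conth] by metis
  define side where "side = (\<lambda>(u, v). Im (L (u, v) - L (v, u)))"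
  have "continuous_on (Z \<times> Z) (\<lambda>x. L (snd x, fst x))"
    by (rule continuous_on_compose2[OF L(1)]) (auto intro!: continuous_intros)
  then have "continuous_on (Z \<times> Z) side"
    unfolding side_def case_prod_unfold using L(1) by (intro continuous_intros) auto
  moreover have "side (u, v) = - side (v, u)" for u v
    by (simp add: side_def)
  moreover have "\<exists>r>0. (2 * pi * \<i> - (G u - G v)) / (2 * pi * \<i> + (G u - G v)) =
      of_real r * cis (side (u, v))" if "u \<in> Z" "v \<in> Z" for u v
  proof (intro exI conjI)
    have "(2 * pi * \<i> - (G u - G v)) / (2 * pi * \<i> + (G u - G v)) = h (u, v) / h (v, u)"
    proof -
      have "h (u, v) = (2 * pi * \<i> - (G u - G v)) / (2 * pi * \<i>)"
        "h (v, u) = (2 * pi * \<i> + (G u - G v)) / (2 * pi * \<i>)"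
        by (simp_all add: h_def field_simps)
      then show ?thesis by simp
    qed
    also have "\<dots> = exp (L (u, v) - L (v, u))"
      using L(2) that by (simp add: exp_diff)
    finally show "(2 * pi * \<i> - (G u - G v)) / (2 * pi * \<i> + (G u - G v)) =
        of_real (exp (Re (L (u, v) - L (v, u)))) * cis (side (u, v))"
      by (simp add: side_def exp_eq_polar)
  qed simp
  ultimately show thesis by (rule that)
qed

lemma Im_side_quotient:
  fixes d :: complex
  assumes "2 * pi * \<i> + d \<noteq> 0"
  shows "Im ((2 * pi * \<i> - d) / (2 * pi * \<i> + d)) = 4 * pi * Re d / (cmod (2 * pi * \<i> + d))\<^sup>2"
    and "Re ((2 * pi * \<i> - d) / (2 * pi * \<i> + d)) = (4 * pi\<^sup>2 - (cmod d)\<^sup>2) / (cmod (2 * pi * \<i> + d))\<^sup>2"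
proof -
  have "(2 * pi * \<i> - d) / (2 * pi * \<i> + d) =
      (2 * pi * \<i> - d) * cnj (2 * pi * \<i> + d) / of_real ((cmod (2 * pi * \<i> + d))\<^sup>2)"
    using complex_div_cnj by (metis of_real_power)
  moreover have "(2 * pi * \<i> - d) * cnj (2 * pi * \<i> + d) = Complex (4 * pi\<^sup>2 - (cmod d)\<^sup>2) (4 * pi * Re d)"
    unfolding cmod_power2 by (simp add: complex_eq_iff power2_eq_square algebra_simps)
  ultimately show "Im ((2 * pi * \<i> - d) / (2 * pi * \<i> + d)) = 4 * pi * Re d / (cmod (2 * pi * \<i> + d))\<^sup>2"
    and "Re ((2 * pi * \<i> - d) / (2 * pi * \<i> + d)) = (4 * pi\<^sup>2 - (cmod d)\<^sup>2) / (cmod (2 * pi * \<i> + d))\<^sup>2"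
    by (simp_all add: Im_divide_of_real Re_divide_of_real)
qed

text \<open>The sine of the side function is a positive multiple of \<open>Re (G u - G v)\<close>. Connectedness fixes the
  branch of the angle in the next two lemmas.\<close>

lemma connected_sin_nonneg:
  fixes I :: "real set"
  assumes "connected I" "\<And>x. x \<in> I \<Longrightarrow> 0 \<le> sin x" "0 \<in> I"
  shows "I \<subseteq> {0..pi}"
proof
  fix x assume x: "x \<in> I"
  show "x \<in> {0..pi}"
  proof (rule ccontr)
    assume "x \<notin> {0..pi}"
    then consider "x < 0" | "pi < x" by fastforce
    then show False
    proof cases
      case 1
      define y where "y = max x (- pi / 2)"
      have "y \<in> I" using connectedD_interval[OF assms(1) x assms(3), of y] 1 by (auto simp: y_def)
      moreover have "sin (- y) > 0" using 1 pi_gt_zero by (intro sin_gt_zero) (auto simp: y_def max_def)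
      ultimately show False using assms(2)[of y] by simp
    next
      case 2
      define y where "y = min x (3 * pi / 2)"
      have "y \<in> I" using connectedD_interval[OF assms(1) assms(3) x, of y] 2 pi_gt_zero by (auto simp: y_def)
      moreover have "sin (y - pi) > 0" using 2 pi_gt_zero by (intro sin_gt_zero) (auto simp: y_def min_def)
      ultimately show False using assms(2)[of y] by (simp add: sin_diff)
    qed
  qed
qed

lemma connected_sin_pos:
  fixes I :: "real set"
  assumes "connected I" "\<And>x. x \<in> I \<Longrightarrow> 0 < sin x" "y \<in> I" "0 \<le> y" "x \<in> I"
  shows "0 < x"
proof (rule ccontr)
  assume "\<not> 0 < x"
  then have "0 \<in> I" using connectedD_interval[OF assms(1) assms(5) assms(3), of 0] assms(4) \<open>\<not> 0 < x\<close> by auto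
  then show False using assms(2)[of 0] by simp
qed

text \<open>Here the side function is used on \<open>Z = {z. c \<le> Re z}\<close> for a map \<open>G\<close> whose values tend to
  infinity to the right. The last two properties anchor the sign: everything is to the left of a rightmost
  point of a connected set, and points sufficiently close to infinity are to the right of any given bounded
  set.\<close>

proposition exists_side_function_half_plane:
  fixes G :: "complex \<Rightarrow> complex" and c :: real
  defines "Z \<equiv> {z. c \<le> Re z}"
  assumes G: "continuous_on Z G"
    and ne: "\<And>u v. u \<in> Z \<Longrightarrow> v \<in> Z \<Longrightarrow> G u \<noteq> G v + 2 * pi * \<i>"
    and infinity: "\<And>M. \<exists>R. \<forall>u\<in>Z. R < cmod u \<longrightarrow> M < Re (G u)"
  obtains side :: "complex \<times> complex \<Rightarrow> real" where
    "continuous_on (Z \<times> Z) side"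
    "\<And>u v. side (u, v) = - side (v, u)"
    "\<And>u v. u \<in> Z \<Longrightarrow> v \<in> Z \<Longrightarrow> side (u, v) = 0 \<Longrightarrow> cmod (G u - G v) < 2 * pi"
    "\<And>A. A \<noteq> {} \<Longrightarrow> compact A \<Longrightarrow> connected A \<Longrightarrow> A \<subseteq> Z \<Longrightarrow> \<exists>m\<in>A. \<forall>u\<in>A. side (u, m) \<le> 0"
    "\<And>B. bounded B \<Longrightarrow> \<exists>R. \<forall>u\<in>Z. \<forall>v\<in>B \<inter> Z. R < cmod u \<longrightarrow> 0 < side (u, v)"
proof -
  have "convex Z" unfolding Z_def by (rule convex_halfspace_Re_ge)
  then obtain side :: "complex \<times> complex \<Rightarrow> real" where
    side: "continuous_on (Z \<times> Z) side" "\<And>u v. side (u, v) = - side (v, u)"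
    and dir: "\<And>u v. u \<in> Z \<Longrightarrow> v \<in> Z \<Longrightarrow> \<exists>r>0.
       (2 * pi * \<i> - (G u - G v)) / (2 * pi * \<i> + (G u - G v)) = of_real r * cis (side (u, v))"
    using exists_side_function[OF _ G ne] by metis
  have nz: "2 * pi * \<i> + (G u - G v) \<noteq> 0" if "u \<in> Z" "v \<in> Z" for u v
    using ne[of v u] that by (auto simp: algebra_simps)
  have sin: "\<exists>r>0. sin (side (u, v)) = r * Re (G u - G v)" if uv: "u \<in> Z" "v \<in> Z" for u v
  proof -
    obtain r where r: "r > 0"
      "(2 * pi * \<i> - (G u - G v)) / (2 * pi * \<i> + (G u - G v)) = of_real r * cis (side (u, v))"
      using dir[OF uv] by blast
    define N where "N = (cmod (2 * pi * \<i> + (G u - G v)))\<^sup>2"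
    have "r * sin (side (u, v)) = 4 * pi * Re (G u - G v) / N"
      unfolding N_def using arg_cong[OF r(2), of Im] Im_side_quotient(1)[OF nz[OF uv]] by simp
    then have "(r * sin (side (u, v))) / r = (4 * pi / N / r) * Re (G u - G v)"
      by simp
    then have "sin (side (u, v)) = (4 * pi / N / r) * Re (G u - G v)"
      using r(1) by simp
    moreover have "4 * pi / N / r > 0"
      using r(1) nz[OF uv] by (simp add: N_def)
    ultimately show ?thesis by blast
  qed
  have diag: "side (u, u) = 0" for u using side(2)[of u u] by simp
  have small: "cmod (G u - G v) < 2 * pi" if uv: "u \<in> Z" "v \<in> Z" and 0: "side (u, v) = 0" for u v
  proof -
    obtain r where r: "r > 0"
      "(2 * pi * \<i> - (G u - G v)) / (2 * pi * \<i> + (G u - G v)) = of_real r * cis (side (u, v))"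
      using dir[OF uv] by blast
    have "r = (4 * pi\<^sup>2 - (cmod (G u - G v))\<^sup>2) / (cmod (2 * pi * \<i> + (G u - G v)))\<^sup>2"
      using arg_cong[OF r(2), of Re] Im_side_quotient(2)[OF nz[OF uv]] 0 by simp
    with r(1) have "0 < 4 * pi\<^sup>2 - (cmod (G u - G v))\<^sup>2"
      by (metis not_less_iff_gr_or_eq zero_less_divide_iff zero_le_power2 leD)
    then have "(cmod (G u - G v))\<^sup>2 < (2 * pi)\<^sup>2" by (simp add: power_mult_distrib)
    then show ?thesis by (rule power_less_imp_less_base) simp
  qed
  have slice: "connected ((\<lambda>u. side (u, m)) ` A)" if "connected A" "A \<subseteq> Z" "m \<in> Z" for A m
    using that by (intro connected_continuous_image continuous_on_compose2[OF side(1)])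
      (auto intro!: continuous_intros)
  have right: "0 \<le> side (u, m)"
    if A: "connected A" "A \<subseteq> Z" "m \<in> A" "\<And>u. u \<in> A \<Longrightarrow> Re (G m) \<le> Re (G u)" "u \<in> A" for A m u
  proof -
    have "(\<lambda>u. side (u, m)) ` A \<subseteq> {0..pi}"
    proof (rule connected_sin_nonneg)
      show "connected ((\<lambda>u. side (u, m)) ` A)" using A by (intro slice) auto
      show "0 \<le> sin x" if x: "x \<in> (\<lambda>u. side (u, m)) ` A" for x
      proof -
        obtain u where u: "x = side (u, m)" "u \<in> A" using x by auto
        then obtain r where "r > 0" "sin x = r * Re (G u - G m)"
          using sin[of u m] A(2,3) by auto
        with A(4)[OF u(2)] show ?thesis by simp
      qed
      show "0 \<in> (\<lambda>u. side (u, m)) ` A" using A(3) diag[of m] by (metis image_eqI)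
    qed
    then show ?thesis using A(5) by auto
  qed
  have left: "side (u, m) \<le> 0"
    if A: "connected A" "A \<subseteq> Z" "m \<in> A" "\<And>u. u \<in> A \<Longrightarrow> Re (G u) \<le> Re (G m)" "u \<in> A" for A m u
  proof -
    have "uminus ` (\<lambda>u. side (u, m)) ` A \<subseteq> {0..pi}"
    proof (rule connected_sin_nonneg)
      have "connected ((\<lambda>u. side (u, m)) ` A)" using A by (intro slice) auto
      then show "connected (uminus ` (\<lambda>u. side (u, m)) ` A)"
        by (rule connected_continuous_image[rotated]) (intro continuous_intros)
      show "0 \<le> sin x" if x: "x \<in> uminus ` (\<lambda>u. side (u, m)) ` A" for x
      proof -
        obtain u where u: "x = - side (u, m)" "u \<in> A" using x by auto
        then obtain r where "r > 0" "sin (- x) = r * Re (G u - G m)"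
          using sin[of u m] A(2,3) by auto
        with A(4)[OF u(2)] show ?thesis
          by (simp add: mult_le_0_iff minus_equation_iff[of "sin x"] algebra_simps)
            (smt (verit) mult_left_mono)
      qed
      show "0 \<in> uminus ` (\<lambda>u. side (u, m)) ` A" using A(3) diag[of m] by force
    qed
    then show ?thesis using A(5) by (auto simp: image_image image_subset_iff)
  qed
  have rightmost: "\<exists>m\<in>A. \<forall>u\<in>A. side (u, m) \<le> 0"
    if A: "A \<noteq> {}" "compact A" "connected A" "A \<subseteq> Z" for A
  proof -
    have "continuous_on A (\<lambda>u. Re (G u))"
      using G A(4) by (intro continuous_intros) (auto intro: continuous_on_subset)
    then obtain m where "m \<in> A" "\<And>u. u \<in> A \<Longrightarrow> Re (G u) \<le> Re (G m)"
      using continuous_attains_sup[OF A(2,1)] by blast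
    then show ?thesis using left[OF A(3,4)] by blast
  qed
  have far: "\<exists>R. \<forall>u\<in>Z. \<forall>v\<in>B \<inter> Z. R < cmod u \<longrightarrow> 0 < side (u, v)" if B: "bounded B" for B
  proof -
    \<comment> \<open>A bounded box around \<open>B\<close> that contains a leftmost point of \<open>Z\<close> with respect to \<open>G\<close>.\<close>
    define a where "a = complex_of_real c"
    have aZ: "a \<in> Z" by (simp add: a_def Z_def)
    obtain R1 where R1: "\<And>u. u \<in> Z \<Longrightarrow> R1 < cmod u \<Longrightarrow> Re (G a) < Re (G u)"
      using infinity by blast
    obtain b where b: "\<And>v. v \<in> B \<Longrightarrow> cmod v \<le> b" using B by (auto simp: bounded_iff)
    define R2 where "R2 = max (max R1 b) (\<bar>c\<bar> + 1)"
    define box where "box = Z \<inter> cball 0 R2"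
    have box: "compact box" "convex box" "a \<in> box"
      unfolding box_def using aZ \<open>convex Z\<close>
      by (auto intro!: closed_Int_compact convex_Int simp: Z_def closed_halfspace_Re_ge a_def R2_def)
    have cb: "continuous_on box (\<lambda>u. Re (G u))"
      using G by (intro continuous_intros) (auto intro: continuous_on_subset simp: box_def)
    then obtain m where m: "m \<in> box" "\<And>u. u \<in> box \<Longrightarrow> Re (G m) \<le> Re (G u)"
      using continuous_attains_inf[OF box(1) _ cb] box(3) by blast
    have mmin: "Re (G m) \<le> Re (G u)" if "u \<in> Z" for u
    proof (cases "u \<in> box")
      case False
      then have "R1 < cmod u" using that by (auto simp: box_def R2_def)
      then show ?thesis using R1[OF that] m(2)[OF box(3)] by simp
    qed (use m in auto)
    obtain u1 where u1: "\<And>u. u \<in> box \<Longrightarrow> Re (G u) \<le> Re (G u1)"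
      using continuous_attains_sup[OF box(1) _ cb] box(3) by blast
    obtain R3 where R3: "\<And>u. u \<in> Z \<Longrightarrow> R3 < cmod u \<Longrightarrow> Re (G u1) < Re (G u)"
      using infinity by blast
    \<comment> \<open>A connected neighbourhood of infinity in \<open>Z\<close>, made of three overlapping convex pieces.\<close>
    define R where "R = max \<bar>R3\<bar> (\<bar>c\<bar> + 1)"
    define E where "E = {z. R < Re z} \<union> (Z \<inter> {z. R < Im z}) \<union> (Z \<inter> {z. Im z < - R})"
    have conn1: "connected ({z. R < Re z} \<union> (Z \<inter> {z. R < Im z}))"
    proof (rule connected_Un)
      have "Complex (R + 1) (R + 1) \<in> {z. R < Re z} \<inter> (Z \<inter> {z. R < Im z})"
        by (auto simp: R_def Z_def)
      then show "{z. R < Re z} \<inter> (Z \<inter> {z. R < Im z}) \<noteq> {}" by blast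
    qed (intro convex_connected convex_Int \<open>convex Z\<close> convex_halfspace_Re_gt convex_halfspace_Im_gt)+
    have connE: "connected E" unfolding E_def
    proof (rule connected_Un[OF conn1])
      have "Complex (R + 1) (- R - 1) \<in> {z. R < Re z} \<inter> (Z \<inter> {z. Im z < - R})"
        by (auto simp: R_def Z_def)
      then show "({z. R < Re z} \<union> (Z \<inter> {z. R < Im z})) \<inter> (Z \<inter> {z. Im z < - R}) \<noteq> {}" by blast
    qed (intro convex_connected convex_Int \<open>convex Z\<close> convex_halfspace_Im_lt)
    have EZ: "E \<subseteq> Z" by (auto simp: E_def Z_def R_def)
    have Enorm: "R3 < cmod z" if "z \<in> E" for z
    proof -
      have "R < cmod z" using that abs_Re_le_cmod[of z] abs_Im_le_cmod[of z] by (auto simp: E_def)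
      then show ?thesis using abs_ge_self[of R3] unfolding R_def by linarith
    qed
    have pos: "0 < side (u, v)" if u: "u \<in> E" and v: "v \<in> box" for u v
    proof (rule connected_sin_pos)
      show "connected (side ` (E \<times> box))"
      proof (rule connected_continuous_image)
        show "continuous_on (E \<times> box) side"
          using EZ by (auto intro: continuous_on_subset[OF side(1)] simp: box_def)
        show "connected (E \<times> box)" by (intro connected_Times connE convex_connected box(2))
      qed
      show "0 < sin x" if x: "x \<in> side ` (E \<times> box)" for x
      proof -
        obtain u v where uv: "u \<in> E" "v \<in> box" "x = side (u, v)" using x by auto
        then obtain r where "r > 0" "sin x = r * Re (G u - G v)"
          using sin[of u v] EZ by (auto simp: box_def)
        moreover have "Re (G v) < Re (G u)"
          using uv u1[of v] R3[of u] Enorm EZ by force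
        ultimately show ?thesis by simp
      qed
      show "side (u, m) \<in> side ` (E \<times> box)" using u m by auto
      show "0 \<le> side (u, m)"
        using right[OF convex_connected[OF \<open>convex Z\<close>] order_refl, of m u] mmin m(1) u EZ
        by (auto simp: box_def)
      show "side (u, v) \<in> side ` (E \<times> box)" using u v by auto
    qed
    have "u \<in> E" if "u \<in> Z" "2 * R < cmod u" for u
    proof (rule ccontr)
      assume "u \<notin> E"
      then have "Re u \<le> R" "Im u \<le> R" "- R \<le> Im u" "c \<le> Re u" using that by (auto simp: E_def Z_def)
      moreover have "\<bar>c\<bar> < R" by (simp add: R_def)
      ultimately have "\<bar>Re u\<bar> \<le> R" "\<bar>Im u\<bar> \<le> R" by linarith+
      then show False using cmod_le[of u] that by linarith
    qed
    then have "0 < side (u, v)" if "u \<in> Z" "v \<in> B \<inter> Z" "2 * R < cmod u" for u v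
      using that b by (intro pos) (force simp: box_def R2_def)+
    then show ?thesis by blast
  qed
  show thesis using side small rightmost far by (rule that)
qed

section \<open>Lifting through an entire function\<close>

lemma transcendental_entire_not_constant:
  assumes "transcendental_entire f"
  shows "\<not> f constant_on UNIV"
proof
  assume "f constant_on UNIV"
  then obtain c where "\<And>z. f z = c" by (auto simp: constant_on_def)
  then have "f = poly [:c:]" by auto
  then show False using assms by (auto simp: transcendental_entire_def)
qed

text \<open>Along a curve whose image converges to a point that is not an asymptotic value, an entire function
  has a finite limit point; it is the limit because the fibres are discrete.\<close>

lemma lifted_curve_converges:
  fixes f :: "complex \<Rightarrow> complex" and \<gamma> :: "real \<Rightarrow> complex"
  assumes f: "f holomorphic_on UNIV" "\<not> f constant_on UNIV"
    and \<gamma>: "continuous_on {0..<1} \<gamma>" "((\<lambda>t. f (\<gamma> t)) \<longlongrightarrow> c) (at_left 1)"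
    and c: "c \<notin> asymptotic_values f"
  obtains z where "(\<gamma> \<longlongrightarrow> z) (at_left 1)" "f z = c"
proof -
  have contf: "continuous_on UNIV f" using f(1) by (rule holomorphic_on_imp_continuous_on)
  \<comment> \<open>The domain of a curve in the definition of an asymptotic value is \<open>[0, \<infinity>)\<close>.\<close>
  define \<phi> :: "real \<Rightarrow> real" where "\<phi> = (\<lambda>s. s / (1 + s))"
  have \<phi>lim: "filterlim \<phi> (at_left 1) at_top"
    unfolding \<phi>_def by real_asymp
  have "\<not> filterlim \<gamma> at_infinity (at_left 1)"
  proof
    assume inf: "filterlim \<gamma> at_infinity (at_left 1)"
    have "continuous_on {0..} (\<gamma> \<circ> \<phi>)"
    proof (rule continuous_on_compose)
      show "continuous_on {0..} \<phi>" unfolding \<phi>_def by (intro continuous_intros) auto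
      show "continuous_on (\<phi> ` {0..}) \<gamma>"
        by (rule continuous_on_subset[OF \<gamma>(1)]) (auto simp: \<phi>_def)
    qed
    moreover have "filterlim (\<gamma> \<circ> \<phi>) at_infinity at_top"
      unfolding comp_def by (rule filterlim_compose[OF inf \<phi>lim])
    moreover have "((\<lambda>t. f ((\<gamma> \<circ> \<phi>) t)) \<longlongrightarrow> c) at_top"
      unfolding comp_def by (rule filterlim_compose[OF \<gamma>(2) \<phi>lim])
    ultimately have "c \<in> asymptotic_values f" unfolding asymptotic_values_def by blast
    with c show False by contradiction
  qed
  then obtain R where R: "R > 0" "\<not> eventually (\<lambda>t. R \<le> cmod (\<gamma> t)) (at_left 1)"
    using filterlim_at_infinity[of 0 \<gamma> "at_left 1"] by auto
  have freq: "\<exists>t. b < t \<and> t < 1 \<and> cmod (\<gamma> t) < R" if "b < 1" for b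
  proof (rule ccontr)
    assume "\<not> ?thesis"
    then have "eventually (\<lambda>t. R \<le> cmod (\<gamma> t)) (at_left 1)"
      unfolding eventually_at_left_field using that not_less by (intro exI[of _ b]) auto
    then show False using R(2) by blast
  qed
  have "\<exists>t. 1 - 1 / real (Suc n) < t \<and> t < 1 \<and> cmod (\<gamma> t) < R" for n
    by (rule freq) simp
  then obtain \<tau> where \<tau>: "\<And>n. 1 - 1 / real (Suc n) < \<tau> n" "\<And>n. \<tau> n < 1" "\<And>n. cmod (\<gamma> (\<tau> n)) < R"
    by metis
  obtain z r where zr: "strict_mono r" "((\<gamma> \<circ> \<tau>) \<circ> r) \<longlonglongrightarrow> z"
    using compact_cball[of "0::complex" R] \<tau>(3)
    by (metis (no_types, lifting) comp_apply compact_def less_imp_le mem_cball_0)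
  have "\<tau> \<longlonglongrightarrow> 1"
  proof (rule tendsto_sandwich)
    show "\<forall>\<^sub>F n in sequentially. 1 - 1 / real (Suc n) \<le> \<tau> n" using \<tau>(1) by (auto intro: always_eventually less_imp_le)
    show "\<forall>\<^sub>F n in sequentially. \<tau> n \<le> 1" using \<tau>(2) by (auto intro: always_eventually less_imp_le)
    show "(\<lambda>n. 1 - 1 / real (Suc n)) \<longlonglongrightarrow> 1" by real_asymp
  qed auto
  then have "filterlim \<tau> (at_left 1) sequentially"
    using \<tau>(2) by (auto simp: filterlim_at less_imp_neq intro: always_eventually)
  then have \<tau>r: "filterlim (\<tau> \<circ> r) (at_left 1) sequentially"
    unfolding comp_def by (rule filterlim_compose) (rule filterlim_subseq[OF zr(1)])
  have fz: "f z = c"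
  proof (rule LIMSEQ_unique)
    have "isCont f z" using contf by (simp add: continuous_on_eq_continuous_at)
    then show "(\<lambda>n. f (((\<gamma> \<circ> \<tau>) \<circ> r) n)) \<longlonglongrightarrow> f z" using zr(2) by (rule isCont_tendsto_compose)
    show "(\<lambda>n. f (((\<gamma> \<circ> \<tau>) \<circ> r) n)) \<longlonglongrightarrow> c"
      using filterlim_compose[OF \<gamma>(2) \<tau>r] by (simp add: comp_def)
  qed
  have "(\<gamma> \<longlongrightarrow> z) (at_left 1)"
  proof (rule tendstoI)
    fix e :: real assume e: "e > 0"
    obtain \<rho> where \<rho>: "\<rho> > 0" "\<And>w. w \<in> ball z \<rho> - {z} \<Longrightarrow> f w \<noteq> c"
    proof -
      obtain w0 where w0: "f w0 - c \<noteq> 0"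
        using f(2) by (auto simp: constant_on_def)
      have "(\<lambda>w. f w - c) holomorphic_on UNIV" using f(1) by (intro holomorphic_intros)
      then obtain \<rho> where "\<rho> > 0" "\<And>w. w \<in> ball z \<rho> - {z} \<Longrightarrow> f w - c \<noteq> 0"
        by (rule isolated_zeros[of _ UNIV z w0]) (use w0 fz in auto)
      then show thesis by (intro that) auto
    qed
    define s where "s = min (\<rho> / 2) (e / 2)"
    have s: "0 < s" "s < \<rho>" "s < e" using \<rho>(1) e by (auto simp: s_def)
    have "compact (sphere z s)" "sphere z s \<noteq> {}" using s by auto
    moreover have "continuous_on (sphere z s) (\<lambda>w. cmod (f w - c))"
      by (intro continuous_on_norm continuous_on_diff continuous_on_const continuous_on_subset[OF contf]) simp
    ultimately obtain w1 where w1: "w1 \<in> sphere z s" "\<And>w. w \<in> sphere z s \<Longrightarrow> cmod (f w1 - c) \<le> cmod (f w - c)"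
      using continuous_attains_inf[of "sphere z s" "\<lambda>w. cmod (f w - c)"] by blast
    have "f w1 \<noteq> c" using w1(1) \<rho>(2)[of w1] s by auto
    then have "eventually (\<lambda>t. dist (f (\<gamma> t)) c < cmod (f w1 - c)) (at_left 1)"
      using \<gamma>(2) by (intro tendstoD) auto
    then obtain b where b: "b < 1" "\<And>t. b < t \<Longrightarrow> t < 1 \<Longrightarrow> dist (f (\<gamma> t)) c < cmod (f w1 - c)"
      unfolding eventually_at_left_field by auto
    define b' where "b' = max b 0"
    have off: "\<gamma> t \<notin> sphere z s" if "t \<in> {b'<..<1}" for t
      using that b(2)[of t] w1(2)[of "\<gamma> t"] by (auto simp: b'_def dist_norm)
    have conn: "connected (\<gamma> ` {b'<..<1})"
      by (intro connected_continuous_image continuous_on_subset[OF \<gamma>(1)]) (auto simp: b'_def)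
    have "eventually (\<lambda>n. dist (((\<gamma> \<circ> \<tau>) \<circ> r) n) z < s) sequentially" using zr(2) s(1) by (rule tendstoD)
    moreover have "eventually (\<lambda>n. b' < (\<tau> \<circ> r) n) sequentially"
    proof -
      have "eventually (\<lambda>t. b' < t) (at_left 1)"
        unfolding eventually_at_left_field using b(1) by (intro exI[of _ b']) (auto simp: b'_def)
      then show ?thesis using \<tau>r by (simp add: filterlim_iff)
    qed
    ultimately have "eventually (\<lambda>n. dist (((\<gamma> \<circ> \<tau>) \<circ> r) n) z < s \<and> b' < (\<tau> \<circ> r) n) sequentially"
      by (rule eventually_conj)
    then obtain n where n: "dist (((\<gamma> \<circ> \<tau>) \<circ> r) n) z < s" "b' < (\<tau> \<circ> r) n"
      using eventually_happens'[OF sequentially_bot] by blast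
    have "\<gamma> ` {b'<..<1} \<subseteq> ball z s"
    proof (rule ccontr)
      assume "\<not> \<gamma> ` {b'<..<1} \<subseteq> ball z s"
      moreover have "\<gamma> ` {b'<..<1} \<inter> ball z s \<noteq> {}"
      proof -
        have "\<tau> (r n) \<in> {b'<..<1}" using n \<tau>(2) by simp
        moreover have "\<gamma> (\<tau> (r n)) \<in> ball z s" using n(1) by (simp add: dist_commute)
        ultimately show ?thesis by blast
      qed
      ultimately have "\<gamma> ` {b'<..<1} \<inter> frontier (ball z s) \<noteq> {}"
        using connected_Int_frontier[OF conn] by blast
      then show False using off s by auto
    qed
    then have "dist (\<gamma> t) z < e" if "b' < t" "t < 1" for t
      using that s(3) by (force simp: dist_commute)
    then show "eventually (\<lambda>t. dist (\<gamma> t) z < e) (at_left 1)"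
      unfolding eventually_at_left_field using b(1) by (intro exI[of _ b']) (auto simp: b'_def)
  qed
  then show thesis using fz by (rule that)
qed

text \<open>Holomorphic lifts are unique: locally \<open>f\<close> is injective, so that the set where two lifts agree is open
  as well as closed.\<close>

lemma holomorphic_lift_unique:
  assumes f: "f holomorphic_on UNIV"
    and U: "connected U" and g: "continuous_on U g" "continuous_on U h"
    and eq: "\<And>w. w \<in> U \<Longrightarrow> f (g w) = f (h w)" and crit: "\<And>w. w \<in> U \<Longrightarrow> deriv f (g w) \<noteq> 0"
    and a: "a \<in> U" "g a = h a" and w: "w \<in> U"
  shows "g w = h w"
proof -
  have "openin (top_of_set U) {w \<in> U. g w = h w}"
  proof (subst openin_subopen, intro ballI)
    fix x assume "x \<in> {w \<in> U. g w = h w}"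
    then have x: "x \<in> U" "g x = h x" by auto
    obtain r where r: "r > 0" "inj_on f (ball (g x) r)"
      using has_complex_derivative_locally_injective[OF f _ _ crit[OF x(1)]] by auto
    define T where "T = (U \<inter> g -` ball (g x) r) \<inter> (U \<inter> h -` ball (g x) r)"
    have "openin (top_of_set U) T"
      unfolding T_def using g by (intro openin_Int continuous_openin_preimage_gen) auto
    moreover have "x \<in> T" using x r by (auto simp: T_def)
    moreover have "T \<subseteq> {w \<in> U. g w = h w}"
      using r(2) eq by (auto simp: T_def inj_on_def)
    ultimately show "\<exists>T. openin (top_of_set U) T \<and> x \<in> T \<and> T \<subseteq> {w \<in> U. g w = h w}" by blast
  qed
  moreover have "closedin (top_of_set U) {w \<in> U. g w = h w}"
  proof -
    have "{w \<in> U. g w = h w} = U \<inter> (\<lambda>w. g w - h w) -` {0}" by auto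
    then show ?thesis using g by (simp add: continuous_closedin_preimage continuous_on_diff)
  qed
  ultimately have "{w \<in> U. g w = h w} = U"
    using U a connected_clopen by blast
  then show ?thesis using w by blast
qed

lemma holomorphic_on_if_locally:
  assumes "\<And>x. x \<in> S \<Longrightarrow> \<exists>N h. open N \<and> x \<in> N \<and> h holomorphic_on N \<and> (\<forall>w\<in>N. g w = h w)"
  shows "g holomorphic_on S"
  unfolding holomorphic_on_def
proof
  fix x assume "x \<in> S"
  then obtain N h where N: "open N" "x \<in> N" "h holomorphic_on N" "\<forall>w\<in>N. g w = h w"
    using assms by blast
  have "g holomorphic_on N" using N by (metis holomorphic_transform)
  then have "g field_differentiable (at x)"
    using N holomorphic_on_imp_differentiable_at by blast
  then show "g field_differentiable at x within S"
    by (rule field_differentiable_at_within)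
qed

definition regular_values :: "(complex \<Rightarrow> complex) \<Rightarrow> complex set" where
  "regular_values f = - (critical_values f \<union> asymptotic_values f)"

lemma regular_values_deriv: "f z \<in> regular_values f \<Longrightarrow> deriv f z \<noteq> 0"
  by (auto simp: regular_values_def critical_values_def)

definition holomorphic_lift ::
  "(complex \<Rightarrow> complex) \<Rightarrow> (complex \<Rightarrow> complex) \<Rightarrow> complex set \<Rightarrow> (complex \<Rightarrow> complex) \<Rightarrow> bool" where
  "holomorphic_lift f Q U G \<longleftrightarrow> G holomorphic_on U \<and> (\<forall>w\<in>U. f (G w) = Q w)"

lemma holomorphic_lift_subset: "holomorphic_lift f Q U G \<Longrightarrow> V \<subseteq> U \<Longrightarrow> holomorphic_lift f Q V G"
  by (auto simp: holomorphic_lift_def intro: holomorphic_on_subset)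

lemma holomorphic_lifts_agree:
  assumes "f holomorphic_on UNIV" "connected U" "\<And>w. w \<in> U \<Longrightarrow> Q w \<in> regular_values f"
    and "holomorphic_lift f Q U G" "holomorphic_lift f Q U G'" "a \<in> U" "G a = G' a" "w \<in> U"
  shows "G w = G' w"
  using assms regular_values_deriv
  by (intro holomorphic_lift_unique[of f U G G' a w])
    (auto simp: holomorphic_lift_def intro: holomorphic_on_imp_continuous_on)

lemma local_holomorphic_lift:
  assumes f: "f holomorphic_on UNIV" and Q: "Q holomorphic_on U" "open U" "c \<in> U"
    and z: "f z = Q c" "Q c \<in> regular_values f"
  obtains s r h where "s > 0" "ball c s \<subseteq> U" "holomorphic_lift f Q (ball c s) h" "h c = z"
    "r > 0" "inj_on f (ball z r)" "h ` ball c s \<subseteq> ball z r"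
proof -
  obtain r where r: "r > 0" "inj_on f (ball z r)"
    using has_complex_derivative_locally_injective[OF f, of z] regular_values_deriv[of f z] z by auto
  have fball: "f holomorphic_on ball z r" using f by (rule holomorphic_on_subset) auto
  then obtain k where k: "k holomorphic_on (f ` ball z r)"
      "\<And>w. w \<in> ball z r \<Longrightarrow> deriv f w * deriv k (f w) = 1"
      "\<And>w. w \<in> ball z r \<Longrightarrow> k (f w) = w"
    by (rule holomorphic_has_inverse[OF _ open_ball r(2)]) blast
  have ofb: "open (f ` ball z r)" using open_mapping_thm3[OF fball _ r(2)] by simp
  have "open (U \<inter> Q -` (f ` ball z r))"
    using Q ofb by (intro continuous_open_preimage holomorphic_on_imp_continuous_on) auto
  moreover have "c \<in> U \<inter> Q -` (f ` ball z r)" using Q(3) z(1) r(1) by (auto intro!: image_eqI[of _ f z])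
  ultimately obtain s where s: "s > 0" "ball c s \<subseteq> U \<inter> Q -` (f ` ball z r)"
    using open_contains_ball by blast
  show thesis
  proof (rule that)
    show "holomorphic_lift f Q (ball c s) (k \<circ> Q)"
      unfolding holomorphic_lift_def
    proof
      show "k \<circ> Q holomorphic_on ball c s"
        by (rule holomorphic_on_compose_gen[OF holomorphic_on_subset[OF Q(1)] k(1)]) (use s in auto)
      show "\<forall>w\<in>ball c s. f ((k \<circ> Q) w) = Q w"
      proof
        fix w assume "w \<in> ball c s"
        then obtain x where "x \<in> ball z r" "Q w = f x" using s by blast
        then show "f ((k \<circ> Q) w) = Q w" using k(3) by simp
      qed
    qed
    show "(k \<circ> Q) c = z" using k(3)[of z] r(1) z(1) by simp
    show "(k \<circ> Q) ` ball c s \<subseteq> ball z r"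
    proof clarify
      fix w assume "w \<in> ball c s"
      then obtain x where "x \<in> ball z r" "Q w = f x" using s by blast
      then show "(k \<circ> Q) w \<in> ball z r" using k(3) by simp
    qed
  qed (use s r in auto)
qed

text \<open>Along the radius that ends at \<open>c\<close>, the lift has a finite limit, and the local inverse of \<open>f\<close> there
  continues it.\<close>

lemma lift_extends_across_boundary_point:
  assumes f: "f holomorphic_on UNIV" "\<not> f constant_on UNIV"
    and Q: "Q holomorphic_on U" "open U" "\<And>w. w \<in> U \<Longrightarrow> Q w \<in> regular_values f"
    and G: "holomorphic_lift f Q (ball b \<rho>) G" "ball b \<rho> \<subseteq> U" "\<rho> > 0"
    and c: "c \<in> sphere b \<rho>" "c \<in> U"
  obtains s h where "s > 0" "ball c s \<subseteq> U" "holomorphic_lift f Q (ball c s) h"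
    "\<And>w. w \<in> ball c s \<inter> ball b \<rho> \<Longrightarrow> h w = G w"
proof -
  define ray where "ray = (\<lambda>t. b + of_real t * (c - b))"
  have ray_in: "ray t \<in> ball b \<rho>" if "0 \<le> t" "t < 1" for t
    using that c(1) G(3) by (simp add: ray_def dist_norm norm_mult norm_minus_commute)
  have ray_lim: "(ray \<longlongrightarrow> c) (at_left 1)"
    unfolding ray_def by (auto intro!: tendsto_eq_intros)
  define \<gamma> where "\<gamma> = G \<circ> ray"
  have "continuous_on {0..<1} \<gamma>" unfolding \<gamma>_def
  proof (rule continuous_on_compose)
    show "continuous_on {0..<1} ray" unfolding ray_def by (intro continuous_intros)
    show "continuous_on (ray ` {0..<1}) G"
      using G(1) ray_in by (auto simp: holomorphic_lift_def
          intro!: continuous_on_subset[OF holomorphic_on_imp_continuous_on])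
  qed
  moreover have "((\<lambda>t. f (\<gamma> t)) \<longlongrightarrow> Q c) (at_left 1)"
  proof (rule Lim_transform_eventually)
    have "isCont Q c"
      using Q c(2) holomorphic_on_imp_continuous_on continuous_on_eq_continuous_at by blast
    then show "((\<lambda>t. Q (ray t)) \<longlongrightarrow> Q c) (at_left 1)" using ray_lim by (rule isCont_tendsto_compose)
    show "\<forall>\<^sub>F t in at_left 1. Q (ray t) = f (\<gamma> t)"
      unfolding eventually_at_left_field \<gamma>_def using G(1) ray_in
      by (intro exI[of _ 0]) (auto simp: holomorphic_lift_def)
  qed
  moreover have "Q c \<notin> asymptotic_values f" using Q(3)[OF c(2)] by (auto simp: regular_values_def)
  ultimately obtain z where z: "(\<gamma> \<longlongrightarrow> z) (at_left 1)" "f z = Q c"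
    using lifted_curve_converges[OF f] by blast
  obtain s r h where h: "s > 0" "ball c s \<subseteq> U" "holomorphic_lift f Q (ball c s) h"
    and r: "r > 0" "inj_on f (ball z r)" "h ` ball c s \<subseteq> ball z r"
    using local_holomorphic_lift[OF f(1) Q(1,2) c(2) z(2) Q(3)[OF c(2)]] by metis
  have "\<forall>\<^sub>F t in at_left 1. dist (\<gamma> t) z < r \<and> dist (ray t) c < s \<and> 0 < t \<and> t < 1"
    using tendstoD[OF z(1) r(1)] tendstoD[OF ray_lim h(1)]
    by (intro eventually_conj) (auto simp: eventually_at_left_field intro: exI[of _ "0::real"])
  then obtain t where t: "dist (\<gamma> t) z < r" "dist (ray t) c < s" "0 < t" "t < 1"
    using eventually_happens'[OF trivial_limit_at_left_real] by blast
  define a where "a = ray t"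
  have a: "a \<in> ball c s \<inter> ball b \<rho>" using t ray_in[of t] by (auto simp: a_def dist_commute)
  have ha: "h a = G a"
  proof (rule inj_onD[OF r(2)])
    show "f (h a) = f (G a)" using a h(3) G(1) by (auto simp: holomorphic_lift_def)
    show "h a \<in> ball z r" using r(3) a by blast
    show "G a \<in> ball z r" using t by (auto simp: \<gamma>_def a_def dist_commute)
  qed
  have "h w = G w" if w: "w \<in> ball c s \<inter> ball b \<rho>" for w
  proof (rule holomorphic_lifts_agree[where G = h and G' = G and Q = Q and a = a, OF f(1)])
    show "connected (ball c s \<inter> ball b \<rho>)" by (intro convex_connected convex_Int) auto
    show "Q w \<in> regular_values f" if "w \<in> ball c s \<inter> ball b \<rho>" for w using that Q(3) h(2) by blast
    show "holomorphic_lift f Q (ball c s \<inter> ball b \<rho>) h" "holomorphic_lift f Q (ball c s \<inter> ball b \<rho>) G"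
      using h(3) G(1) by (auto intro: holomorphic_lift_subset)
  qed (use a ha w in auto)
  then show thesis using h by (intro that)
qed

text \<open>The continuations across the boundary points fit together, because any two of them agree with \<open>G\<close> on a
  common part of the disc. Compactness of the circle provides a uniform radius \<open>e\<close>; with \<open>e / 3\<close> in the
  definition of the extension, the continuations used at nearby points are defined on overlapping discs.\<close>

lemma lift_extends_to_larger_disc:
  assumes f: "f holomorphic_on UNIV" "\<not> f constant_on UNIV"
    and Q: "Q holomorphic_on U" "open U" "\<And>w. w \<in> U \<Longrightarrow> Q w \<in> regular_values f"
    and G: "holomorphic_lift f Q (ball b \<rho>) G" "cball b \<rho> \<subseteq> U" "\<rho> > 0"
  obtains \<rho>' G' where "\<rho> < \<rho>'" "holomorphic_lift f Q (ball b \<rho>') G'" "G' b = G b"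
proof -
  define good where "good = (\<lambda>B. \<exists>h. holomorphic_lift f Q B h \<and> (\<forall>w \<in> B \<inter> ball b \<rho>. h w = G w))"
  have ball_good: "\<exists>s>0. ball c s \<subseteq> U \<and> good (ball c s)" if c: "c \<in> sphere b \<rho>" for c
  proof -
    have "ball b \<rho> \<subseteq> U" "c \<in> U" using G(2) c by auto
    then obtain s h where "s > 0" "ball c s \<subseteq> U" "holomorphic_lift f Q (ball c s) h"
      "\<And>w. w \<in> ball c s \<inter> ball b \<rho> \<Longrightarrow> h w = G w"
      using lift_extends_across_boundary_point[OF f Q G(1) _ G(3) c] by metis
    then show ?thesis unfolding good_def by blast
  qed
  define \<G> where "\<G> = {B. open B \<and> B \<subseteq> U \<and> good B}"
  have "sphere b \<rho> \<subseteq> \<Union>\<G>"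
  proof
    fix c assume "c \<in> sphere b \<rho>"
    then obtain s where "s > 0" "ball c s \<in> \<G>" using ball_good by (auto simp: \<G>_def)
    then show "c \<in> \<Union>\<G>" by (meson UnionI centre_in_ball)
  qed
  then obtain e where e: "0 < e" "\<And>c. c \<in> sphere b \<rho> \<Longrightarrow> \<exists>B\<in>\<G>. ball c e \<subseteq> B"
    by (rule Heine_Borel_lemma[OF compact_sphere]) (simp_all add: \<G>_def)
  have "\<exists>h. ball c e \<subseteq> U \<and> holomorphic_lift f Q (ball c e) h \<and> (\<forall>w \<in> ball c e \<inter> ball b \<rho>. h w = G w)"
    if "c \<in> sphere b \<rho>" for c
    using e(2)[OF that] unfolding \<G>_def good_def by (blast intro: holomorphic_lift_subset)
  then obtain H where H: "\<And>c. c \<in> sphere b \<rho> \<Longrightarrow> ball c e \<subseteq> U"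
      "\<And>c. c \<in> sphere b \<rho> \<Longrightarrow> holomorphic_lift f Q (ball c e) (H c)"
      "\<And>c w. c \<in> sphere b \<rho> \<Longrightarrow> w \<in> ball c e \<inter> ball b \<rho> \<Longrightarrow> H c w = G w"
    by metis
  have H_agree: "H c w = H c' w"
    if c: "c \<in> sphere b \<rho>" "c' \<in> sphere b \<rho>" "dist c c' < e" and w: "w \<in> ball c e \<inter> ball c' e" for c c' w
  proof -
    have "c \<in> closure (ball b \<rho>)" using c(1) G(3) by auto
    moreover have "open (ball c e \<inter> ball c' e)" "c \<in> ball c e \<inter> ball c' e"
      using e(1) c(3) by (auto simp: dist_commute)
    ultimately have "ball b \<rho> \<inter> (ball c e \<inter> ball c' e) \<noteq> {}"
      by (meson closure_iff_nhds_not_empty order_refl)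
    then obtain a where a: "a \<in> ball b \<rho>" "a \<in> ball c e \<inter> ball c' e" by blast
    show ?thesis
    proof (rule holomorphic_lifts_agree[where G = "H c" and G' = "H c'" and Q = Q and a = a, OF f(1)])
      show "connected (ball c e \<inter> ball c' e)" by (intro convex_connected convex_Int) auto
      show "Q w \<in> regular_values f" if "w \<in> ball c e \<inter> ball c' e" for w using that Q(3) H(1) c by blast
      show "holomorphic_lift f Q (ball c e \<inter> ball c' e) (H c)" "holomorphic_lift f Q (ball c e \<inter> ball c' e) (H c')"
        using H(2) c by (auto intro: holomorphic_lift_subset)
      show "H c a = H c' a" using H(3)[of c a] H(3)[of c' a] a c by auto
    qed (use a w in auto)
  qed
  have "\<exists>c. c \<in> sphere b \<rho> \<and> dist w c < e / 3" if w: "w \<in> ball b (\<rho> + e / 3) - ball b \<rho>" for w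
  proof -
    define n where "n = cmod (w - b)"
    have n: "\<rho> \<le> n" "n < \<rho> + e / 3" "n > 0" using w G(3) by (auto simp: n_def dist_norm norm_minus_commute)
    define c where "c = b + of_real (\<rho> / n) * (w - b)"
    have "c \<in> sphere b \<rho>" using n G(3) by (simp add: c_def dist_norm norm_mult norm_divide n_def[symmetric])
    moreover have "dist w c = n - \<rho>"
    proof -
      have "w - c = of_real (1 - \<rho> / n) * (w - b)" by (simp add: c_def algebra_simps)
      then have "cmod (w - c) = \<bar>1 - \<rho> / n\<bar> * n" unfolding n_def by (metis norm_mult norm_of_real)
      moreover have "\<bar>1 - \<rho> / n\<bar> * n = n - \<rho>" using n by (simp add: algebra_simps)
      ultimately show ?thesis by (simp add: dist_norm)
    qed
    ultimately show ?thesis using n by (intro exI[of _ c]) simp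
  qed
  then obtain \<pi> where \<pi>: "\<And>w. w \<in> ball b (\<rho> + e / 3) - ball b \<rho> \<Longrightarrow> \<pi> w \<in> sphere b \<rho>"
    "\<And>w. w \<in> ball b (\<rho> + e / 3) - ball b \<rho> \<Longrightarrow> dist w (\<pi> w) < e / 3"
    by metis
  define G' where "G' = (\<lambda>w. if w \<in> ball b \<rho> then G w else H (\<pi> w) w)"
  have "G' holomorphic_on ball b (\<rho> + e / 3)"
  proof (rule holomorphic_on_if_locally)
    fix w0 assume w0: "w0 \<in> ball b (\<rho> + e / 3)"
    show "\<exists>N h. open N \<and> w0 \<in> N \<and> h holomorphic_on N \<and> (\<forall>w\<in>N. G' w = h w)"
    proof (cases "w0 \<in> ball b \<rho>")
      case True
      then show ?thesis using G(1)
        by (intro exI[of _ "ball b \<rho>"] exI[of _ G]) (auto simp: G'_def holomorphic_lift_def)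
    next
      case False
      define c where "c = \<pi> w0"
      have c: "c \<in> sphere b \<rho>" "dist w0 c < e / 3" using \<pi> w0 False by (auto simp: c_def)
      define N where "N = ball w0 (e / 3) \<inter> ball b (\<rho> + e / 3)"
      have Nc: "w \<in> ball c e" if "w \<in> N" for w
      proof -
        have "dist c w \<le> dist w0 c + dist w0 w" by (metis dist_triangle dist_commute add.commute)
        moreover have "dist w0 w < e / 3" using that by (simp add: N_def)
        ultimately show ?thesis using c e(1) by simp
      qed
      have "G' w = H c w" if w: "w \<in> N" for w
      proof (cases "w \<in> ball b \<rho>")
        case True
        then show ?thesis using H(3)[OF c(1)] Nc[OF w] by (simp add: G'_def)
      next
        case False
        then have p: "\<pi> w \<in> sphere b \<rho>" "dist w (\<pi> w) < e / 3" using \<pi> w by (auto simp: N_def)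
        have "dist (\<pi> w) c \<le> dist w (\<pi> w) + dist w0 w + dist w0 c"
          by (smt (verit) dist_commute dist_triangle)
        moreover have "dist w0 w < e / 3" using w by (simp add: N_def)
        ultimately have "dist (\<pi> w) c < e" using p c by linarith
        then show ?thesis using H_agree[OF p(1) c(1)] Nc[OF w] p(2) False e(1)
          by (auto simp: G'_def dist_commute)
      qed
      moreover have "H c holomorphic_on N"
        using H(2)[OF c(1)] Nc by (auto simp: holomorphic_lift_def intro: holomorphic_on_subset)
      ultimately show ?thesis using w0 e(1)
        by (intro exI[of _ N] exI[of _ "H c"]) (auto simp: N_def)
    qed
  qed
  moreover have "f (G' w) = Q w" if w: "w \<in> ball b (\<rho> + e / 3)" for w
  proof (cases "w \<in> ball b \<rho>")
    case True
    then show ?thesis using G(1) by (auto simp: G'_def holomorphic_lift_def)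
  next
    case False
    then have p: "\<pi> w \<in> sphere b \<rho>" "dist w (\<pi> w) < e / 3" using \<pi> w by auto
    then show ?thesis using H(2)[OF p(1)] False e(1) by (auto simp: G'_def holomorphic_lift_def dist_commute)
  qed
  ultimately have "holomorphic_lift f Q (ball b (\<rho> + e / 3)) G'" by (auto simp: holomorphic_lift_def)
  moreover have "G' b = G b" using G(3) by (simp add: G'_def)
  ultimately show thesis using e(1) by (intro that[of "\<rho> + e / 3" G']) auto
qed

text \<open>By the extension lemma, the supremum of the radii over which a lift exists is the full radius.\<close>

proposition holomorphic_lift_exists_ball:
  assumes f: "f holomorphic_on UNIV" "\<not> f constant_on UNIV"
    and Q: "Q holomorphic_on ball b r" "\<And>w. w \<in> ball b r \<Longrightarrow> Q w \<in> regular_values f" "r > 0"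
    and z: "f z = Q b"
  obtains G where "holomorphic_lift f Q (ball b r) G" "G b = z"
proof -
  define lifts where "lifts = (\<lambda>\<rho> G. holomorphic_lift f Q (ball b \<rho>) G \<and> G b = z)"
  define A where "A = {\<rho>. 0 < \<rho> \<and> \<rho> \<le> r \<and> Ex (lifts \<rho>)}"
  have union: "R \<in> A" if R: "0 < R" "R \<le> r" and ex: "\<And>\<rho>. 0 < \<rho> \<Longrightarrow> \<rho> < R \<Longrightarrow> \<rho> \<in> A" for R
  proof -
    have "\<exists>G. \<forall>\<rho>. 0 < \<rho> \<and> \<rho> < R \<longrightarrow> lifts \<rho> (G \<rho>)"
      using ex by (intro choice) (auto simp: A_def)
    then obtain g where g: "\<And>\<rho>. 0 < \<rho> \<Longrightarrow> \<rho> < R \<Longrightarrow> lifts \<rho> (g \<rho>)" by blast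
    define m where "m = (\<lambda>w. (dist b w + R) / 2)"
    have m: "0 < m w" "m w < R" "w \<in> ball b (m w)" if "w \<in> ball b R" for w
      using that by (auto simp: m_def add_nonneg_pos R(1))
    have agree: "g \<rho> w = g \<rho>' w" if "0 < \<rho>" "\<rho> < R" "0 < \<rho>'" "\<rho>' < R" "w \<in> ball b \<rho>" "w \<in> ball b \<rho>'" for \<rho> \<rho>' w
    proof (rule holomorphic_lifts_agree[where G = "g \<rho>" and G' = "g \<rho>'" and Q = Q and a = b, OF f(1)])
      show "connected (ball b (min \<rho> \<rho>'))" by simp
      show "Q w \<in> regular_values f" if "w \<in> ball b (min \<rho> \<rho>')" for w
        using that \<open>\<rho> < R\<close> R(2) Q(2) by auto
      show "holomorphic_lift f Q (ball b (min \<rho> \<rho>')) (g \<rho>)" "holomorphic_lift f Q (ball b (min \<rho> \<rho>')) (g \<rho>')"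
        using g[of \<rho>] g[of \<rho>'] that
        by (auto simp: lifts_def intro: holomorphic_lift_subset[of _ _ "ball b \<rho>"]
            holomorphic_lift_subset[of _ _ "ball b \<rho>'"])
      show "g \<rho> b = g \<rho>' b" using g that by (simp add: lifts_def)
    qed (use that in auto)
    define G where "G = (\<lambda>w. g (m w) w)"
    have Geq: "G w = g \<rho> w" if "0 < \<rho>" "\<rho> < R" "w \<in> ball b \<rho>" for \<rho> w
      unfolding G_def using that m[of w] by (intro agree) auto
    have "G holomorphic_on ball b R"
    proof (rule holomorphic_on_if_locally)
      fix w assume "w \<in> ball b R"
      note mw = m[OF this]
      show "\<exists>N h. open N \<and> w \<in> N \<and> h holomorphic_on N \<and> (\<forall>w\<in>N. G w = h w)"
        using mw g[OF mw(1,2)] Geq[OF mw(1,2)]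
        by (intro exI[of _ "ball b (m w)"] exI[of _ "g (m w)"]) (auto simp: lifts_def holomorphic_lift_def)
    qed
    moreover have "f (G w) = Q w" if "w \<in> ball b R" for w
      using g[OF m(1,2)[OF that]] m(3)[OF that] by (auto simp: lifts_def holomorphic_lift_def G_def)
    moreover have "G b = z" using g[of "m b"] m[of b] R by (auto simp: lifts_def G_def)
    ultimately show "R \<in> A" unfolding A_def lifts_def holomorphic_lift_def using R by blast
  qed
  have down: "\<rho> \<in> A" if d: "\<rho>' \<in> A" "0 < \<rho>" "\<rho> \<le> \<rho>'" for \<rho> \<rho>'
  proof -
    have "ball b \<rho> \<subseteq> ball b \<rho>'" using d by auto
    moreover obtain G where G: "holomorphic_lift f Q (ball b \<rho>') G" "G b = z" "\<rho>' \<le> r"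
      using d(1) by (auto simp: A_def lifts_def)
    ultimately have "lifts \<rho> G"
      unfolding lifts_def using holomorphic_lift_subset by blast
    then show ?thesis using d G(3) by (auto simp: A_def)
  qed
  have ne: "A \<noteq> {}"
  proof -
    obtain s k h where h: "s > 0" "ball b s \<subseteq> ball b r" "holomorphic_lift f Q (ball b s) h" "h b = z"
      using local_holomorphic_lift[OF f(1) Q(1) open_ball _ z Q(2)] Q(3) by (metis centre_in_ball)
    then have "min s r \<in> A" unfolding A_def lifts_def using Q(3)
      by (auto intro!: exI[of _ h] holomorphic_lift_subset[of f Q "ball b s" h])
    then show ?thesis by blast
  qed
  have bdd: "bdd_above A" by (auto simp: A_def)
  define R where "R = Sup A"
  obtain \<rho>0 where "\<rho>0 \<in> A" using ne by blast
  then have R: "0 < R" "R \<le> r"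
    using cSup_upper[OF _ bdd, of \<rho>0] cSup_least[OF ne, of r] by (auto simp: R_def A_def)
  have "R \<in> A"
  proof (rule union[OF R])
    fix \<rho> assume "0 < \<rho>" "\<rho> < R"
    moreover obtain \<rho>' where "\<rho>' \<in> A" "\<rho> < \<rho>'"
      using less_cSup_iff[OF ne bdd, of \<rho>] \<open>\<rho> < R\<close> by (auto simp: R_def)
    ultimately show "\<rho> \<in> A" using down by auto
  qed
  moreover have "R = r"
  proof (rule ccontr)
    assume "R \<noteq> r"
    with R have lt: "R < r" by simp
    obtain G where G: "lifts R G" using \<open>R \<in> A\<close> by (auto simp: A_def)
    obtain \<rho>' G' where G': "R < \<rho>'" "holomorphic_lift f Q (ball b \<rho>') G'" "G' b = G b"
    proof (rule lift_extends_to_larger_disc[OF f Q(1) open_ball Q(2)])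
      show "holomorphic_lift f Q (ball b R) G" using G by (simp add: lifts_def)
      show "cball b R \<subseteq> ball b r" using lt R by auto
    qed (use R in auto)
    have "min \<rho>' r \<in> A" unfolding A_def lifts_def using G' G R lt
      by (auto simp: lifts_def intro!: exI[of _ G'] holomorphic_lift_subset[of f Q "ball b \<rho>'" G'])
    then have "min \<rho>' r \<le> R" unfolding R_def using bdd by (intro cSup_upper) auto
    then show False using G'(1) lt by auto
  qed
  ultimately show thesis using that by (auto simp: A_def lifts_def)
qed

text \<open>The disc and the half-plane are related by the coordinate \<open>\<zeta> \<mapsto> (u0 + \<zeta> * cnj u0) / (1 - \<zeta>)\<close>.\<close>

corollary holomorphic_lift_exists_half_plane:
  assumes f: "f holomorphic_on UNIV" "\<not> f constant_on UNIV"
    and Q: "Q holomorphic_on right_half_plane" "\<And>w. 0 < Re w \<Longrightarrow> Q w \<in> regular_values f"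
    and u0: "0 < Re u0" and z: "f z = Q u0"
  obtains G where "holomorphic_lift f Q right_half_plane G" "G u0 = z"
proof -
  define \<psi> where "\<psi> = (\<lambda>\<zeta>. (u0 + \<zeta> * cnj u0) / (1 - \<zeta>))"
  define \<phi> where "\<phi> = (\<lambda>u. (u - u0) / (u + cnj u0))"
  have \<psi>: "\<psi> holomorphic_on ball 0 1" "\<And>\<zeta>. cmod \<zeta> < 1 \<Longrightarrow> 0 < Re (\<psi> \<zeta>)" "\<And>u. 0 < Re u \<Longrightarrow> \<psi> (\<phi> u) = u"
    unfolding \<psi>_def \<phi>_def using inverse_Cayley[OF u0] by auto
  have \<phi>: "\<phi> holomorphic_on right_half_plane" "\<And>u. 0 < Re u \<Longrightarrow> cmod (\<phi> u) < 1"
    unfolding \<phi>_def using Cayley_lt_1[OF u0] add_cnj_nonzero[OF _ u0] by (auto intro!: holomorphic_intros)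
  have "(Q \<circ> \<psi>) holomorphic_on ball 0 1"
    by (rule holomorphic_on_compose_gen[OF \<psi>(1) Q(1)]) (use \<psi> in auto)
  then obtain G where G: "holomorphic_lift f (Q \<circ> \<psi>) (ball 0 1) G" "G 0 = z"
    using holomorphic_lift_exists_ball[OF f, of "Q \<circ> \<psi>" 0 1 z] Q(2) \<psi>(2) z by (auto simp: \<psi>_def)
  have "(G \<circ> \<phi>) holomorphic_on right_half_plane"
    by (rule holomorphic_on_compose_gen[OF \<phi>(1), of _ "ball 0 1"])
      (use G \<phi> in \<open>auto simp: holomorphic_lift_def\<close>)
  then have "holomorphic_lift f Q right_half_plane (G \<circ> \<phi>)"
    using G(1) \<phi>(2) \<psi>(3) by (auto simp: holomorphic_lift_def)
  moreover have "(G \<circ> \<phi>) u0 = z" using G(2) by (simp add: \<phi>_def)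
  ultimately show thesis by (rule that)
qed

section \<open>Logarithmic coordinates near infinity\<close>

text \<open>A clopen part of \<open>K - {p}\<close> that misses a punctured disc around \<open>p\<close> is clopen in \<open>K\<close>; the punctured
  disc is connected and lies in one of the two parts of any separation.\<close>

lemma connected_delete_interior_point:
  fixes K :: "complex set"
  assumes K: "connected K" and p: "p \<in> interior K"
  shows "connected (K - {p})"
proof -
  obtain e where e: "e > 0" "ball p e \<subseteq> K" using p by (auto simp: mem_interior)
  have away: "T = {}" if T: "openin (top_of_set (K - {p})) T" "closedin (top_of_set (K - {p})) T"
    and disj: "T \<inter> (ball p e - {p}) = {}" for T
  proof -
    have sub: "T \<subseteq> K - {p}" using T(1) by (rule openin_imp_subset)
    have K': "openin (top_of_set K) (K - {p})" by (simp add: openin_delete)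
    have opT: "openin (top_of_set K) T" using T(1) K' by (rule openin_trans)
    have "openin (top_of_set (K - {p})) (K - {p} - T)" using T(2) by (simp add: openin_diff)
    then have "openin (top_of_set K) (K - {p} - T)" using K' by (rule openin_trans)
    then have "openin (top_of_set K) ((K - {p} - T) \<union> (K \<inter> ball p e))"
      by (intro openin_Un) (auto simp: openin_open_Int)
    moreover have "(K - {p} - T) \<union> (K \<inter> ball p e) = K - T" using sub disj e by auto
    ultimately have "closedin (top_of_set K) T" using sub by (simp add: closedin_def) blast
    with opT K have "T = {} \<or> T = K" by (simp add: connected_clopen)
    then show ?thesis using sub e by force
  qed
  show ?thesis unfolding connected_clopen
  proof (intro allI impI)
    fix T assume T: "openin (top_of_set (K - {p})) T \<and> closedin (top_of_set (K - {p})) T"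
    have sub: "T \<subseteq> K - {p}" using T openin_imp_subset by blast
    have BK: "ball p e - {p} \<subseteq> K - {p}" using e by auto
    have "openin (top_of_set (ball p e - {p})) ((ball p e - {p}) \<inter> T)"
    proof -
      obtain U where "open U" "T = (K - {p}) \<inter> U" using T unfolding openin_open by blast
      moreover from this have "(ball p e - {p}) \<inter> T = (ball p e - {p}) \<inter> U" using BK by blast
      ultimately show ?thesis by (simp only: openin_open_Int)
    qed
    moreover have "closedin (top_of_set (ball p e - {p})) ((ball p e - {p}) \<inter> T)"
    proof -
      obtain U where "closed U" "T = (K - {p}) \<inter> U" using T unfolding closedin_closed by blast
      moreover from this have "(ball p e - {p}) \<inter> T = (ball p e - {p}) \<inter> U" using BK by blast
      ultimately show ?thesis by (simp only: closedin_closed_Int)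
    qed
    moreover have "connected (ball p e - {p})" by (intro connected_open_delete) auto
    ultimately have "(ball p e - {p}) \<inter> T = {} \<or> (ball p e - {p}) \<inter> T = ball p e - {p}"
      unfolding connected_clopen by blast
    then consider "T \<inter> (ball p e - {p}) = {}" | "(K - {p} - T) \<inter> (ball p e - {p}) = {}" by blast
    then show "T = {} \<or> T = K - {p}"
    proof cases
      case 1 then show ?thesis using away T by blast
    next
      case 2
      have "openin (top_of_set (K - {p})) (K - {p} - T)" "closedin (top_of_set (K - {p})) (K - {p} - T)"
        using T by (auto intro: openin_diff closedin_diff)
      then have "K - {p} - T = {}" using away 2 by blast
      then show ?thesis using sub by blast
    qed
  qed
qed

text \<open>For a compact connected set \<open>K\<close> with connected complement \<open>W\<close> and interior point \<open>p\<close>, the set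
  \<open>W\<close> together with infinity is simply connected. A Riemann map of its image under \<open>1 / (z - p)\<close>
  thus gives, after composition with the exponential, a universal cover \<open>P\<close> of \<open>W\<close> by the right half-plane.
  It plays the role of \<open>exp\<close>, with the advantage that the domain of the logarithmic coordinate is a
  half-plane. The last three assumptions of the locale describe \<open>P\<close> near the ends \<open>Re u \<rightarrow> \<infinity>\<close> and
  \<open>Re u \<rightarrow> 0\<close>, which correspond to infinity and to the boundary of \<open>W\<close>.\<close>

locale exponential_cover =
  fixes W :: "complex set" and P :: "complex \<Rightarrow> complex"
  assumes open_W: "open W"
    and P_holomorphic: "P holomorphic_on right_half_plane"
    and P_image: "P ` right_half_plane = W"
    and P_eq_iff: "\<And>u v. 0 < Re u \<Longrightarrow> 0 < Re v \<Longrightarrow> P u = P v \<longleftrightarrow> (\<exists>k::int. u = v + 2 * pi * k * \<i>)"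
    and P_lift: "\<And>g u0 b. g holomorphic_on right_half_plane \<Longrightarrow> g ` right_half_plane \<subseteq> W \<Longrightarrow>
      0 < Re u0 \<Longrightarrow> 0 < Re b \<Longrightarrow> P b = g u0 \<Longrightarrow>
      \<exists>h. h holomorphic_on right_half_plane \<and> (\<forall>u. 0 < Re u \<longrightarrow> 0 < Re (h u) \<and> P (h u) = g u) \<and> h u0 = b"
    and P_bounded: "\<And>M. \<exists>R. \<forall>u. 0 < Re u \<and> Re u \<le> M \<longrightarrow> cmod (P u) \<le> R"
    and P_infinity: "\<And>R. \<exists>M. \<forall>u. 0 < Re u \<and> M < Re u \<longrightarrow> R < cmod (P u)"
    and Re_bounded_below: "\<And>E. closed E \<Longrightarrow> E \<subseteq> W \<Longrightarrow> \<exists>c>0. \<forall>u. 0 < Re u \<and> P u \<in> E \<longrightarrow> c \<le> Re u"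

proposition exists_exponential_cover:
  assumes K: "compact K" "connected K" "connected (- K)" "p \<in> interior K"
  obtains P where "exponential_cover (- K) P"
proof -
  define j where "j = (\<lambda>\<omega>. p + inverse \<omega>)"
  define \<Omega> where "\<Omega> = {\<omega>. \<omega> = 0 \<or> j \<omega> \<in> - K}"
  have pK: "p \<in> K" using K(4) interior_subset by blast
  obtain e where e: "e > 0" "ball p e \<subseteq> K" using K(4) by (auto simp: mem_interior)
  obtain B where B: "B > 0" "K \<subseteq> ball p B"
    using compact_imp_bounded[OF K(1)] bounded_subset_ballD[of K p] by auto
  have contj: "continuous_on (- {0}) j" unfolding j_def by (intro continuous_intros) auto
  have near0: "ball 0 (1 / B) \<subseteq> \<Omega>"
  proof
    fix \<omega> :: complex assume "\<omega> \<in> ball 0 (1 / B)"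
    then have "\<omega> \<noteq> 0 \<Longrightarrow> B < cmod (inverse \<omega>)"
      using B(1) by (simp add: norm_inverse inverse_eq_divide norm_divide pos_less_divide_eq mult.commute)
    then have "\<omega> \<noteq> 0 \<Longrightarrow> j \<omega> \<notin> ball p B" by (simp add: j_def dist_norm)
    then show "\<omega> \<in> \<Omega>" using B(2) by (auto simp: \<Omega>_def)
  qed
  have j_open: "open (- {0} \<inter> j -` S)" if "open S" for S
    using contj that by (intro continuous_open_preimage) auto
  have "\<Omega> = (- {0} \<inter> j -` (- K)) \<union> ball 0 (1 / B)"
    using near0 B(1) by (auto simp: \<Omega>_def)
  moreover have "open (- {0} \<inter> j -` (- K))"
    using K(1) by (intro j_open open_Compl compact_imp_closed)
  ultimately have op: "open \<Omega>" by (simp only: open_Un open_ball)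
  have j_image: "(\<lambda>z. inverse (z - p)) ` (S - {p}) = {\<omega>. \<omega> \<noteq> 0 \<and> j \<omega> \<in> S}" for S
  proof (intro set_eqI iffI)
    fix \<omega> assume "\<omega> \<in> {\<omega>. \<omega> \<noteq> 0 \<and> j \<omega> \<in> S}"
    then have "j \<omega> \<in> S - {p}" "\<omega> = inverse (j \<omega> - p)" by (auto simp: j_def)
    then show "\<omega> \<in> (\<lambda>z. inverse (z - p)) ` (S - {p})" by blast
  qed (auto simp: j_def)
  have conn_image: "connected {\<omega>. \<omega> \<noteq> 0 \<and> j \<omega> \<in> S}" if "connected (S - {p})" for S
    unfolding j_image[symmetric] using that by (intro connected_continuous_image continuous_intros) auto
  have "bounded \<Omega>"
  proof (rule boundedI)
    fix \<omega> assume "\<omega> \<in> \<Omega>"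
    then have "\<omega> \<noteq> 0 \<Longrightarrow> e \<le> cmod (inverse \<omega>)" using e(2) by (force simp: \<Omega>_def j_def dist_norm)
    then show "cmod \<omega> \<le> 1 / e" using e(1) by (cases "\<omega> = 0") (auto simp: norm_inverse norm_divide field_simps)
  qed
  moreover have "connected \<Omega>"
  proof (rule connected_intermediate_closure)
    have "- K - {p} = - K" using pK by auto
    then show "connected {\<omega>. \<omega> \<noteq> 0 \<and> j \<omega> \<in> - K}" using conn_image[of "- K"] K(3) by (simp only:)
    show "{\<omega>. \<omega> \<noteq> 0 \<and> j \<omega> \<in> - K} \<subseteq> \<Omega>" by (auto simp: \<Omega>_def)
    have "0 \<in> closure (ball 0 (1 / B) - {0::complex})"
      using B(1) by (simp add: islimpt_in_closure[symmetric] islimpt_ball)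
    moreover have "ball 0 (1 / B) - {0} \<subseteq> {\<omega>. \<omega> \<noteq> 0 \<and> j \<omega> \<in> - K}" using near0 by (auto simp: \<Omega>_def)
    ultimately have "0 \<in> closure {\<omega>. \<omega> \<noteq> 0 \<and> j \<omega> \<in> - K}" using closure_mono by blast
    moreover have "{\<omega>. \<omega> \<noteq> 0 \<and> j \<omega> \<in> - K} \<subseteq> closure {\<omega>. \<omega> \<noteq> 0 \<and> j \<omega> \<in> - K}" by (rule closure_subset)
    moreover have "\<Omega> \<subseteq> insert 0 {\<omega>. \<omega> \<noteq> 0 \<and> j \<omega> \<in> - K}" by (auto simp: \<Omega>_def)
    ultimately show "\<Omega> \<subseteq> closure {\<omega>. \<omega> \<noteq> 0 \<and> j \<omega> \<in> - K}" by blast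
  qed
  moreover have "connected (- \<Omega>)"
  proof -
    have "- \<Omega> = {\<omega>. \<omega> \<noteq> 0 \<and> j \<omega> \<in> K}" by (auto simp: \<Omega>_def)
    then show ?thesis using conn_image[OF connected_delete_interior_point[OF K(2,4)]] by (simp only:)
  qed
  ultimately have "simply_connected \<Omega>" using op by (simp add: simply_connected_iff_simple)
  have "\<Omega> \<noteq> UNIV" using \<open>bounded \<Omega>\<close> by auto
  have 0: "0 \<in> \<Omega>" by (simp add: \<Omega>_def)
  obtain \<phi> \<rho> where \<phi>: "\<phi> holomorphic_on \<Omega>" "\<rho> holomorphic_on ball 0 1"
    "\<And>z. z \<in> \<Omega> \<Longrightarrow> \<phi> z \<in> ball 0 1 \<and> \<rho> (\<phi> z) = z" "\<And>z. z \<in> ball 0 1 \<Longrightarrow> \<rho> z \<in> \<Omega> \<and> \<phi> (\<rho> z) = z"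
  proof -
    have "\<exists>f g. f holomorphic_on \<Omega> \<and> g holomorphic_on ball 0 1 \<and>
        (\<forall>z\<in>\<Omega>. f z \<in> ball 0 1 \<and> g (f z) = z) \<and> (\<forall>z\<in>ball 0 1. g z \<in> \<Omega> \<and> f (g z) = z)"
      using Riemann_mapping_theorem[of \<Omega>] op \<open>simply_connected \<Omega>\<close> \<open>\<Omega> \<noteq> UNIV\<close> 0 by blast
    then show thesis using that by blast
  qed
  obtain m n where mn: "m (\<phi> 0) = 0" "m holomorphic_on ball 0 1" "m ` ball 0 1 \<subseteq> ball 0 1"
    "n holomorphic_on ball 0 1" "n ` ball 0 1 \<subseteq> ball 0 1"
    "\<And>z. z \<in> ball 0 1 \<Longrightarrow> m (n z) = z" "\<And>z. z \<in> ball 0 1 \<Longrightarrow> n (m z) = z"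
    using ball_biholomorphism_exists[of "\<phi> 0"] \<phi>(3)[OF 0] by blast
  define \<Phi> where "\<Phi> = m \<circ> \<phi>"
  define r where "r = \<rho> \<circ> n"
  have \<Phi>: "\<Phi> holomorphic_on \<Omega>" "\<Phi> 0 = 0"
  proof -
    have "\<phi> ` \<Omega> \<subseteq> ball 0 1" using \<phi>(3) by blast
    then show "\<Phi> holomorphic_on \<Omega>"
      unfolding \<Phi>_def by (rule holomorphic_on_compose_gen[OF \<phi>(1) mn(2)])
  qed (simp add: \<Phi>_def mn(1))
  have r: "r holomorphic_on ball 0 1"
    unfolding r_def by (rule holomorphic_on_compose_gen[OF mn(4) \<phi>(2) mn(5)])
  have \<Phi>r: "\<Phi> z \<in> ball 0 1" "r (\<Phi> z) = z" if "z \<in> \<Omega>" for z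
    using \<phi>(3)[OF that] mn(3,7) by (auto simp: \<Phi>_def r_def image_subset_iff)
  have r\<Phi>: "r z \<in> \<Omega>" "\<Phi> (r z) = z" if "z \<in> ball 0 1" for z
  proof -
    have "n z \<in> ball 0 1" using mn(5) that by blast
    then show "r z \<in> \<Omega>" "\<Phi> (r z) = z"
      using \<phi>(4)[of "n z"] mn(6)[OF that] by (auto simp: \<Phi>_def r_def)
  qed
  have r0: "r 0 = 0" using \<Phi>r(2)[OF 0] \<Phi>(2) by simp
  have r_nz: "r z \<noteq> 0" if "z \<in> ball 0 1" "z \<noteq> 0" for z using r\<Phi>(2)[OF that(1)] that(2) \<Phi>(2) by auto
  define E where "E = (\<lambda>u::complex. exp (- u))"
  have E: "E u \<in> ball 0 1" "E u \<noteq> 0" if "0 < Re u" for u using that by (auto simp: E_def)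
  define P where "P = (\<lambda>u. j (r (E u)))"
  have holP: "P holomorphic_on right_half_plane"
  proof -
    have "(r \<circ> E) holomorphic_on right_half_plane"
      by (rule holomorphic_on_compose_gen[OF _ r]) (use E in \<open>auto simp: E_def intro!: holomorphic_intros\<close>)
    then show ?thesis unfolding P_def j_def using r_nz E by (intro holomorphic_intros) (auto simp: o_def)
  qed
  have PE: "r (E u) = inverse (P u - p)" "E u = \<Phi> (inverse (P u - p))" if "0 < Re u" for u
    using r\<Phi>(2)[OF E(1)[OF that]] by (auto simp: P_def j_def)
  have PW: "P u \<in> - K" if "0 < Re u" for u
    using r\<Phi>(1)[OF E(1)[OF that]] r_nz[OF E[OF that]] by (simp add: P_def \<Omega>_def)
  have inv_in: "inverse (z - p) \<in> \<Omega>" "inverse (z - p) \<noteq> 0" if "z \<in> - K" for z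
    using that pK by (auto simp: \<Omega>_def j_def)
  have Pinv: "P u = z" if "E u = \<Phi> (inverse (z - p))" "z \<in> - K" for u z
    using that \<Phi>r(2)[OF inv_in(1)[OF that(2)]] by (simp add: P_def j_def)
  have \<Phi>_nz: "\<Phi> z \<noteq> 0" if "z \<in> \<Omega>" "z \<noteq> 0" for z using \<Phi>r(2)[OF that(1)] r0 that(2) by auto
  have image: "P ` right_half_plane = - K"
  proof
    show "P ` right_half_plane \<subseteq> - K" using PW by auto
    show "- K \<subseteq> P ` right_half_plane"
    proof
      fix z assume z: "z \<in> - K"
      define u where "u = - Ln (\<Phi> (inverse (z - p)))"
      have nz: "\<Phi> (inverse (z - p)) \<noteq> 0" using \<Phi>_nz inv_in[OF z] by blast
      have "E u = \<Phi> (inverse (z - p))" using nz by (simp add: E_def u_def)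
      moreover have "0 < Re u" using \<Phi>r(1)[OF inv_in(1)[OF z]] nz by (simp add: u_def)
      ultimately show "z \<in> P ` right_half_plane" using Pinv z by (metis image_eqI right_half_plane_simps)
    qed
  qed
  have eq_iff: "P u = P v \<longleftrightarrow> (\<exists>k::int. u = v + 2 * pi * k * \<i>)" if "0 < Re u" "0 < Re v" for u v
  proof
    assume "P u = P v"
    then have "E u = E v" using PE that by simp
    then have "exp u = exp v" by (simp add: E_def exp_minus)
    then show "\<exists>k::int. u = v + 2 * pi * k * \<i>" by (auto simp: exp_eq algebra_simps)
  next
    assume "\<exists>k::int. u = v + 2 * pi * k * \<i>"
    then have "exp u = exp v" by (subst exp_eq) (auto simp: algebra_simps)
    then show "P u = P v" by (simp add: P_def E_def exp_minus)
  qed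
  have "exponential_cover (- K) P"
  proof
    show "open (- K)" using K(1) by (simp add: compact_imp_closed open_Compl)
    show "P holomorphic_on right_half_plane" "P ` right_half_plane = - K" by fact+
    show "P u = P v \<longleftrightarrow> (\<exists>k::int. u = v + 2 * pi * k * \<i>)" if "0 < Re u" "0 < Re v" for u v
      using that by (rule eq_iff)
    show "\<exists>h. h holomorphic_on right_half_plane \<and> (\<forall>u. 0 < Re u \<longrightarrow> 0 < Re (h u) \<and> P (h u) = g u) \<and> h u0 = b"
      if g: "g holomorphic_on right_half_plane" "g ` right_half_plane \<subseteq> - K"
        and b: "0 < Re u0" "0 < Re b" "P b = g u0" for g u0 b
    proof -
      have gW: "g u \<in> - K" if "0 < Re u" for u using g(2) that by (auto simp: image_subset_iff)
      have "(\<lambda>u. inverse (g u - p)) holomorphic_on right_half_plane"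
        using g pK gW by (intro holomorphic_intros) auto
      then have "(\<Phi> \<circ> (\<lambda>u. inverse (g u - p))) holomorphic_on right_half_plane"
        by (rule holomorphic_on_compose_gen[OF _ \<Phi>(1)]) (use inv_in gW in auto)
      moreover have "contractible right_half_plane"
        by (simp add: convex_imp_contractible convex_right_half_plane)
      ultimately obtain l where l: "l holomorphic_on right_half_plane"
        "\<And>u. u \<in> right_half_plane \<Longrightarrow> (\<Phi> \<circ> (\<lambda>u. inverse (g u - p))) u = exp (l u)"
        using contractible_imp_holomorphic_log[of "\<Phi> \<circ> (\<lambda>u. inverse (g u - p))" right_half_plane]
          \<Phi>_nz inv_in gW by (metis comp_apply right_half_plane_simps)
      have El: "E (- l u) = \<Phi> (inverse (g u - p))" if "0 < Re u" for u
        using l(2)[of u] that by (simp add: E_def)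
      have Pl: "P (- l u) = g u" if "0 < Re u" for u
        using Pinv[OF El[OF that] gW[OF that]] .
      have Rel: "0 < Re (- l u)" if "0 < Re u" for u
      proof -
        have "cmod (E (- l u)) < 1" using \<Phi>r(1)[OF inv_in(1)[OF gW[OF that]]] El[OF that] by simp
        then show ?thesis by (simp add: E_def)
      qed
      have "P b = P (- l u0)" using b Pl by simp
      then obtain k :: int where k: "b = - l u0 + 2 * pi * k * \<i>"
        using eq_iff[OF b(2) Rel[OF b(1)]] by blast
      define h where "h = (\<lambda>u. - l u + 2 * pi * k * \<i>)"
      have "h holomorphic_on right_half_plane" unfolding h_def using l(1) by (intro holomorphic_intros)
      moreover have "0 < Re (h u)" "P (h u) = g u" if "0 < Re u" for u
      proof -
        show *: "0 < Re (h u)" using Rel[OF that] by (simp add: h_def)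
        have "P (h u) = P (- l u)" using eq_iff[OF * Rel[OF that]] by (auto simp: h_def)
        then show "P (h u) = g u" using Pl[OF that] by simp
      qed
      moreover have "h u0 = b" using k by (simp add: h_def)
      ultimately show ?thesis by blast
    qed
    show "\<exists>R. \<forall>u. 0 < Re u \<and> Re u \<le> M \<longrightarrow> cmod (P u) \<le> R" for M
    proof -
      have "isCont \<Phi> 0"
        using \<Phi>(1) op 0 holomorphic_on_imp_continuous_on continuous_on_eq_continuous_at by blast
      then have "\<exists>\<delta>>0. \<forall>\<omega>. dist \<omega> 0 < \<delta> \<longrightarrow> dist (\<Phi> \<omega>) (\<Phi> 0) < exp (- M)"
        unfolding continuous_at_eps_delta by simp
      then obtain \<delta> where \<delta>: "\<delta> > 0" "\<And>\<omega>. cmod \<omega> < \<delta> \<Longrightarrow> cmod (\<Phi> \<omega>) < exp (- M)"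
        using \<Phi>(2) by auto
      have "cmod (P u) \<le> cmod p + 1 / \<delta>" if u: "0 < Re u" "Re u \<le> M" for u
      proof -
        have "exp (- M) \<le> cmod (\<Phi> (r (E u)))"
          using u r\<Phi>(2)[OF E(1)[OF u(1)]] by (simp add: E_def)
        then have "\<delta> \<le> cmod (r (E u))" using \<delta>(2) not_less by fastforce
        then have "cmod (inverse (r (E u))) \<le> 1 / \<delta>"
          using \<delta>(1) by (simp add: norm_inverse norm_divide inverse_eq_divide frac_le)
        then show ?thesis unfolding P_def j_def by (meson add_left_mono norm_triangle_le)
      qed
      then show ?thesis by blast
    qed
    show "\<exists>M. \<forall>u. 0 < Re u \<and> M < Re u \<longrightarrow> R < cmod (P u)" for R
    proof -
      define \<epsilon> where "\<epsilon> = 1 / (\<bar>R\<bar> + cmod p + 1)"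
      have \<epsilon>: "\<epsilon> > 0" by (simp add: \<epsilon>_def add_nonneg_pos)
      have "isCont r 0"
        using r holomorphic_on_imp_continuous_on continuous_on_eq_continuous_at[of "ball 0 1"] by force
      then have "\<exists>\<delta>>0. \<forall>z. dist z 0 < \<delta> \<longrightarrow> dist (r z) (r 0) < \<epsilon>"
        using \<epsilon> unfolding continuous_at_eps_delta by simp
      then obtain \<delta> where \<delta>: "\<delta> > 0" "\<And>z. cmod z < \<delta> \<Longrightarrow> cmod (r z) < \<epsilon>" using r0 by auto
      have "R < cmod (P u)" if u: "0 < Re u" "- ln \<delta> < Re u" for u
      proof -
        have "exp (- Re u) < exp (ln \<delta>)" using u by simp
        then have "cmod (E u) < \<delta>" using \<delta>(1) by (simp add: E_def)
        then have "cmod (r (E u)) < \<epsilon>" by (rule \<delta>(2))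
        moreover have "0 < cmod (r (E u))" using r_nz[OF E[OF u(1)]] by simp
        ultimately have "1 / \<epsilon> < cmod (inverse (r (E u)))"
          by (simp add: norm_inverse norm_divide inverse_eq_divide frac_less2)
        then have "\<bar>R\<bar> + cmod p + 1 < cmod (inverse (r (E u)))" by (simp add: \<epsilon>_def)
        moreover have "cmod (inverse (r (E u))) \<le> cmod (P u) + cmod p"
          using norm_triangle_ineq4[of "P u" p] by (simp add: P_def j_def)
        ultimately show ?thesis by linarith
      qed
      then show ?thesis by blast
    qed
    show "\<exists>c>0. \<forall>u. 0 < Re u \<and> P u \<in> F \<longrightarrow> c \<le> Re u" if F: "closed F" "F \<subseteq> - K" for F
    proof -
      define F' where "F' = {\<omega>. \<omega> = 0 \<or> j \<omega> \<in> F}"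
      have "- F' = - {0} \<inter> j -` (- F)" by (auto simp: F'_def)
      then have "closed F'" using j_open[of "- F"] F(1) by (metis closed_open open_Compl)
      moreover have sub: "F' \<subseteq> \<Omega>" using F(2) by (auto simp: F'_def \<Omega>_def)
      ultimately have "compact F'" using \<open>bounded \<Omega>\<close> bounded_subset compact_eq_bounded_closed by blast
      moreover have "continuous_on F' (\<lambda>z. cmod (\<Phi> z))"
        using \<Phi>(1) sub by (intro continuous_intros)
          (auto intro: holomorphic_on_imp_continuous_on holomorphic_on_subset)
      moreover have "F' \<noteq> {}" by (auto simp: F'_def)
      ultimately obtain \<omega>0 where \<omega>0: "\<omega>0 \<in> F'" "\<And>\<omega>. \<omega> \<in> F' \<Longrightarrow> cmod (\<Phi> \<omega>) \<le> cmod (\<Phi> \<omega>0)"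
        using continuous_attains_sup[of F' "\<lambda>z. cmod (\<Phi> z)"] by blast
      define s where "s = max (1 / 2) (cmod (\<Phi> \<omega>0))"
      have s: "0 < s" "s < 1" using \<Phi>r(1)[of \<omega>0] \<omega>0(1) sub by (auto simp: s_def)
      have "- ln s \<le> Re u" if u: "0 < Re u" "P u \<in> F" for u
      proof -
        have "inverse (P u - p) \<in> F'" using u by (simp add: F'_def j_def)
        then have "cmod (\<Phi> (inverse (P u - p))) \<le> s" using \<omega>0(2) by (auto simp: s_def le_max_iff_disj)
        then have "cmod (E u) \<le> s" using PE(2)[OF u(1)] by simp
        then have "exp (- Re u) \<le> exp (ln s)" using s by (simp add: E_def)
        then show ?thesis by simp
      qed
      moreover have "0 < - ln s" using s by simp
      ultimately show ?thesis by blast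
    qed
  qed
  then show thesis by (rule that)
qed

section \<open>Inverse branches over a neighbourhood of infinity\<close>

lemma holomorphic_power_iterate: "f holomorphic_on UNIV \<Longrightarrow> (f ^^ n) holomorphic_on UNIV"
  by (induction n) (auto simp: id_def[symmetric] intro: holomorphic_on_compose_gen holomorphic_on_id)

lemma transcendental_not_tending_to_infinity:
  assumes f: "transcendental_entire f"
    and inf: "\<And>R. \<exists>B. \<forall>z. B < cmod z \<longrightarrow> R < cmod (f z)"
  shows False
proof -
  have "filterlim f at_infinity at_infinity"
    unfolding filterlim_at_infinity[OF order_refl]
  proof (intro allI impI)
    fix R :: real
    obtain B where B: "\<And>z. B < cmod z \<Longrightarrow> R < cmod (f z)" using inf by blast
    show "\<forall>\<^sub>F z in at_infinity. R \<le> cmod (f z)"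
      unfolding eventually_at_infinity using B by (intro exI[of _ "B + 1"]) (force intro: less_imp_le)
  qed
  then have "((inverse \<circ> f) \<longlongrightarrow> 0) at_infinity"
    unfolding comp_def by (rule filterlim_compose[OF tendsto_inverse_0])
  then obtain a n where "\<And>z. f z = (\<Sum>i\<le>n. a i * z ^ i)"
    using pole_at_infinity[of f 0] f by (metis transcendental_entire_def)
  then have "f = poly (\<Sum>i\<le>n. monom (a i) i)"
    by (auto simp: poly_sum poly_monom)
  then show False using f by (auto simp: transcendental_entire_def)
qed

locale log_tracts = exponential_cover W P for W P +
  fixes f :: "complex \<Rightarrow> complex"
  assumes f_transcendental: "transcendental_entire f"
    and W_regular: "W \<subseteq> regular_values f"
    and W_backward: "\<And>z. f z \<in> W \<Longrightarrow> z \<in> W"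
begin

lemma f_holomorphic: "f holomorphic_on UNIV"
  using f_transcendental by (simp add: transcendental_entire_def)

lemma f_continuous: "continuous_on S f"
  using f_holomorphic holomorphic_on_imp_continuous_on continuous_on_subset by blast

lemma f_bounded_on_cball: obtains R' where "\<And>z. cmod z \<le> R \<Longrightarrow> cmod (f z) \<le> R'"
proof -
  have "compact (f ` cball 0 R)" by (intro compact_continuous_image f_continuous) auto
  then have "bounded (f ` cball 0 R)" by (rule compact_imp_bounded)
  then obtain R' where "\<forall>w\<in>f ` cball 0 R. cmod w \<le> R'" unfolding bounded_iff by (rule exE)
  then show thesis by (intro that) auto
qed

lemma P_in_W: "0 < Re u \<Longrightarrow> P u \<in> W"
  using P_image by auto

lemma P_continuous: "continuous_on right_half_plane P"
  using P_holomorphic by (rule holomorphic_on_imp_continuous_on)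

text \<open>An inverse branch of \<open>f\<close>, as a function of the logarithmic coordinate.\<close>

definition inverse_branch :: "(complex \<Rightarrow> complex) \<Rightarrow> bool" where
  "inverse_branch g \<longleftrightarrow> holomorphic_lift f P right_half_plane g"

lemma inverse_branch_eq: "inverse_branch g \<Longrightarrow> 0 < Re u \<Longrightarrow> f (g u) = P u"
  by (simp add: inverse_branch_def holomorphic_lift_def)

lemma inverse_branch_holomorphic: "inverse_branch g \<Longrightarrow> g holomorphic_on right_half_plane"
  by (simp add: inverse_branch_def holomorphic_lift_def)

lemma inverse_branch_exists:
  assumes "0 < Re u" "f z = P u"
  obtains g where "inverse_branch g" "g u = z"
  unfolding inverse_branch_def
  using holomorphic_lift_exists_half_plane[OF f_holomorphic
      transcendental_entire_not_constant[OF f_transcendental] P_holomorphic _ assms]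
    P_in_W W_regular by blast

lemma inverse_branches_agree:
  assumes "inverse_branch g" "inverse_branch h" "0 < Re u" "g u = h u" "0 < Re v"
  shows "g v = h v"
proof (rule holomorphic_lifts_agree[where G = g and G' = h and U = right_half_plane and Q = P and a = u,
        OF f_holomorphic])
  show "connected right_half_plane" by (rule convex_connected[OF convex_right_half_plane])
  show "P w \<in> regular_values f" if "w \<in> right_half_plane" for w
    using that P_in_W W_regular by auto
qed (use assms in \<open>simp_all add: inverse_branch_def\<close>)

lemma P_translate: "0 < Re u \<Longrightarrow> P (u + 2 * pi * of_int k * \<i>) = P u"
  by (subst P_eq_iff) auto

lemma inverse_branch_translate:
  assumes "inverse_branch g"
  shows "inverse_branch (\<lambda>u. g (u + 2 * pi * of_int k * \<i>))"
  unfolding inverse_branch_def holomorphic_lift_def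
proof
  have "(g \<circ> (\<lambda>u. u + 2 * pi * of_int k * \<i>)) holomorphic_on right_half_plane"
    by (rule holomorphic_on_compose_gen[OF _ inverse_branch_holomorphic[OF assms]])
      (auto intro!: holomorphic_intros)
  then show "(\<lambda>u. g (u + 2 * pi * of_int k * \<i>)) holomorphic_on right_half_plane"
    by (simp add: o_def)
qed (use inverse_branch_eq[OF assms] P_translate in auto)

text \<open>An inverse branch that is not injective is periodic. It would map \<open>{u. M < Re u}\<close> onto a set that
  contains a neighbourhood of infinity, so that \<open>f\<close> would tend to infinity at infinity and be a polynomial.\<close>

proposition inverse_branch_inj:
  assumes g: "inverse_branch g"
  shows "inj_on g right_half_plane"
proof (rule ccontr)
  assume "\<not> inj_on g right_half_plane"
  then obtain u0 v0 where uv: "0 < Re u0" "0 < Re v0" "g u0 = g v0" "u0 \<noteq> v0"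
    by (auto simp: inj_on_def)
  then have "P u0 = P v0" using inverse_branch_eq[OF g] by metis
  then obtain k :: int where k: "u0 = v0 + 2 * pi * of_int k * \<i>" using P_eq_iff uv by auto
  have "g (u + 2 * pi * of_int k * \<i>) = g u" if "0 < Re u" for u
    using inverse_branches_agree[OF inverse_branch_translate[OF g] g uv(2) _ that] uv(3) k by metis
  then have per1: "g (u + of_int n * (2 * pi * of_int k * \<i>)) = g u" if "0 < Re u" for u and n :: nat
    using that
  proof (induction n arbitrary: u)
    case (Suc n)
    have "g (u + of_int (Suc n) * (2 * pi * of_int k * \<i>))
        = g ((u + of_int n * (2 * pi * of_int k * \<i>)) + 2 * pi * of_int k * \<i>)"
      by (simp add: algebra_simps)
    with Suc show ?case by simp
  qed simp
  have per: "g (u + of_int n * (2 * pi * of_int k * \<i>)) = g u" if "0 < Re u" for u and n :: int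
  proof (cases "0 \<le> n")
    case True then show ?thesis using per1[OF that, of "nat n"] by simp
  next
    case False
    have "g ((u + of_int n * (2 * pi * of_int k * \<i>)) + of_int (nat (- n)) * (2 * pi * of_int k * \<i>))
        = g (u + of_int n * (2 * pi * of_int k * \<i>))"
      using that by (intro per1) simp
    then show ?thesis using False by (simp add: algebra_simps)
  qed
  have k0: "k \<noteq> 0" using k uv(4) by auto
  define p where "p = 2 * pi * \<bar>real_of_int k\<bar>"
  have p: "p > 0" using k0 by (simp add: p_def)
  \<comment> \<open>Every value is attained at a point with imaginary part in a period interval.\<close>
  have reduce: "\<exists>u'. Re u' = Re u \<and> 0 \<le> Im u' \<and> Im u' \<le> p \<and> g u' = g u" if "0 < Re u" for u
  proof -
    define m where "m = - \<lfloor>Im u / p\<rfloor>"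
    define u' where "u' = u + of_int (m * sgn k) * (2 * pi * of_int k * \<i>)"
    have sk: "real_of_int (sgn k) * real_of_int k = \<bar>real_of_int k\<bar>"
      by (metis abs_sgn mult.commute of_int_abs of_int_mult)
    have "Im u' = Im u + of_int m * (2 * pi * (real_of_int (sgn k) * real_of_int k))"
      by (simp add: u'_def)
    then have "Im u' = Im u + of_int m * p" unfolding sk by (simp add: p_def)
    moreover have "of_int \<lfloor>Im u / p\<rfloor> * p \<le> Im u" "Im u \<le> (of_int \<lfloor>Im u / p\<rfloor> + 1) * p"
      using p floor_divide_lower floor_divide_upper[of p "Im u"] by (auto intro: less_imp_le)
    ultimately have "0 \<le> Im u'" "Im u' \<le> p" by (auto simp: m_def algebra_simps)
    moreover have "g u' = g u" unfolding u'_def by (rule per[OF that])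
    moreover have "Re u' = Re u" by (simp add: u'_def)
    ultimately show ?thesis by blast
  qed
  have gcont: "continuous_on right_half_plane g"
    using inverse_branch_holomorphic[OF g] by (rule holomorphic_on_imp_continuous_on)
  have "\<exists>B. \<forall>z. B < cmod z \<longrightarrow> R < cmod (f z)" for R
  proof -
    obtain M0 where M0: "\<And>u. 0 < Re u \<Longrightarrow> M0 < Re u \<Longrightarrow> R < cmod (P u)" using P_infinity by blast
    define M where "M = max M0 1"
    have M: "M > 0" by (simp add: M_def)
    have compact_strip: "compact {u. M \<le> Re u \<and> Re u \<le> N \<and> 0 \<le> Im u \<and> Im u \<le> p}" for N
    proof -
      have "{u. M \<le> Re u \<and> Re u \<le> N \<and> 0 \<le> Im u \<and> Im u \<le> p} = cbox (Complex M 0) (Complex N p)"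
        by (auto simp: in_cbox_complex_iff)
      then show ?thesis by simp
    qed
    define S where "S = {u. M \<le> Re u \<and> Re u \<le> M \<and> 0 \<le> Im u \<and> Im u \<le> p}"
    have "compact (g ` S)" unfolding S_def
      using M by (intro compact_continuous_image compact_strip continuous_on_subset[OF gcont]) auto
    then have "bounded (g ` S)" by (rule compact_imp_bounded)
    then obtain B where B: "\<forall>z\<in>g ` S. cmod z \<le> B" unfolding bounded_iff by (rule exE)
    have B': "cmod (g u) \<le> B" if "Re u = M" for u
    proof -
      obtain u' where "Re u' = Re u" "0 \<le> Im u'" "Im u' \<le> p" "g u' = g u"
        using reduce[of u] \<open>Re u = M\<close> M by auto
      then have "g u \<in> g ` S"
        using that by (intro image_eqI[of _ g u']) (auto simp: S_def)
      then show ?thesis using B by blast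
    qed
    define V where "V = g ` {u. M < Re u}"
    define E where "E = - cball (0::complex) B"
    have connE: "connected E" unfolding E_def by (rule connected_complement_bounded_convex) auto
    have op: "openin (top_of_set E) (E \<inter> V)"
    proof (rule openin_open_Int)
      have "\<not> g constant_on X" if X: "open X" "X \<subseteq> {u. M < Re u}" "X \<noteq> {}" for X
      proof
        assume "g constant_on X"
        then obtain c where c: "\<And>u. u \<in> X \<Longrightarrow> g u = c" by (auto simp: constant_on_def)
        obtain x where "x \<in> X" using X by blast
        then obtain e where e: "e > 0" "ball x e \<subseteq> X" using \<open>open X\<close> openE by blast
        define y where "y = x + of_real (e / 2)"
        have y: "y \<in> X" using e by (auto simp: y_def dist_norm)
        have "P x = P y" using c \<open>x \<in> X\<close> y inverse_branch_eq[OF g] X(2) M by (metis mem_Collect_eq order_less_trans subsetD)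
        then obtain n :: int where "x = y + 2 * pi * n * \<i>"
          using P_eq_iff[of x y] \<open>x \<in> X\<close> y X(2) M by fastforce
        then have "Re x = Re y" by simp
        then show False using e by (simp add: y_def)
      qed
      then show "open V" unfolding V_def
        by (intro open_mapping_thm2[where S = "{u. M < Re u}"]
            holomorphic_on_subset[OF inverse_branch_holomorphic[OF g]])
          (use M in \<open>auto simp: open_halfspace_Re_gt\<close>)
    qed
    have cl: "closedin (top_of_set E) (E \<inter> V)"
      unfolding closedin_limpt
    proof (intro conjI allI impI)
      fix z assume z: "z islimpt (E \<inter> V) \<and> z \<in> E"
      then obtain x where "\<forall>n. x n \<in> E \<inter> V - {z}" "x \<longlonglongrightarrow> z"
        unfolding islimpt_sequential by blast
      with z have x: "\<And>n. x n \<in> E" "\<And>n. x n \<in> V" "z \<in> E" "x \<longlonglongrightarrow> z" by auto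
      have "\<exists>u. M < Re u \<and> 0 \<le> Im u \<and> Im u \<le> p \<and> g u = x n" for n
      proof -
        obtain u where "x n = g u" "M < Re u" using x(2)[of n] by (auto simp: V_def)
        then show ?thesis using reduce[of u] M by (metis order_less_trans)
      qed
      then obtain u where u: "\<And>n. M < Re (u n)" "\<And>n. 0 \<le> Im (u n)" "\<And>n. Im (u n) \<le> p" "\<And>n. g (u n) = x n"
        by metis
      have "bounded (range (f \<circ> x))"
        using isCont_tendsto_compose[OF _ x(4), of f] f_continuous[of UNIV]
        by (auto simp: continuous_on_eq_continuous_at o_def convergent_def intro!: convergent_imp_bounded)
      then obtain R' where R': "\<And>n. cmod (f (x n)) \<le> R'" by (auto simp: bounded_iff)
      obtain N where N: "\<And>u. 0 < Re u \<Longrightarrow> N < Re u \<Longrightarrow> R' < cmod (P u)" using P_infinity by blast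
      have "Re (u n) \<le> N" for n
        using N[of "u n"] R'[of n] inverse_branch_eq[OF g, of "u n"] u(1)[of n] u(4)[of n] M
        by (smt (verit))
      then have "\<forall>n. u n \<in> {u. M \<le> Re u \<and> Re u \<le> N \<and> 0 \<le> Im u \<and> Im u \<le> p}"
        using u by (auto intro: less_imp_le)
      then obtain l r where l: "l \<in> {u. M \<le> Re u \<and> Re u \<le> N \<and> 0 \<le> Im u \<and> Im u \<le> p}"
        "strict_mono r" "(u \<circ> r) \<longlonglongrightarrow> l"
        using compact_strip[of N] unfolding compact_def by blast
      have "isCont g l"
        using gcont l(1) M open_right_half_plane continuous_on_eq_continuous_at by fastforce
      then have "(\<lambda>n. g ((u \<circ> r) n)) \<longlonglongrightarrow> g l" using l(3) by (rule isCont_tendsto_compose)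
      moreover have "(\<lambda>n. g ((u \<circ> r) n)) \<longlonglongrightarrow> z"
        using LIMSEQ_subseq_LIMSEQ[OF x(4) l(2)] u(4) by (simp add: o_def)
      ultimately have "g l = z" by (rule LIMSEQ_unique)
      moreover have "Re l \<noteq> M" using B'[of l] \<open>g l = z\<close> x(3) by (auto simp: E_def)
      ultimately show "z \<in> E \<inter> V" using l(1) x(3) by (auto simp: V_def)
    qed auto
    have "E \<inter> V \<noteq> {}"
    proof
      assume "E \<inter> V = {}"
      then have V: "V \<subseteq> cball 0 B" by (auto simp: E_def)
      obtain R' where R': "\<And>z. cmod z \<le> B \<Longrightarrow> cmod (f z) \<le> R'" by (rule f_bounded_on_cball) blast
      obtain N where N: "\<And>u. 0 < Re u \<Longrightarrow> N < Re u \<Longrightarrow> R' < cmod (P u)" using P_infinity by blast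
      define u where "u = complex_of_real (max M N + 1)"
      have "g u \<in> V" by (auto simp: V_def u_def)
      then have "cmod (f (g u)) \<le> R'" using V R'[of "g u"] by auto
      moreover have "0 < Re u" "N < Re u" using M by (auto simp: u_def)
      ultimately show False using N[of u] inverse_branch_eq[OF g, of u] by simp
    qed
    moreover have "E \<inter> V = {} \<or> E \<inter> V = E"
      by (rule connected_clopen[THEN iffD1, rule_format, OF connE conjI[OF op cl]])
    ultimately have "E \<inter> V = E" by simp
    then have "R < cmod (f z)" if "B < cmod z" for z
    proof -
      have "z \<in> E" using that by (simp add: E_def)
      then have "z \<in> V" using \<open>E \<inter> V = E\<close> by blast
      then obtain u where "z = g u" "M < Re u" by (auto simp: V_def)
      then show ?thesis using inverse_branch_eq[OF g, of u] M0[of u] M by (simp add: M_def)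
    qed
    then show ?thesis by blast
  qed
  then show False by (rule transcendental_not_tending_to_infinity[OF f_transcendental])
qed

lemma inverse_branch_open_image: "inverse_branch g \<Longrightarrow> open (g ` right_half_plane)"
  by (intro open_mapping_thm3 inverse_branch_holomorphic inverse_branch_inj open_right_half_plane)

lemma inverse_branch_left_inverse:
  assumes g: "inverse_branch g"
  obtains k where "continuous_on (g ` right_half_plane) k" "\<And>u. 0 < Re u \<Longrightarrow> k (g u) = u"
proof -
  obtain k where "k holomorphic_on (g ` right_half_plane)"
    "\<And>z. z \<in> right_half_plane \<Longrightarrow> deriv g z * deriv k (g z) = 1"
    "\<And>z. z \<in> right_half_plane \<Longrightarrow> k (g z) = z"
    using holomorphic_has_inverse[OF inverse_branch_holomorphic[OF g] open_right_half_plane inverse_branch_inj[OF g]]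
    by blast
  then show thesis by (intro that[of k]) (auto intro: holomorphic_on_imp_continuous_on)
qed

lemma inverse_branch_images:
  assumes g: "inverse_branch g" and h: "inverse_branch h"
    and meet: "g ` right_half_plane \<inter> h ` right_half_plane \<noteq> {}"
  obtains k :: int where "\<And>u. 0 < Re u \<Longrightarrow> g u = h (u + 2 * pi * of_int k * \<i>)"
proof -
  obtain u v where uv: "0 < Re u" "0 < Re v" "g u = h v" using meet by auto
  then have "P v = P u" using inverse_branch_eq[OF g] inverse_branch_eq[OF h] by metis
  then obtain k :: int where k: "v = u + 2 * pi * of_int k * \<i>" using P_eq_iff uv by auto
  show thesis
    using inverse_branches_agree[OF g inverse_branch_translate[OF h] uv(1)] uv(3) k by (intro that) blast
qed

text \<open>The images of inverse branches are open, and any two of them are equal or disjoint.\<close>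

lemma connected_subset_inverse_branch_image:
  assumes g: "inverse_branch g" and C: "connected C" "f ` C \<subseteq> W" "C \<inter> g ` right_half_plane \<noteq> {}"
  shows "C \<subseteq> g ` right_half_plane"
proof -
  define V where "V = g ` right_half_plane"
  define V' where "V' = \<Union>{h ` right_half_plane | h. inverse_branch h \<and> h ` right_half_plane \<inter> V = {}}"
  have "open V" unfolding V_def by (rule inverse_branch_open_image[OF g])
  moreover have "open V'" unfolding V'_def by (auto intro: inverse_branch_open_image)
  moreover have "V \<inter> V' = {}" by (auto simp: V'_def)
  moreover have "C \<subseteq> V \<union> V'"
  proof
    fix z assume "z \<in> C"
    then obtain u where u: "0 < Re u" "f z = P u" using C(2) P_image by (force simp: image_subset_iff)
    then obtain h where h: "inverse_branch h" "h u = z" by (rule inverse_branch_exists)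
    show "z \<in> V \<union> V'"
    proof (cases "h ` right_half_plane \<inter> V = {}")
      case True
      then show ?thesis using h u by (auto simp: V'_def)
    next
      case False
      then obtain k :: int where "\<And>u. 0 < Re u \<Longrightarrow> h u = g (u + 2 * pi * of_int k * \<i>)"
        unfolding V_def by (rule inverse_branch_images[OF h(1) g]) blast
      then have "z = g (u + 2 * pi * of_int k * \<i>)" using u h by simp
      then show ?thesis using u by (auto simp: V_def)
    qed
  qed
  ultimately have "V \<inter> C = {} \<or> V' \<inter> C = {}" using C(1) by (intro connectedD) auto
  moreover have "V \<inter> C \<noteq> {}" using C(3) by (auto simp: V_def)
  ultimately show ?thesis using \<open>C \<subseteq> V \<union> V'\<close> unfolding V_def by blast
qed

text \<open>This passes to the logarithmic coordinate, where the dynamics becomes the backward iteration of self-maps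
  \<open>G n\<close> of the half-plane. The lifts \<open>X n\<close> and the maps \<open>G n\<close> are unique up to periods, and these are adjusted
  at one point \<open>z0\<close>; connectedness of \<open>C\<close> makes the relation between them hold everywhere.\<close>

proposition itinerary:
  assumes C: "connected C" "C \<noteq> {}" "\<And>n z. z \<in> C \<Longrightarrow> (f ^^ n) z \<in> W"
  obtains G X where
    "\<And>n. G n holomorphic_on right_half_plane"
    "\<And>n u. 0 < Re u \<Longrightarrow> 0 < Re (G n u)"
    "\<And>n. inverse_branch (\<lambda>u. P (G n u))"
    "\<And>n. continuous_on C (X n)"
    "\<And>n z. z \<in> C \<Longrightarrow> 0 < Re (X n z)"
    "\<And>n z. z \<in> C \<Longrightarrow> P (X n z) = (f ^^ n) z"
    "\<And>n z. z \<in> C \<Longrightarrow> G n (X (Suc n) z) = X n z"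
proof -
  obtain z0 where z0: "z0 \<in> C" using C(2) by blast
  have "\<exists>u. 0 < Re u \<and> P u = (f ^^ n) z0" for n
    using C(3)[OF z0, of n] P_image by (metis image_iff right_half_plane_simps)
  then obtain w where w: "\<And>n. 0 < Re (w n)" "\<And>n. P (w n) = (f ^^ n) z0" by metis
  have "\<exists>g. inverse_branch g \<and> g (w (Suc n)) = (f ^^ n) z0" for n
    by (rule inverse_branch_exists[of "w (Suc n)" "(f ^^ n) z0"]) (use w in auto)
  then obtain g where g: "\<And>n. inverse_branch (g n)" "\<And>n. g n (w (Suc n)) = (f ^^ n) z0" by metis
  have "\<exists>h. h holomorphic_on right_half_plane \<and> (\<forall>u. 0 < Re u \<longrightarrow> 0 < Re (h u) \<and> P (h u) = g n u) \<and> h (w (Suc n)) = w n" for n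
  proof (rule P_lift)
    show "g n holomorphic_on right_half_plane" by (rule inverse_branch_holomorphic[OF g(1)])
    show "g n ` right_half_plane \<subseteq> W"
      using W_backward inverse_branch_eq[OF g(1)] P_in_W by (auto simp: image_subset_iff)
  qed (use w g in auto)
  then obtain G where G: "\<And>n. G n holomorphic_on right_half_plane"
    "\<And>n u. 0 < Re u \<Longrightarrow> 0 < Re (G n u)" "\<And>n u. 0 < Re u \<Longrightarrow> P (G n u) = g n u" "\<And>n. G n (w (Suc n)) = w n"
    by metis
  have "\<exists>k. continuous_on (g n ` right_half_plane) k \<and> (\<forall>u. 0 < Re u \<longrightarrow> k (g n u) = u)" for n
    using inverse_branch_left_inverse[OF g(1)] by metis
  then obtain k where k: "\<And>n. continuous_on (g n ` right_half_plane) (k n)" "\<And>n u. 0 < Re u \<Longrightarrow> k n (g n u) = u"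
    by metis
  have fcont: "continuous_on S (f ^^ n)" for n S
    using holomorphic_power_iterate[OF f_holomorphic] holomorphic_on_imp_continuous_on continuous_on_subset by blast
  have image: "(f ^^ n) ` C \<subseteq> g n ` right_half_plane" for n
  proof (rule connected_subset_inverse_branch_image[OF g(1)])
    show "connected ((f ^^ n) ` C)" by (rule connected_continuous_image[OF fcont C(1)])
    show "f ` (f ^^ n) ` C \<subseteq> W" using C(3)[of _ "Suc n"] by auto
    have "(f ^^ n) z0 \<in> g n ` right_half_plane" using g(2) w(1) by (metis image_eqI right_half_plane_simps)
    then show "(f ^^ n) ` C \<inter> g n ` right_half_plane \<noteq> {}" using z0 by blast
  qed
  define Y where "Y = (\<lambda>n z. k n ((f ^^ n) z))"
  have Y: "0 < Re (Y n z)" "g n (Y n z) = (f ^^ n) z" if z: "z \<in> C" for n z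
  proof -
    obtain u where "0 < Re u" "(f ^^ n) z = g n u" using image[of n] z by auto
    then show "0 < Re (Y n z)" "g n (Y n z) = (f ^^ n) z" using k(2) by (auto simp: Y_def)
  qed
  have contY: "continuous_on C (Y n)" for n
    unfolding Y_def by (rule continuous_on_compose2[OF k(1) fcont image])
  define X where "X = (\<lambda>n z. G n (Y n z))"
  have contX: "continuous_on C (X n)" for n
    unfolding X_def using Y(1)
    by (intro continuous_on_compose2[OF holomorphic_on_imp_continuous_on[OF G(1)] contY]) auto
  have X: "0 < Re (X n z)" "P (X n z) = (f ^^ n) z" if "z \<in> C" for n z
    using Y[OF that] G by (auto simp: X_def)
  have Xz0: "Y n z0 = w (Suc n)" "X n z0 = w n" for n
    using k(2)[OF w(1), of n "Suc n"] g(2) G(4) by (auto simp: X_def Y_def)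
  \<comment> \<open>Two lifts of the same point differ by a multiple of the period, which is constant on \<open>C\<close>.\<close>
  have YX: "Y n z = X (Suc n) z" if z: "z \<in> C" for n z
  proof -
    define D where "D = (\<lambda>z. Y n z - X (Suc n) z)"
    have per: "\<exists>m::int. D z = 2 * pi * of_int m * \<i>" if "z \<in> C" for z
    proof -
      have "P (Y n z) = f (g n (Y n z))" using inverse_branch_eq[OF g(1) Y(1)[OF that]] by simp
      also have "\<dots> = P (X (Suc n) z)" using Y(2)[OF that] X(2)[OF that, of "Suc n"] by simp
      finally show ?thesis using P_eq_iff[OF Y(1)[OF that] X(1)[OF that]] by (auto simp: D_def)
    qed
    have "D constant_on C"
    proof (rule continuous_discrete_range_constant[OF C(1)])
      show "continuous_on C D" unfolding D_def by (intro continuous_intros contX contY)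
      show "\<exists>e>0. \<forall>y. y \<in> C \<and> D y \<noteq> D x \<longrightarrow> e \<le> norm (D y - D x)" if x: "x \<in> C" for x
      proof (intro exI[of _ "2 * pi"] conjI allI impI)
        fix y assume y: "y \<in> C \<and> D y \<noteq> D x"
        obtain a b :: int where ab: "D y = 2 * pi * of_int a * \<i>" "D x = 2 * pi * of_int b * \<i>"
          using per[of y] per[of x] y x by blast
        then have "D y - D x = of_real (2 * pi * of_int (a - b)) * \<i>" by (simp add: algebra_simps)
        then have "norm (D y - D x) = 2 * pi * \<bar>real_of_int (a - b)\<bar>"
          by (simp only: norm_mult norm_of_real) (simp add: abs_mult)
        moreover have "a \<noteq> b" using ab y by auto
        then have "1 \<le> \<bar>real_of_int (a - b)\<bar>" by linarith
        ultimately show "2 * pi \<le> norm (D y - D x)" using mult_left_mono[of 1 _ "2 * pi"] by simp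
      qed simp
    qed
    then have "D z = D z0" using z z0 by (auto simp: constant_on_def)
    then show ?thesis by (simp add: D_def Xz0)
  qed
  show thesis
  proof (rule that[of G X])
    show "inverse_branch (\<lambda>u. P (G n u))" for n
    proof -
      have "(\<lambda>u. P (G n u)) holomorphic_on right_half_plane"
        by (rule holomorphic_transform[OF inverse_branch_holomorphic[OF g(1)[of n]]]) (simp add: G(3))
      then show ?thesis
        using inverse_branch_eq[OF g(1)[of n]] G(3)[of _ n] by (simp add: inverse_branch_def holomorphic_lift_def)
    qed
    show "G n (X (Suc n) z) = X n z" if "z \<in> C" for n z
      using YX[OF that] by (metis X_def)
  qed (use G contX X in auto)
qed

text \<open>If \<open>P (G u)\<close> had a finite accumulation point as \<open>u\<close> tends to infinity with \<open>c \<le> Re u\<close>, then \<open>f\<close>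
  would map this point into \<open>W\<close>, so that it would have a neighbourhood covered by a single inverse branch. The
  parameters \<open>u\<close> of points in this neighbourhood could not be unbounded.\<close>

proposition Re_tends_to_infinity:
  assumes G: "\<And>u. 0 < Re u \<Longrightarrow> 0 < Re (G u)" "inverse_branch (\<lambda>u. P (G u))" and c: "0 < c"
  shows "\<exists>R. \<forall>u. c \<le> Re u \<and> R < cmod u \<longrightarrow> M < Re (G u)"
proof (rule ccontr)
  assume "\<not> ?thesis"
  then have "\<exists>u. c \<le> Re u \<and> real k < cmod u \<and> Re (G u) \<le> M" for k :: nat
    by (meson not_le)
  then obtain u where u: "\<And>k. c \<le> Re (u k)" "\<And>k. real k < cmod (u k)" "\<And>k. Re (G (u k)) \<le> M" by metis
  have u0: "0 < Re (u k)" for k using u(1)[of k] c by linarith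
  define z where "z = (\<lambda>k. P (G (u k)))"
  have fz: "f (z k) = P (u k)" for k unfolding z_def using inverse_branch_eq[OF G(2) u0] .
  obtain R1 where "\<And>v. 0 < Re v \<Longrightarrow> Re v \<le> M \<Longrightarrow> cmod (P v) \<le> R1" using P_bounded by blast
  then have z: "cmod (z k) \<le> R1" for k using G(1)[OF u0] u(3) by (simp add: z_def)
  obtain R2 where R2: "\<And>z. cmod z \<le> R1 \<Longrightarrow> cmod (f z) \<le> R2" by (rule f_bounded_on_cball) blast
  obtain N where N: "\<And>u. 0 < Re u \<Longrightarrow> N < Re u \<Longrightarrow> R2 < cmod (P u)" using P_infinity by blast
  have uN: "Re (u k) \<le> N" for k
    using N[OF u0, of k] R2[of "z k"] z[of k] fz[of k] by (smt (verit))
  \<comment> \<open>The translates \<open>v k\<close> of \<open>u k\<close> have imaginary part in \<open>[0, 2\<pi>]\<close> and are bounded. It will turn out that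
    the amount \<open>m k\<close> of the translation is eventually constant on a subsequence.\<close>
  define m where "m = (\<lambda>k. \<lfloor>Im (u k) / (2 * pi)\<rfloor>)"
  define v where "v = (\<lambda>k. u k - 2 * pi * of_int (m k) * \<i>)"
  have v: "v k \<in> cbox (Complex c 0) (Complex N (2 * pi))" for k
  proof -
    have "of_int (m k) * (2 * pi) \<le> Im (u k)" "Im (u k) \<le> (of_int (m k) + 1) * (2 * pi)"
      unfolding m_def using floor_divide_lower[of "2 * pi" "Im (u k)"] floor_divide_upper[of "2 * pi" "Im (u k)"]
      by (auto intro: less_imp_le)
    then show ?thesis using u(1)[of k] uN[of k] by (simp add: v_def in_cbox_complex_iff algebra_simps)
  qed
  have uv: "u k = v k + 2 * pi * of_int (m k) * \<i>" for k by (simp add: v_def)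
  have v0: "0 < Re (v k)" for k using u0[of k] by (simp add: v_def)
  have fzv: "f (z k) = P (v k)" for k using fz P_translate[OF v0] uv by metis
  have "compact (cball (0::complex) R1 \<times> cbox (Complex c 0) (Complex N (2 * pi)))" by (intro compact_Times) auto
  moreover have "\<forall>k. (z k, v k) \<in> cball (0::complex) R1 \<times> cbox (Complex c 0) (Complex N (2 * pi))"
    using z v by simp
  ultimately obtain r l where l: "l \<in> cball (0::complex) R1 \<times> cbox (Complex c 0) (Complex N (2 * pi))"
    "strict_mono r" "((\<lambda>k. (z k, v k)) \<circ> r) \<longlonglongrightarrow> l"
    by (auto elim!: seq_compactE[OF compact_imp_seq_compact])
  define za va where "za = fst l" and "va = snd l"
  have lim: "(\<lambda>k. z (r k)) \<longlonglongrightarrow> za" "(\<lambda>k. v (r k)) \<longlonglongrightarrow> va"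
    using tendsto_fst[OF l(3)] tendsto_snd[OF l(3)] by (auto simp: o_def za_def va_def)
  have va: "0 < Re va" using l(1) c by (auto simp: va_def in_cbox_complex_iff mem_Times_iff)
  have "f za = P va"
  proof (rule LIMSEQ_unique)
    have "isCont f za" using f_continuous[of UNIV] by (simp add: continuous_on_eq_continuous_at)
    then show "(\<lambda>k. f (z (r k))) \<longlonglongrightarrow> f za" using lim(1) by (rule isCont_tendsto_compose)
    have "isCont P va"
      using P_continuous open_right_half_plane va continuous_on_eq_continuous_at by fastforce
    then have "(\<lambda>k. P (v (r k))) \<longlonglongrightarrow> P va" using lim(2) by (rule isCont_tendsto_compose)
    then show "(\<lambda>k. f (z (r k))) \<longlonglongrightarrow> P va" by (simp add: fzv)
  qed
  then obtain g where g: "inverse_branch g" "g va = za" using inverse_branch_exists[OF va] by blast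
  obtain h where h: "continuous_on (g ` right_half_plane) h" "\<And>u. 0 < Re u \<Longrightarrow> h (g u) = u"
    using inverse_branch_left_inverse[OF g(1)] by blast
  have op: "open (g ` right_half_plane)" by (rule inverse_branch_open_image[OF g(1)])
  have zin: "za \<in> g ` right_half_plane" using g(2) va by auto
  have ev1: "\<forall>\<^sub>F k in sequentially. z (r k) \<in> g ` right_half_plane"
    using topological_tendstoD[OF lim(1) op zin] .
  have "isCont h za" using h(1) op zin continuous_on_eq_continuous_at by blast
  then have "(\<lambda>k. h (z (r k))) \<longlonglongrightarrow> h za" using lim(1) by (rule isCont_tendsto_compose)
  moreover have "h za = va" using h(2)[OF va] g(2) by simp
  ultimately have "(\<lambda>k. h (z (r k)) - v (r k)) \<longlonglongrightarrow> va - va" using lim(2) by (intro tendsto_diff) auto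
  then have ev2: "\<forall>\<^sub>F k in sequentially. cmod (h (z (r k)) - v (r k)) < 2 * pi"
    using tendstoD[of _ "0::complex" sequentially "2 * pi"] by simp
  have "\<forall>\<^sub>F k in sequentially. g (v (r k)) = z (r k)"
    using ev1 ev2
  proof eventually_elim
    case (elim k)
    then obtain s where s: "0 < Re s" "z (r k) = g s" by auto
    then have "P s = P (v (r k))" using fzv[of "r k"] inverse_branch_eq[OF g(1)] by metis
    then obtain n :: int where n: "s = v (r k) + 2 * pi * of_int n * \<i>" using P_eq_iff s v0 by auto
    have "cmod (s - v (r k)) < 2 * pi" using elim(2) s h(2) by simp
    then have "\<bar>real_of_int n\<bar> < 1" using n by (simp add: norm_mult)
    then have "n = 0" by linarith
    then show ?case using s n by simp
  qed
  then obtain k0 where k0: "\<And>k. k0 \<le> k \<Longrightarrow> g (v (r k)) = z (r k)"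
    unfolding eventually_sequentially by blast
  have shift: "g 1 = P (G (1 + 2 * pi * of_int (m (r k)) * \<i>))" if "k0 \<le> k" for k
  proof (rule inverse_branches_agree[OF g(1) inverse_branch_translate[OF G(2)] v0])
    show "g (v (r k)) = P (G (v (r k) + 2 * pi * of_int (m (r k)) * \<i>))"
      using k0[OF that] uv by (simp add: z_def)
  qed simp
  have "m (r k) = m (r k0)" if "k0 \<le> k" for k
  proof -
    have "1 + 2 * pi * of_int (m (r k)) * \<i> = 1 + 2 * pi * of_int (m (r k0)) * \<i>"
    proof (rule inj_onD[OF inverse_branch_inj[OF G(2)]])
      show "P (G (1 + 2 * pi * of_int (m (r k)) * \<i>)) = P (G (1 + 2 * pi * of_int (m (r k0)) * \<i>))"
        using shift[OF that] shift[OF order_refl] by simp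
    qed auto
    then show ?thesis by simp
  qed
  then have bound: "cmod (u (r k)) \<le> cmod (v (r k)) + cmod (2 * pi * of_int (m (r k0)) * \<i>)" if "k0 \<le> k" for k
    using that uv[of "r k"] norm_triangle_ineq by metis
  have "bounded (range (\<lambda>k. v (r k)))" using lim(2) convergent_imp_bounded convergentI by blast
  then obtain B where "\<And>k. cmod (v (r k)) \<le> B" by (auto simp: bounded_iff)
  with bound have B: "cmod (u (r k)) \<le> B + cmod (2 * pi * of_int (m (r k0)) * \<i>)" if "k0 \<le> k" for k
    using that by (meson add_right_mono order_trans)
  obtain k1 :: nat where k1: "B + cmod (2 * pi * of_int (m (r k0)) * \<i>) < real k1"
    using reals_Archimedean2 by blast
  define k where "k = max k0 k1"
  have "real k1 \<le> real (r k)" using seq_suble[OF l(2), of k] by (simp add: k_def)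
  then show False using u(2)[of "r k"] B[of k] k1 by (simp add: k_def)
qed

end

section \<open>Sequences on the Riemann sphere\<close>

lemma continuous_on_sphere_emb: "continuous_on S sphere_emb"
proof -
  have "(cmod z)\<^sup>2 + 1 \<noteq> 0" for z :: complex
    by (metis add_nonneg_eq_0_iff zero_le_one zero_le_power2 zero_neq_one)
  then show ?thesis
    unfolding sphere_emb_def[abs_def] by (intro continuous_intros) auto
qed

lemma snd_sphere_emb: "snd (sphere_emb z) = 1 - 2 / ((cmod z)\<^sup>2 + 1)"
proof -
  have "(cmod z)\<^sup>2 + 1 > 0" by (simp add: add_nonneg_pos)
  then show ?thesis by (simp add: sphere_emb_def field_simps)
qed

lemma sphere_emb_neq_infty [simp]: "sphere_emb z \<noteq> sphere_infty" "sphere_infty \<noteq> sphere_emb z"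
  using bij_betw_sphere_emb by (auto simp: bij_betw_def)

lemma inj_sphere_emb: "inj sphere_emb"
  using bij_betw_sphere_emb by (simp add: bij_betw_def)

lemma sphere_emb_eq_iff [simp]: "sphere_emb z = sphere_emb w \<longleftrightarrow> z = w"
  using inj_sphere_emb by (simp add: inj_eq)

definition sphere_proj :: "complex \<times> real \<Rightarrow> complex" where
  "sphere_proj p = (1 / (1 - snd p)) *\<^sub>R fst p"

lemma sphere_proj_emb [simp]: "sphere_proj (sphere_emb z) = z"
proof -
  define a where "a = (cmod z)\<^sup>2 + 1"
  have "a > 0" by (simp add: a_def add_nonneg_pos)
  moreover have "fst (sphere_emb z) = (2 / a) *\<^sub>R z" "1 - snd (sphere_emb z) = 2 / a"
    unfolding snd_sphere_emb by (simp_all add: sphere_emb_def a_def)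
  ultimately show ?thesis by (simp add: sphere_proj_def)
qed

lemma snd_sphere_emb_neq_1: "snd (sphere_emb z) \<noteq> 1"
proof -
  have "(cmod z)\<^sup>2 + 1 > 0" by (simp add: add_nonneg_pos)
  then show ?thesis by (simp add: snd_sphere_emb)
qed

lemma continuous_on_sphere_proj: "continuous_on (range sphere_emb) sphere_proj"
  unfolding sphere_proj_def[abs_def] using snd_sphere_emb_neq_1 by (intro continuous_intros) fastforce+

lemma tendsto_sphere_emb_iff:
  "((\<lambda>k. sphere_emb (z k)) \<longlongrightarrow> sphere_emb l) F \<longleftrightarrow> (z \<longlongrightarrow> l) F"
proof
  assume lim: "((\<lambda>k. sphere_emb (z k)) \<longlongrightarrow> sphere_emb l) F"
  have "((\<lambda>k. sphere_proj (sphere_emb (z k))) \<longlongrightarrow> sphere_proj (sphere_emb l)) F"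
    unfolding sphere_proj_def using lim snd_sphere_emb_neq_1[of l]
    by (intro tendsto_intros) auto
  then show "(z \<longlongrightarrow> l) F" by simp
next
  have "isCont sphere_emb l"
    using continuous_on_sphere_emb[of UNIV] by (simp add: continuous_on_eq_continuous_at)
  then show "(z \<longlongrightarrow> l) F \<Longrightarrow> ((\<lambda>k. sphere_emb (z k)) \<longlongrightarrow> sphere_emb l) F"
    by (rule isCont_tendsto_compose)
qed

lemma tendsto_sphere_infty_iff:
  "((\<lambda>k. sphere_emb (z k)) \<longlongrightarrow> sphere_infty) F \<longleftrightarrow> filterlim z at_infinity F"
proof
  assume lim: "((\<lambda>k. sphere_emb (z k)) \<longlongrightarrow> sphere_infty) F"
  show "filterlim z at_infinity F"
    unfolding filterlim_at_infinity[OF order_refl]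
  proof (intro allI impI)
    fix r :: real assume r: "0 < r"
    have "((\<lambda>k. snd (sphere_emb (z k))) \<longlongrightarrow> 1) F"
      using tendsto_snd[OF lim] by (simp add: sphere_infty_def)
    moreover have "1 - 2 / (r\<^sup>2 + 1) < 1" using r by (simp add: add_nonneg_pos)
    ultimately have "\<forall>\<^sub>F k in F. 1 - 2 / (r\<^sup>2 + 1) < snd (sphere_emb (z k))"
      by (rule order_tendstoD(1))
    then show "\<forall>\<^sub>F k in F. r \<le> cmod (z k)"
    proof eventually_elim
      case (elim k)
      have pos: "0 < r\<^sup>2 + 1" "0 < (cmod (z k))\<^sup>2 + 1" by (simp_all add: add_nonneg_pos)
      have "2 / ((cmod (z k))\<^sup>2 + 1) < 2 / (r\<^sup>2 + 1)" using elim by (simp add: snd_sphere_emb)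
      then have "r\<^sup>2 < (cmod (z k))\<^sup>2" using pos by (simp add: divide_less_cancel frac_less2 field_simps)
      then show ?case using power2_less_imp_less[of r "cmod (z k)"] by simp
    qed
  qed
next
  assume inf: "filterlim z at_infinity F"
  have n: "filterlim (\<lambda>k. cmod (z k)) at_top F"
    using inf by (rule filterlim_at_infinity_imp_norm_at_top)
  have "((\<lambda>k. 2 * cmod (z k) / ((cmod (z k))\<^sup>2 + 1)) \<longlongrightarrow> 0) F"
    by (rule filterlim_compose[OF _ n, of "\<lambda>x. 2 * x / (x\<^sup>2 + 1)"]) real_asymp
  then have "((\<lambda>k. cmod (fst (sphere_emb (z k)))) \<longlongrightarrow> 0) F"
    by (simp add: sphere_emb_def)
  then have "((\<lambda>k. fst (sphere_emb (z k))) \<longlongrightarrow> 0) F" by (rule tendsto_norm_zero_cancel)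
  moreover have "((\<lambda>k. snd (sphere_emb (z k))) \<longlongrightarrow> 1) F"
    unfolding snd_sphere_emb
    by (rule filterlim_compose[OF _ n, of "\<lambda>x. 1 - 2 / (x\<^sup>2 + 1)"]) real_asymp
  ultimately have "((\<lambda>k. (fst (sphere_emb (z k)), snd (sphere_emb (z k)))) \<longlongrightarrow> (0, 1)) F"
    by (rule tendsto_Pair)
  then show "((\<lambda>k. sphere_emb (z k)) \<longlongrightarrow> sphere_infty) F" by (simp add: sphere_infty_def)
qed

lemma eventually_in_plane:
  assumes "s \<longlonglongrightarrow> sphere_emb x" "\<And>k::nat. s k \<in> insert sphere_infty (range sphere_emb)"
  shows "\<forall>\<^sub>F k in sequentially. s k \<in> range sphere_emb"
proof -
  have "\<forall>\<^sub>F k in sequentially. s k \<noteq> sphere_infty"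
    by (rule tendsto_imp_eventually_ne[OF assms(1)]) simp
  then show ?thesis by eventually_elim (use assms(2) in auto)
qed

lemma compact_sphere_closure:
  assumes "closed C"
  shows "compact (insert sphere_infty (sphere_emb ` C))"
proof -
  have sph: "insert sphere_infty (range sphere_emb) = sphere 0 1"
    using bij_betw_sphere_emb by (auto simp: bij_betw_def sphere_infty_def norm_Pair)
  have sub: "insert sphere_infty (sphere_emb ` C) \<subseteq> sphere 0 1" unfolding sph[symmetric] by blast
  have "closed (insert sphere_infty (sphere_emb ` C))"
    unfolding closed_sequential_limits
  proof (intro allI impI, elim conjE)
    fix s l assume s: "\<forall>n. s n \<in> insert sphere_infty (sphere_emb ` C)" "s \<longlonglongrightarrow> l"
    have "\<forall>n. s n \<in> sphere 0 1" using s(1) sub by blast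
    then have "l \<in> sphere 0 1" using closed_sequentially[OF closed_sphere _ s(2)] by blast
    then consider "l = sphere_infty" | x where "l = sphere_emb x" using sph by blast
    then show "l \<in> insert sphere_infty (sphere_emb ` C)"
    proof cases
      case 2
      have "\<forall>\<^sub>F k in sequentially. s k \<in> range sphere_emb"
        using s 2 by (intro eventually_in_plane) auto
      then have ev: "\<forall>\<^sub>F k in sequentially. s k = sphere_emb (sphere_proj (s k)) \<and> sphere_proj (s k) \<in> C"
      proof eventually_elim
        case (elim k)
        then obtain z where "s k = sphere_emb z" by auto
        then show ?case using s(1)[rule_format, of k] by auto
      qed
      have "(\<lambda>k. sphere_emb (sphere_proj (s k))) \<longlonglongrightarrow> sphere_emb x"
        using s(2) 2 ev by (auto elim!: Lim_transform_eventually eventually_mono)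
      then have "(\<lambda>k. sphere_proj (s k)) \<longlonglongrightarrow> x" by (simp add: tendsto_sphere_emb_iff)
      then have "x \<in> C"
        using ev by (intro Lim_in_closed_set[OF assms]) (auto elim: eventually_mono)
      then show ?thesis using 2 by blast
    qed simp
  qed
  with sub show ?thesis
    using bounded_subset[OF bounded_sphere] compact_eq_bounded_closed by blast
qed

lemma continuum_sphere_closure:
  assumes "closed C" "connected C" "\<not> bounded C"
  shows "continuum (insert sphere_infty (sphere_emb ` C))"
proof -
  have "\<exists>z. z \<in> C \<and> real k < cmod z" for k :: nat
    using assms(3) unfolding bounded_iff by (meson not_le)
  then obtain z where z: "\<And>k. z k \<in> C" "\<And>k::nat. real k < cmod (z k)" by metis
  have "filterlim (\<lambda>k. cmod (z k)) at_top sequentially"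
    by (rule filterlim_at_top_mono[OF filterlim_real_sequentially]) (auto intro!: always_eventually less_imp_le z)
  then have "(\<lambda>k. sphere_emb (z k)) \<longlonglongrightarrow> sphere_infty"
    by (simp add: tendsto_sphere_infty_iff filterlim_norm_at_top_imp_at_infinity)
  then have "sphere_infty \<in> closure (sphere_emb ` C)"
    unfolding closure_sequential using z(1) by (intro exI[of _ "\<lambda>k. sphere_emb (z k)"]) auto
  then have sub: "insert sphere_infty (sphere_emb ` C) \<subseteq> closure (sphere_emb ` C)"
    using closure_subset[of "sphere_emb ` C"] by (simp only: insert_subset simp_thms)
  have "connected (sphere_emb ` C)"
    by (intro connected_continuous_image continuous_on_sphere_emb assms)
  then have "connected (insert sphere_infty (sphere_emb ` C))"
    using subset_insertI sub by (rule connected_intermediate_closure)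
  then show ?thesis
    using compact_sphere_closure[OF assms(1)] by (simp add: continuum_def)
qed

section \<open>Continua of pairs meet the diagonal\<close>

locale lifted_continuum = log_tracts +
  fixes C :: "complex set" and G :: "nat \<Rightarrow> complex \<Rightarrow> complex" and X :: "nat \<Rightarrow> complex \<Rightarrow> complex"
    and c :: real
  assumes closed_C: "closed C"
    and c_pos: "0 < c"
    and G_holomorphic: "\<And>n. G n holomorphic_on right_half_plane"
    and G_in: "\<And>n u. 0 < Re u \<Longrightarrow> 0 < Re (G n u)"
    and G_branch: "\<And>n. inverse_branch (\<lambda>u. P (G n u))"
    and X_continuous: "\<And>n. continuous_on C (X n)"
    and X_Re: "\<And>n z. z \<in> C \<Longrightarrow> c \<le> Re (X n z)"
    and P_X: "\<And>z. z \<in> C \<Longrightarrow> P (X 0 z) = z"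
    and G_X: "\<And>n z. z \<in> C \<Longrightarrow> G n (X (Suc n) z) = X n z"
begin

lemma X_pos: "z \<in> C \<Longrightarrow> 0 < Re (X n z)"
  using X_Re[of z n] c_pos by simp

lemma G_translates_disjoint:
  assumes "0 < Re u" "0 < Re v"
  shows "G n u \<noteq> G n v + 2 * pi * \<i>"
proof
  assume eq: "G n u = G n v + 2 * pi * \<i>"
  then have "P (G n u) = P (G n v)"
    using P_translate[of "G n v" 1] G_in[OF assms(2)] by simp
  then have "u = v"
    using inj_onD[OF inverse_branch_inj[OF G_branch[of n]]] assms by simp
  then show False using eq by simp
qed

text \<open>Since \<open>G n\<close> omits the translate of \<open>X n x\<close> by \<open>2\<pi>\<i>\<close>, which is at bounded distance from \<open>X n x\<close>,
  the pull-back contracts by a definite factor at every step.\<close>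

lemma close_at_time_n_imp_close:
  obtains \<kappa> where "0 \<le> \<kappa>" "\<kappa> < 1"
    "\<And>n x y. x \<in> C \<Longrightarrow> y \<in> C \<Longrightarrow> cmod (X n x - X n y) < 2 * pi \<Longrightarrow> pseudo_hyp (X 0 x) (X 0 y) \<le> \<kappa> ^ n"
proof -
  define d where "d = 2 * pi / sqrt ((2 * pi)\<^sup>2 + 4 * c\<^sup>2)"
  define \<kappa> where "\<kappa> = sqrt (1 - (1 - d\<^sup>2) * (1 - sqrt d)\<^sup>2 / 4)"
  have d: "0 \<le> d" "d < 1"
  proof -
    have "2 * pi < sqrt ((2 * pi)\<^sup>2 + 4 * c\<^sup>2)"
      by (rule real_less_rsqrt) (use c_pos in simp)
    moreover from this have "0 < sqrt ((2 * pi)\<^sup>2 + 4 * c\<^sup>2)" using pi_gt_zero by linarith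
    ultimately show "d < 1" by (simp only: d_def divide_less_eq_1_pos)
  qed (simp add: d_def)
  have d2: "0 < 1 - d\<^sup>2" "1 - d\<^sup>2 \<le> 1" using d by (simp_all add: power_less_one_iff)
  have sd: "0 < (1 - sqrt d)\<^sup>2" "(1 - sqrt d)\<^sup>2 \<le> 1" using d by (auto simp: power_le_one)
  have "(1 - d\<^sup>2) * (1 - sqrt d)\<^sup>2 \<le> 1" using d2 sd by (simp add: mult_le_one)
  moreover have "0 < (1 - d\<^sup>2) * (1 - sqrt d)\<^sup>2" using d2 sd by simp
  ultimately have \<kappa>: "0 \<le> \<kappa>" "\<kappa> < 1" unfolding \<kappa>_def by simp_all
  have step: "pseudo_hyp (X n x) (X n y) \<le> \<kappa> * pseudo_hyp (X (Suc n) x) (X (Suc n) y)"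
    if xy: "x \<in> C" "y \<in> C" "pseudo_hyp (X (Suc n) x) (X (Suc n) y) \<le> d" for n x y
  proof -
    have "pseudo_hyp (G n (X (Suc n) x)) (G n (X (Suc n) y)) \<le> \<kappa> * pseudo_hyp (X (Suc n) x) (X (Suc n) y)"
      unfolding \<kappa>_def
    proof (rule pseudo_hyp_contraction[OF G_holomorphic G_in])
      show "0 < Re (X n x + 2 * pi * \<i>)" using X_pos[OF xy(1)] by simp
      show "G n z \<noteq> X n x + 2 * pi * \<i>" if "0 < Re z" for z
        using G_translates_disjoint[OF that X_pos[OF xy(1), of "Suc n"], of n] G_X[OF xy(1)] by simp
      show "pseudo_hyp (G n (X (Suc n) x)) (X n x + 2 * pi * \<i>) \<le> d"
        unfolding d_def G_X[OF xy(1)] using X_Re[OF xy(1)] by (intro pseudo_hyp_le[OF c_pos]) (auto simp: norm_mult)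
    qed (use X_pos xy d in auto)
    then show ?thesis using G_X xy by simp
  qed
  have iter: "pseudo_hyp (X 0 x) (X 0 y) \<le> \<kappa> ^ n * pseudo_hyp (X n x) (X n y)"
    if xy: "x \<in> C" "y \<in> C" "pseudo_hyp (X n x) (X n y) \<le> d" for n x y
    using xy(3)
  proof (induction n)
    case (Suc n)
    have s: "pseudo_hyp (X n x) (X n y) \<le> \<kappa> * pseudo_hyp (X (Suc n) x) (X (Suc n) y)"
      by (rule step[OF xy(1,2) Suc.prems])
    also have "\<dots> \<le> 1 * d" using Suc.prems \<kappa> by (intro mult_mono) (auto simp: pseudo_hyp_nonneg)
    finally have "pseudo_hyp (X n x) (X n y) \<le> d" by simp
    then have "pseudo_hyp (X 0 x) (X 0 y) \<le> \<kappa> ^ n * pseudo_hyp (X n x) (X n y)" by (rule Suc.IH)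
    also have "\<dots> \<le> \<kappa> ^ n * (\<kappa> * pseudo_hyp (X (Suc n) x) (X (Suc n) y))"
      using s \<kappa> by (intro mult_left_mono) auto
    finally show ?case by (simp add: mult_ac)
  qed simp
  show thesis
  proof (rule that[OF \<kappa>])
    fix n x y assume xy: "x \<in> C" "y \<in> C" "cmod (X n x - X n y) < 2 * pi"
    have "pseudo_hyp (X n x) (X n y) \<le> d" unfolding d_def
      using X_Re xy by (intro pseudo_hyp_le[OF c_pos]) (auto intro: less_imp_le)
    then have "pseudo_hyp (X 0 x) (X 0 y) \<le> \<kappa> ^ n * pseudo_hyp (X n x) (X n y)" by (rule iter[OF xy(1,2)])
    also have "\<dots> \<le> \<kappa> ^ n * 1"
      using \<kappa> pseudo_hyp_lt_1[OF X_pos X_pos, OF xy(1,2)] by (intro mult_left_mono) (auto intro: less_imp_le)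
    finally show "pseudo_hyp (X 0 x) (X 0 y) \<le> \<kappa> ^ n" by simp
  qed
qed

text \<open>Points of \<open>C\<close> that tend to infinity have lifts that tend to infinity: \<open>x\<close> is recovered from \<open>X n x\<close> by
  maps that are continuous on the half-plane.\<close>

lemma X_bounded_imp_bounded:
  obtains R where "\<And>x. x \<in> C \<Longrightarrow> cmod (X n x) \<le> r \<Longrightarrow> cmod x \<le> R"
proof -
  have compact_Z: "compact {u. c \<le> Re u \<and> cmod u \<le> r}" for r
  proof -
    have "{u. c \<le> Re u \<and> cmod u \<le> r} = {u. c \<le> Re u} \<inter> cball 0 r" by auto
    then show ?thesis by (simp add: closed_Int_compact closed_halfspace_Re_ge)
  qed
  have image_bounded: "\<exists>R. \<forall>u. c \<le> Re u \<and> cmod u \<le> r \<longrightarrow> cmod (g u) \<le> R"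
    if "continuous_on right_half_plane g" for g :: "complex \<Rightarrow> complex" and r
  proof -
    have "compact (g ` {u. c \<le> Re u \<and> cmod u \<le> r})"
      using c_pos by (intro compact_continuous_image[OF continuous_on_subset[OF that]] compact_Z) auto
    then have "bounded (g ` {u. c \<le> Re u \<and> cmod u \<le> r})" by (rule compact_imp_bounded)
    then obtain R where "\<forall>w\<in>g ` {u. c \<le> Re u \<and> cmod u \<le> r}. cmod w \<le> R"
      unfolding bounded_iff by (rule exE)
    then show ?thesis by (intro exI[of _ R]) auto
  qed
  have "\<exists>R. \<forall>x. x \<in> C \<and> cmod (X n x) \<le> r \<longrightarrow> cmod x \<le> R"
  proof (induction n arbitrary: r)
    case 0
    obtain R where "\<And>u. c \<le> Re u \<Longrightarrow> cmod u \<le> r \<Longrightarrow> cmod (P u) \<le> R"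
      using image_bounded[OF P_continuous] by blast
    then show ?case using X_Re P_X by (intro exI[of _ R]) force
  next
    case (Suc n)
    obtain r' where r': "\<And>u. c \<le> Re u \<Longrightarrow> cmod u \<le> r \<Longrightarrow> cmod (G n u) \<le> r'"
      using image_bounded[OF holomorphic_on_imp_continuous_on[OF G_holomorphic]] by blast
    obtain R where R: "\<And>x. x \<in> C \<Longrightarrow> cmod (X n x) \<le> r' \<Longrightarrow> cmod x \<le> R" using Suc by blast
    have "cmod x \<le> R" if "x \<in> C" "cmod (X (Suc n) x) \<le> r" for x
      using R[OF that(1)] r'[OF X_Re[OF that(1)] that(2)] G_X[OF that(1)] by simp
    then show ?case by blast
  qed
  then show thesis using that by blast
qed

text \<open>At each time \<open>n\<close> there is a function on pairs of points that tells on which side of \<open>X n y\<close> the point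
  \<open>X n x\<close> lies, inside the \<open>n\<close>-th tract.\<close>

lemma exists_side:
  obtains \<sigma> :: "complex \<times> complex \<Rightarrow> real" where
    "continuous_on (C \<times> C) \<sigma>"
    "\<And>x y. \<sigma> (x, y) = - \<sigma> (y, x)"
    "\<And>x y. x \<in> C \<Longrightarrow> y \<in> C \<Longrightarrow> \<sigma> (x, y) = 0 \<Longrightarrow> cmod (X n x - X n y) < 2 * pi"
    "\<And>A. A \<noteq> {} \<Longrightarrow> compact A \<Longrightarrow> connected A \<Longrightarrow> A \<subseteq> C \<Longrightarrow> \<exists>m\<in>A. \<forall>x\<in>A. \<sigma> (x, m) \<le> 0"
    "\<And>r. \<exists>R. \<forall>x\<in>C. \<forall>y\<in>C. cmod y \<le> r \<longrightarrow> R < cmod x \<longrightarrow> 0 < \<sigma> (x, y)"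
proof -
  define Z where "Z = {z. c \<le> Re z}"
  have ZH: "0 < Re u" if "u \<in> Z" for u using that c_pos by (simp add: Z_def)
  have p1: "continuous_on Z (G n)"
    using ZH by (intro continuous_on_subset[OF holomorphic_on_imp_continuous_on[OF G_holomorphic]]) auto
  have p2: "G n u \<noteq> G n v + 2 * pi * \<i>" if "u \<in> Z" "v \<in> Z" for u v
    using G_translates_disjoint ZH that by blast
  have p3: "\<exists>R. \<forall>u\<in>Z. R < cmod u \<longrightarrow> M < Re (G n u)" for M
    using Re_tends_to_infinity[of "G n" c M] G_in G_branch c_pos by (auto simp: Z_def)
  obtain side :: "complex \<times> complex \<Rightarrow> real" where side:
    "continuous_on (Z \<times> Z) side"
    "\<And>u v. side (u, v) = - side (v, u)"
    "\<And>u v. u \<in> Z \<Longrightarrow> v \<in> Z \<Longrightarrow> side (u, v) = 0 \<Longrightarrow> cmod (G n u - G n v) < 2 * pi"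
    "\<And>A. A \<noteq> {} \<Longrightarrow> compact A \<Longrightarrow> connected A \<Longrightarrow> A \<subseteq> Z \<Longrightarrow> \<exists>m\<in>A. \<forall>u\<in>A. side (u, m) \<le> 0"
    "\<And>B. bounded B \<Longrightarrow> \<exists>R. \<forall>u\<in>Z. \<forall>v\<in>B \<inter> Z. R < cmod u \<longrightarrow> 0 < side (u, v)"
    by (rule exists_side_function_half_plane[OF p1[unfolded Z_def] p2[unfolded Z_def] p3[unfolded Z_def], folded Z_def];
        (assumption | (rule that; assumption)))
  define Y where "Y = X (Suc n)"
  have YZ: "Y x \<in> Z" if "x \<in> C" for x using X_Re[OF that] by (simp add: Y_def Z_def)
  have GY: "G n (Y x) = X n x" if "x \<in> C" for x using G_X[OF that] by (simp add: Y_def)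
  have contY: "continuous_on C Y" unfolding Y_def by (rule X_continuous)
  define \<sigma> where "\<sigma> = (\<lambda>p. side (Y (fst p), Y (snd p)))"
  show thesis
  proof (rule that[of \<sigma>])
    show "continuous_on (C \<times> C) \<sigma>"
    proof -
      have "fst ` (C \<times> C) \<subseteq> C" "snd ` (C \<times> C) \<subseteq> C" by auto
      then have "continuous_on (C \<times> C) (\<lambda>p. (Y (fst p), Y (snd p)))"
        by (intro continuous_on_Pair continuous_on_compose2[OF contY continuous_on_fst[OF continuous_on_id]]
            continuous_on_compose2[OF contY continuous_on_snd[OF continuous_on_id]])
      then show ?thesis unfolding \<sigma>_def
        by (rule continuous_on_compose2[OF side(1)]) (use YZ in auto)
    qed
    show "\<sigma> (x, y) = - \<sigma> (y, x)" for x y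
      unfolding \<sigma>_def fst_conv snd_conv by (rule side(2))
    show "cmod (X n x - X n y) < 2 * pi" if "x \<in> C" "y \<in> C" "\<sigma> (x, y) = 0" for x y
      using side(3)[OF YZ YZ] that GY by (simp add: \<sigma>_def)
    show "\<exists>m\<in>A. \<forall>x\<in>A. \<sigma> (x, m) \<le> 0" if A: "A \<noteq> {}" "compact A" "connected A" "A \<subseteq> C" for A
    proof -
      have "continuous_on A Y" using contY A(4) by (rule continuous_on_subset)
      then have "\<exists>m\<in>Y ` A. \<forall>u\<in>Y ` A. side (u, m) \<le> 0"
        using A YZ by (intro side(4) compact_continuous_image connected_continuous_image) auto
      then show ?thesis by (auto simp: \<sigma>_def)
    qed
    show "\<exists>R. \<forall>x\<in>C. \<forall>y\<in>C. cmod y \<le> r \<longrightarrow> R < cmod x \<longrightarrow> 0 < \<sigma> (x, y)" for r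
    proof -
      have "compact (Y ` (C \<inter> cball 0 r))"
        by (intro compact_continuous_image continuous_on_subset[OF contY] closed_Int_compact closed_C) auto
      then have "bounded (Y ` (C \<inter> cball 0 r))" by (rule compact_imp_bounded)
      then have "\<exists>R. \<forall>u\<in>Z. \<forall>v\<in>Y ` (C \<inter> cball 0 r) \<inter> Z. R < cmod u \<longrightarrow> 0 < side (u, v)"
        by (rule side(5))
      then obtain R where R: "\<forall>u\<in>Z. \<forall>v\<in>Y ` (C \<inter> cball 0 r) \<inter> Z. R < cmod u \<longrightarrow> 0 < side (u, v)"
        by (rule exE)
      obtain R' where R': "\<And>x. x \<in> C \<Longrightarrow> cmod (Y x) \<le> R \<Longrightarrow> cmod x \<le> R'"
        unfolding Y_def by (rule X_bounded_imp_bounded) blast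
      have "0 < \<sigma> (x, y)" if xy: "x \<in> C" "y \<in> C" "cmod y \<le> r" "R' < cmod x" for x y
      proof -
        have "R < cmod (Y x)" using R'[OF xy(1)] xy(4) by linarith
        moreover have "Y x \<in> Z" "Y y \<in> Y ` (C \<inter> cball 0 r) \<inter> Z" using YZ xy by auto
        ultimately show ?thesis using R by (simp add: \<sigma>_def)
      qed
      then show ?thesis by blast
    qed
  qed
qed

abbreviation K :: "(complex \<times> real) set" where
  "K \<equiv> insert sphere_infty (sphere_emb ` C)"

text \<open>Small pseudo-hyperbolic distance means small Euclidean distance as long as one of the points stays
  bounded.\<close>

lemma close_pairs_same_limit:
  assumes xy: "\<And>k. x k \<in> C" "\<And>k::nat. y k \<in> C"
    and close: "(\<lambda>k. pseudo_hyp (X 0 (x k)) (X 0 (y k))) \<longlonglongrightarrow> 0"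
    and lim: "(\<lambda>k. sphere_emb (x k)) \<longlonglongrightarrow> sphere_emb s" "(\<lambda>k. sphere_emb (y k)) \<longlonglongrightarrow> t"
  shows "t = sphere_emb s"
proof -
  have "x \<longlonglongrightarrow> s" using lim(1) by (simp add: tendsto_sphere_emb_iff)
  then have s: "s \<in> C" using closed_sequentially[OF closed_C] xy(1) by blast
  define u v where "u = (\<lambda>k. X 0 (x k))" and "v = (\<lambda>k. X 0 (y k))"
  have u: "u \<longlonglongrightarrow> X 0 s"
    using X_continuous[of 0] \<open>x \<longlonglongrightarrow> s\<close> s xy(1) unfolding u_def continuous_on_sequentially
    by (auto simp: o_def)
  have pos: "0 < Re (u k)" "0 < Re (v k)" for k using X_pos xy by (auto simp: u_def v_def)
  define \<rho> where "\<rho> = (\<lambda>k. pseudo_hyp (u k) (v k))"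
  have \<rho>: "\<rho> \<longlonglongrightarrow> 0" using close by (simp add: \<rho>_def u_def v_def)
  have \<rho>1: "0 \<le> \<rho> k" "\<rho> k < 1" for k using pseudo_hyp_lt_1[OF pos] by (auto simp: \<rho>_def pseudo_hyp_nonneg)
  have bound: "cmod (u k - v k) \<le> 2 * \<rho> k * cmod (u k) / (1 - \<rho> k)" for k
  proof -
    have "cmod (u k - v k) = \<rho> k * cmod (u k + cnj (v k))"
      using add_cnj_nonzero[OF pos] by (simp add: \<rho>_def pseudo_hyp_def norm_divide)
    also have "\<dots> \<le> \<rho> k * (2 * cmod (u k) + cmod (u k - v k))"
    proof (rule mult_left_mono)
      have "cmod (u k + cnj (v k)) \<le> cmod (u k) + cmod (v k)" using norm_triangle_ineq[of "u k" "cnj (v k)"] by simp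
      moreover have "cmod (v k) \<le> cmod (u k) + cmod (u k - v k)"
        by (metis norm_triangle_sub norm_minus_commute)
      ultimately show "cmod (u k + cnj (v k)) \<le> 2 * cmod (u k) + cmod (u k - v k)" by simp
    qed (rule \<rho>1)
    finally have "cmod (u k - v k) * (1 - \<rho> k) \<le> 2 * \<rho> k * cmod (u k)" by (simp add: algebra_simps)
    then show ?thesis using \<rho>1[of k] by (simp add: pos_le_divide_eq)
  qed
  have "(\<lambda>k. 2 * \<rho> k * cmod (u k) / (1 - \<rho> k)) \<longlonglongrightarrow> 2 * 0 * cmod (X 0 s) / (1 - 0)"
    by (intro tendsto_intros \<rho> u) auto
  then have "(\<lambda>k. 2 * \<rho> k * cmod (u k) / (1 - \<rho> k)) \<longlonglongrightarrow> 0" by simp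
  then have "(\<lambda>k. u k - v k) \<longlonglongrightarrow> 0"
    by (rule Lim_null_comparison[rotated]) (auto intro: always_eventually bound)
  then have "(\<lambda>k. u k - (u k - v k)) \<longlonglongrightarrow> X 0 s - 0" using u by (intro tendsto_diff)
  then have v: "v \<longlonglongrightarrow> X 0 s" by simp
  have "isCont P (X 0 s)"
    using P_continuous open_right_half_plane X_pos[OF s] continuous_on_eq_continuous_at by fastforce
  then have "(\<lambda>k. P (v k)) \<longlonglongrightarrow> P (X 0 s)" using v by (rule isCont_tendsto_compose)
  then have "y \<longlonglongrightarrow> s" using P_X xy(2) s by (simp add: v_def)
  then have "(\<lambda>k. sphere_emb (y k)) \<longlonglongrightarrow> sphere_emb s" by (simp add: tendsto_sphere_emb_iff)
  then show ?thesis using lim(2) LIMSEQ_unique by blast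
qed

text \<open>Infinity counts as lying to the right of every point of \<open>C\<close>.\<close>

definition right_pairs ::
  "(complex \<times> complex \<Rightarrow> real) \<Rightarrow> ((complex \<times> real) \<times> (complex \<times> real)) set" where
  "right_pairs \<sigma> = {(sphere_emb x, sphere_emb y) | x y. x \<in> C \<and> y \<in> C \<and> 0 < \<sigma> (x, y)}
     \<union> {(sphere_infty, sphere_emb y) | y. y \<in> C}"

text \<open>A sequence of right pairs \<open>(x k, y k)\<close> with \<open>x k\<close> bounded cannot have \<open>y k\<close> tending to infinity,
  because \<open>y k\<close> would eventually be to the right of \<open>x k\<close>. All other limits are right pairs by
  continuity, because \<open>\<sigma>\<close> has no zeros on \<open>\<Q>\<close>.\<close>

lemma closed_right_pairs:
  assumes \<sigma>: "continuous_on (C \<times> C) \<sigma>" "\<And>x y. \<sigma> (x, y) = - \<sigma> (y, x)"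
    and far: "\<And>r. \<exists>R. \<forall>x\<in>C. \<forall>y\<in>C. cmod y \<le> r \<longrightarrow> R < cmod x \<longrightarrow> 0 < \<sigma> (x, y)"
    and \<Q>: "closed \<Q>" "\<Q> \<subseteq> K \<times> K" "(sphere_infty, sphere_infty) \<notin> \<Q>"
    and nz: "\<And>x y. x \<in> C \<Longrightarrow> y \<in> C \<Longrightarrow> (sphere_emb x, sphere_emb y) \<in> \<Q> \<Longrightarrow> \<sigma> (x, y) \<noteq> 0"
  shows "closed (\<Q> \<inter> right_pairs \<sigma>)"
  unfolding closed_sequential_limits
proof (intro allI impI, elim conjE)
  fix p l assume p: "\<forall>n. p n \<in> \<Q> \<inter> right_pairs \<sigma>" "p \<longlonglongrightarrow> l"
  have l: "l \<in> \<Q>" using closed_sequentially[OF \<Q>(1) _ p(2)] p(1) by blast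
  obtain s t where st: "l = (s, t)" by (cases l)
  have lim: "(\<lambda>k. fst (p k)) \<longlonglongrightarrow> s" "(\<lambda>k. snd (p k)) \<longlonglongrightarrow> t"
    using tendsto_fst[OF p(2)] tendsto_snd[OF p(2)] by (auto simp: st)
  have form: "\<exists>y\<in>C. snd (p k) = sphere_emb y \<and>
      (fst (p k) = sphere_infty \<or> (\<exists>x\<in>C. fst (p k) = sphere_emb x \<and> 0 < \<sigma> (x, y)))" for k
    using p(1)[rule_format, of k] by (auto simp: right_pairs_def)
  define x y where "x = (\<lambda>k. sphere_proj (fst (p k)))" and "y = (\<lambda>k. sphere_proj (snd (p k)))"
  have y: "y k \<in> C" "snd (p k) = sphere_emb (y k)" for k using form[of k] by (auto simp: y_def)
  have x: "fst (p k) = sphere_infty \<or> (x k \<in> C \<and> fst (p k) = sphere_emb (x k) \<and> 0 < \<sigma> (x k, y k))" for k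
    using form[of k] by (auto simp: x_def y_def)
  show "l \<in> \<Q> \<inter> right_pairs \<sigma>"
  proof (cases "s = sphere_infty")
    case True
    then have "t \<noteq> sphere_infty" using l \<Q>(3) st by auto
    then obtain y0 where "y0 \<in> C" "t = sphere_emb y0" using l \<Q>(2) st by auto
    then show ?thesis using l st True by (auto simp: right_pairs_def)
  next
    case False
    then obtain x0 where x0: "x0 \<in> C" "s = sphere_emb x0" using l \<Q>(2) st by auto
    have "\<forall>\<^sub>F k in sequentially. fst (p k) \<in> range sphere_emb"
      using lim(1) x unfolding x0(2) by (intro eventually_in_plane) auto
    then have ev: "\<forall>\<^sub>F k in sequentially. x k \<in> C \<and> fst (p k) = sphere_emb (x k) \<and> 0 < \<sigma> (x k, y k)"
    proof eventually_elim
      case (elim k)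
      then have "fst (p k) \<noteq> sphere_infty" by auto
      then show ?case using x[of k] by blast
    qed
    have "(\<lambda>k. sphere_emb (x k)) \<longlonglongrightarrow> sphere_emb x0"
      by (rule Lim_transform_eventually[OF lim(1)[unfolded x0(2)]])
        (use ev in \<open>auto elim: eventually_mono\<close>)
    then have xlim: "x \<longlonglongrightarrow> x0" by (simp add: tendsto_sphere_emb_iff)
    show ?thesis
    proof (cases "t = sphere_infty")
      case True
      obtain R where R: "\<And>x' y'. x' \<in> C \<Longrightarrow> y' \<in> C \<Longrightarrow> cmod y' \<le> cmod x0 + 1 \<Longrightarrow> R < cmod x' \<Longrightarrow> 0 < \<sigma> (x', y')"
        using far[of "cmod x0 + 1"] by blast
      have "filterlim y at_infinity sequentially"
        using lim(2) y(2) True by (simp add: tendsto_sphere_infty_iff)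
      then have "\<forall>\<^sub>F k in sequentially. \<bar>R\<bar> + 1 \<le> cmod (y k)"
        unfolding filterlim_at_infinity[OF order_refl] by (metis abs_ge_zero add_nonneg_pos zero_less_one)
      moreover have "\<forall>\<^sub>F k in sequentially. dist (x k) x0 < 1" using xlim by (rule tendstoD) simp
      ultimately have "\<forall>\<^sub>F k in sequentially. False" using ev
      proof eventually_elim
        case (elim k)
        have "cmod (x k) \<le> cmod x0 + 1"
          using elim norm_triangle_ineq2[of "x k" x0] by (simp add: dist_norm)
        then have "0 < \<sigma> (y k, x k)" using elim y(1) by (intro R) auto
        then show ?case using elim \<sigma>(2)[of "y k" "x k"] by simp
      qed
      then show ?thesis by simp
    next
      case False
      then obtain y0 where y0: "y0 \<in> C" "t = sphere_emb y0" using l \<Q>(2) st by auto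
      have ylim: "y \<longlonglongrightarrow> y0" using lim(2) y(2) y0(2) by (simp add: tendsto_sphere_emb_iff)
      have "((\<lambda>k. \<sigma> (x k, y k)) \<longlongrightarrow> \<sigma> (x0, y0)) sequentially"
      proof (rule continuous_on_tendsto_compose[OF \<sigma>(1)])
        show "(\<lambda>k. (x k, y k)) \<longlonglongrightarrow> (x0, y0)" by (intro tendsto_Pair xlim ylim)
        show "\<forall>\<^sub>F k in sequentially. (x k, y k) \<in> C \<times> C" using ev y(1) by (auto elim: eventually_mono)
      qed (use x0 y0 in auto)
      then have "0 \<le> \<sigma> (x0, y0)"
        by (rule tendsto_lowerbound) (use ev in \<open>auto elim!: eventually_mono\<close>)
      moreover have "\<sigma> (x0, y0) \<noteq> 0" using nz[OF x0(1) y0(1)] l st x0 y0 by simp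
      ultimately show ?thesis using l st x0 y0 by (auto simp: right_pairs_def)
    qed
  qed
qed

text \<open>A continuum of pairs on which, for every \<open>n\<close>, the two possible sides both occur contains for every
  \<open>n\<close> a pair that is close at time \<open>n\<close>. By contraction it contains pairs that are arbitrarily close.\<close>

proposition meets_diagonal:
  assumes \<Q>: "compact \<Q>" "connected \<Q>" "\<Q> \<subseteq> K \<times> K"
    and signs: "\<And>\<sigma>. \<lbrakk>continuous_on (C \<times> C) \<sigma>; \<And>x y. \<sigma> (x, y) = - \<sigma> (y, x);
       \<And>A. \<lbrakk>A \<noteq> {}; compact A; connected A; A \<subseteq> C\<rbrakk> \<Longrightarrow> \<exists>m\<in>A. \<forall>x\<in>A. \<sigma> (x, m) \<le> 0;
       \<And>x y. x \<in> C \<Longrightarrow> y \<in> C \<Longrightarrow> (sphere_emb x, sphere_emb y) \<in> \<Q> \<Longrightarrow> \<sigma> (x, y) \<noteq> 0\<rbrakk>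
       \<Longrightarrow> \<Q> \<inter> right_pairs \<sigma> \<noteq> {} \<and> prod.swap ` \<Q> \<inter> right_pairs \<sigma> \<noteq> {}"
  shows "\<exists>s\<in>K. (s, s) \<in> \<Q>"
proof (cases "(sphere_infty, sphere_infty) \<in> \<Q>")
  case True
  then show ?thesis by blast
next
  case noinf: False
  have zero: "\<exists>x y. x \<in> C \<and> y \<in> C \<and> (sphere_emb x, sphere_emb y) \<in> \<Q> \<and> cmod (X n x - X n y) < 2 * pi" for n
  proof -
    obtain \<sigma> :: "complex \<times> complex \<Rightarrow> real" where \<sigma>:
      "continuous_on (C \<times> C) \<sigma>"
      "\<And>x y. \<sigma> (x, y) = - \<sigma> (y, x)"
      "\<And>x y. x \<in> C \<Longrightarrow> y \<in> C \<Longrightarrow> \<sigma> (x, y) = 0 \<Longrightarrow> cmod (X n x - X n y) < 2 * pi"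
      "\<And>A. A \<noteq> {} \<Longrightarrow> compact A \<Longrightarrow> connected A \<Longrightarrow> A \<subseteq> C \<Longrightarrow> \<exists>m\<in>A. \<forall>x\<in>A. \<sigma> (x, m) \<le> 0"
      "\<And>r. \<exists>R. \<forall>x\<in>C. \<forall>y\<in>C. cmod y \<le> r \<longrightarrow> R < cmod x \<longrightarrow> 0 < \<sigma> (x, y)"
      by (rule exists_side[of n]) (rule that; assumption)
    have "\<exists>x y. x \<in> C \<and> y \<in> C \<and> (sphere_emb x, sphere_emb y) \<in> \<Q> \<and> \<sigma> (x, y) = 0"
    proof (rule ccontr)
      assume "\<not> ?thesis"
      then have nz: "\<And>x y. x \<in> C \<Longrightarrow> y \<in> C \<Longrightarrow> (sphere_emb x, sphere_emb y) \<in> \<Q> \<Longrightarrow> \<sigma> (x, y) \<noteq> 0"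
        by blast
      define \<Q>' where "\<Q>' = prod.swap -` \<Q>"
      have swap: "continuous_on UNIV (prod.swap :: (complex \<times> real) \<times> (complex \<times> real) \<Rightarrow> _)"
        by (simp add: prod.swap_def continuous_intros)
      have \<Q>': "closed \<Q>'" "\<Q>' \<subseteq> K \<times> K" "(sphere_infty, sphere_infty) \<notin> \<Q>'"
        unfolding \<Q>'_def using \<Q> noinf closed_vimage[OF compact_imp_closed swap] by auto
      have cl1: "closed (\<Q> \<inter> right_pairs \<sigma>)"
        by (rule closed_right_pairs[OF \<sigma>(1,2,5) compact_imp_closed[OF \<Q>(1)] \<Q>(3) noinf nz])
      have "closed (\<Q>' \<inter> right_pairs \<sigma>)"
      proof (rule closed_right_pairs[OF \<sigma>(1,2,5) \<Q>'])
        fix x y assume "x \<in> C" "y \<in> C" "(sphere_emb x, sphere_emb y) \<in> \<Q>'"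
        then show "\<sigma> (x, y) \<noteq> 0" using nz[of y x] \<sigma>(2)[of x y] by (simp add: \<Q>'_def)
      qed
      then have cl2: "closed (prod.swap -` (\<Q>' \<inter> right_pairs \<sigma>))" using swap by (rule closed_vimage)
      have cov: "\<Q> \<subseteq> (\<Q> \<inter> right_pairs \<sigma>) \<union> prod.swap -` (\<Q>' \<inter> right_pairs \<sigma>)"
      proof
        fix p assume p: "p \<in> \<Q>"
        obtain s t where st: "p = (s, t)" by (cases p)
        have "p \<in> right_pairs \<sigma> \<or> prod.swap p \<in> right_pairs \<sigma>"
        proof -
          consider "s = sphere_infty" "t \<noteq> sphere_infty" | "s \<noteq> sphere_infty" "t = sphere_infty"
            | x y where "x \<in> C" "y \<in> C" "s = sphere_emb x" "t = sphere_emb y"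
            using p \<Q>(3) st noinf by auto
          then show ?thesis
          proof cases
            case (3 x y)
            then have "\<sigma> (x, y) \<noteq> 0" using nz p st by simp
            then consider "0 < \<sigma> (x, y)" | "0 < \<sigma> (y, x)" using \<sigma>(2)[of x y] by linarith
            then show ?thesis using 3 st by cases (auto simp: right_pairs_def)
          qed (use p \<Q>(3) st in \<open>auto simp: right_pairs_def\<close>)
        qed
        then show "p \<in> (\<Q> \<inter> right_pairs \<sigma>) \<union> prod.swap -` (\<Q>' \<inter> right_pairs \<sigma>)"
          using p by (auto simp: \<Q>'_def)
      qed
      have disj: "(\<Q> \<inter> right_pairs \<sigma>) \<inter> prod.swap -` (\<Q>' \<inter> right_pairs \<sigma>) \<inter> \<Q> = {}"
      proof -
        have "\<not> (0 < \<sigma> (x, y) \<and> 0 < \<sigma> (y, x))" for x y using \<sigma>(2)[of x y] by linarith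
        then have "False" if "p \<in> right_pairs \<sigma>" "prod.swap p \<in> right_pairs \<sigma>" for p
          using that by (auto simp: right_pairs_def)
        then show ?thesis by blast
      qed
      have "(\<Q> \<inter> right_pairs \<sigma>) \<inter> \<Q> \<noteq> {}" "prod.swap -` (\<Q>' \<inter> right_pairs \<sigma>) \<inter> \<Q> \<noteq> {}"
        using signs[OF \<sigma>(1,2,4) nz] by (auto simp: \<Q>'_def)
      then show False using connected_closedD[OF \<Q>(2) disj cov cl1 cl2] by blast
    qed
    then show ?thesis using \<sigma>(3) by blast
  qed
  then obtain x y where xy: "\<And>n. x n \<in> C" "\<And>n. y n \<in> C" "\<And>n. (sphere_emb (x n), sphere_emb (y n)) \<in> \<Q>"
    "\<And>n. cmod (X n (x n) - X n (y n)) < 2 * pi" by metis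
  obtain \<kappa> where \<kappa>: "0 \<le> \<kappa>" "\<kappa> < 1"
    "\<And>n x y. x \<in> C \<Longrightarrow> y \<in> C \<Longrightarrow> cmod (X n x - X n y) < 2 * pi \<Longrightarrow> pseudo_hyp (X 0 x) (X 0 y) \<le> \<kappa> ^ n"
    by (rule close_at_time_n_imp_close) (rule that; assumption)
  have close: "(\<lambda>n. pseudo_hyp (X 0 (x n)) (X 0 (y n))) \<longlonglongrightarrow> 0"
  proof (rule tendsto_sandwich[where f = "\<lambda>_. 0" and h = "\<lambda>n. \<kappa> ^ n"])
    show "(\<lambda>n. \<kappa> ^ n) \<longlonglongrightarrow> 0" using \<kappa> by (intro LIMSEQ_power_zero) simp
    show "\<forall>\<^sub>F n in sequentially. pseudo_hyp (X 0 (x n)) (X 0 (y n)) \<le> \<kappa> ^ n"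
      using \<kappa>(3) xy by (auto intro: always_eventually)
  qed (auto simp: pseudo_hyp_nonneg)
  have "\<forall>n. (sphere_emb (x n), sphere_emb (y n)) \<in> \<Q>" using xy(3) by blast
  then obtain l r where l: "l \<in> \<Q>" "strict_mono r" "((\<lambda>n. (sphere_emb (x n), sphere_emb (y n))) \<circ> r) \<longlonglongrightarrow> l"
    by (auto elim!: seq_compactE[OF compact_imp_seq_compact[OF \<Q>(1)]])
  obtain s t where st: "l = (s, t)" by (cases l)
  have lim: "(\<lambda>k. sphere_emb (x (r k))) \<longlonglongrightarrow> s" "(\<lambda>k. sphere_emb (y (r k))) \<longlonglongrightarrow> t"
    using tendsto_fst[OF l(3)] tendsto_snd[OF l(3)] by (auto simp: st o_def)
  have closer: "(\<lambda>k. pseudo_hyp (X 0 (x (r k))) (X 0 (y (r k)))) \<longlonglongrightarrow> 0"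
    using LIMSEQ_subseq_LIMSEQ[OF close l(2)] by (simp add: o_def)
  have closer': "(\<lambda>k. pseudo_hyp (X 0 (y (r k))) (X 0 (x (r k)))) \<longlonglongrightarrow> 0"
  proof -
    have "pseudo_hyp u v = pseudo_hyp v u" for u v
    proof -
      have "cmod (u + cnj v) = cmod (v + cnj u)"
        by (metis add.commute complex_cnj_add complex_cnj_cnj complex_mod_cnj)
      then show ?thesis by (simp add: pseudo_hyp_def norm_divide norm_minus_commute)
    qed
    then show ?thesis using closer by simp
  qed
  have "s = t"
  proof -
    have "s \<in> K" "t \<in> K" using l(1) \<Q>(3) st by auto
    then consider "s = sphere_infty" "t = sphere_infty" | x0 where "s = sphere_emb x0" | y0 where "t = sphere_emb y0"
      by auto
    then show ?thesis
    proof cases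
      case 2
      then show ?thesis using close_pairs_same_limit[of "\<lambda>k. x (r k)" "\<lambda>k. y (r k)"] xy(1,2) closer lim by metis
    next
      case 3
      then show ?thesis using close_pairs_same_limit[of "\<lambda>k. y (r k)" "\<lambda>k. x (r k)"] xy(1,2) closer' lim by metis
    qed simp
  qed
  then show ?thesis using l(1) st \<Q>(3) by auto
qed

lemma infinity_pairs_signs:
  assumes "(sphere_infty, t) \<in> \<Q>" "(s, sphere_infty) \<in> \<Q>" "\<Q> \<subseteq> K \<times> K" "s \<noteq> sphere_infty" "t \<noteq> sphere_infty"
  shows "\<Q> \<inter> right_pairs \<sigma> \<noteq> {} \<and> prod.swap ` \<Q> \<inter> right_pairs \<sigma> \<noteq> {}"
proof
  obtain y where "y \<in> C" "t = sphere_emb y" using assms by auto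
  then show "\<Q> \<inter> right_pairs \<sigma> \<noteq> {}" using assms(1) by (auto simp: right_pairs_def)
  obtain x where x: "x \<in> C" "s = sphere_emb x" using assms by auto
  then have "(sphere_infty, s) \<in> right_pairs \<sigma>" by (auto simp: right_pairs_def)
  moreover have "(sphere_infty, s) \<in> prod.swap ` \<Q>" using assms(2) by force
  ultimately show "prod.swap ` \<Q> \<inter> right_pairs \<sigma> \<noteq> {}" by blast
qed

theorem terminal_point_infinity:
  assumes K: "continuum K"
  shows "terminal_point K sphere_infty"
  unfolding terminal_point_def
proof (intro conjI allI impI K)
  fix A B assume "subcontinuum A K \<and> subcontinuum B K \<and> sphere_infty \<in> A \<inter> B"
  then have A: "compact A" "connected A" "A \<subseteq> K" "sphere_infty \<in> A"
    and B: "compact B" "connected B" "B \<subseteq> K" "sphere_infty \<in> B"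
    by (auto simp: subcontinuum_def continuum_def)
  show "A \<subseteq> B \<or> B \<subseteq> A"
  proof (rule ccontr)
    assume "\<not> (A \<subseteq> B \<or> B \<subseteq> A)"
    then obtain a b where ab: "a \<in> A" "a \<notin> B" "b \<in> B" "b \<notin> A" by blast
    define \<Q> where "\<Q> = A \<times> {b} \<union> {a} \<times> B"
    have "\<exists>s\<in>K. (s, s) \<in> \<Q>"
    proof (rule meets_diagonal)
      show "compact \<Q>" unfolding \<Q>_def by (intro compact_Un compact_Times A B compact_sing)
      have "(a, b) \<in> (A \<times> {b}) \<inter> ({a} \<times> B)" using ab by auto
      then show "connected \<Q>" unfolding \<Q>_def
        by (intro connected_Un connected_Times A B connected_sing) blast
      show sub: "\<Q> \<subseteq> K \<times> K" unfolding \<Q>_def using A B ab by blast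
      show "\<Q> \<inter> right_pairs \<sigma> \<noteq> {} \<and> prod.swap ` \<Q> \<inter> right_pairs \<sigma> \<noteq> {}" for \<sigma>
      proof (rule infinity_pairs_signs[OF _ _ sub])
        show "(sphere_infty, b) \<in> \<Q>" "(a, sphere_infty) \<in> \<Q>" using A B by (auto simp: \<Q>_def)
        show "a \<noteq> sphere_infty" "b \<noteq> sphere_infty" using ab A B by auto
      qed
    qed
    then show False using ab by (auto simp: \<Q>_def)
  qed
qed simp

theorem span_zero_sphere_closure:
  assumes K: "continuum K"
  shows "span_zero K"
  unfolding span_zero_def
proof (intro conjI allI impI K)
  fix \<A> A
  assume "subcontinuum \<A> (K \<times> K) \<and> subcontinuum A K \<and> fst ` \<A> = A \<and> snd ` \<A> = A"
  then have \<A>: "compact \<A>" "connected \<A>" "\<A> \<subseteq> K \<times> K" and A: "A \<noteq> {}" "compact A" "connected A" "A \<subseteq> K"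
    and proj: "fst ` \<A> = A" "snd ` \<A> = A" by (auto simp: subcontinuum_def continuum_def)
  have fst: "\<exists>t. (s, t) \<in> \<A> \<and> t \<in> A" if "s \<in> A" for s
    using that proj by (metis (no_types, lifting) image_iff prod.collapse snd_conv)
  have snd: "\<exists>s. (s, t) \<in> \<A> \<and> s \<in> A" if "t \<in> A" for t
    using that proj by (metis (no_types, lifting) image_iff prod.collapse fst_conv)
  show "\<exists>x\<in>K. (x, x) \<in> \<A>"
  proof (cases "sphere_infty \<in> A")
    case True
    then obtain s t where st: "(sphere_infty, t) \<in> \<A>" "(s, sphere_infty) \<in> \<A>"
      using fst snd by blast
    show ?thesis
    proof (cases "s = sphere_infty \<or> t = sphere_infty")
      case True
      then show ?thesis using st by auto
    next
      case False
      then have inf: "s \<noteq> sphere_infty" "t \<noteq> sphere_infty" by simp_all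
      show ?thesis
        by (rule meets_diagonal[OF \<A>]) (rule infinity_pairs_signs[OF st \<A>(3) inf])
    qed
  next
    case False
    define A' where "A' = sphere_proj ` A"
    have AC: "A \<subseteq> sphere_emb ` C" using A(4) False by auto
    have A': "A' \<noteq> {}" "compact A'" "connected A'" "A' \<subseteq> C"
    proof -
      have "continuous_on A sphere_proj"
        using AC by (intro continuous_on_subset[OF continuous_on_sphere_proj]) auto
      then show "compact A'" "connected A'" unfolding A'_def
        using A by (auto intro: compact_continuous_image connected_continuous_image)
      show "A' \<noteq> {}" "A' \<subseteq> C" using A(1) AC by (auto simp: A'_def)
    qed
    have emb: "\<exists>x\<in>A'. s = sphere_emb x" if "s \<in> A" for s
      using that AC by (force simp: A'_def)
    have emb': "sphere_emb x \<in> A" if "x \<in> A'" for x using that AC by (auto simp: A'_def)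
    show ?thesis
    proof (rule meets_diagonal[OF \<A>])
      fix \<sigma> :: "complex \<times> complex \<Rightarrow> real"
      assume \<sigma>: "\<And>x y. \<sigma> (x, y) = - \<sigma> (y, x)"
        and ext: "\<And>A. \<lbrakk>A \<noteq> {}; compact A; connected A; A \<subseteq> C\<rbrakk> \<Longrightarrow> \<exists>m\<in>A. \<forall>x\<in>A. \<sigma> (x, m) \<le> 0"
        and nz: "\<And>x y. x \<in> C \<Longrightarrow> y \<in> C \<Longrightarrow> (sphere_emb x, sphere_emb y) \<in> \<A> \<Longrightarrow> \<sigma> (x, y) \<noteq> 0"
      obtain m where m: "m \<in> A'" "\<And>x. x \<in> A' \<Longrightarrow> \<sigma> (x, m) \<le> 0" using ext[OF A'] by blast
      obtain t where "(sphere_emb m, t) \<in> \<A>" "t \<in> A" using fst[OF emb'[OF m(1)]] by blast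
      then obtain y where y: "y \<in> A'" "(sphere_emb m, sphere_emb y) \<in> \<A>" using emb by blast
      obtain s where "(s, sphere_emb m) \<in> \<A>" "s \<in> A" using snd[OF emb'[OF m(1)]] by blast
      then obtain x where x: "x \<in> A'" "(sphere_emb x, sphere_emb m) \<in> \<A>" using emb by blast
      have C: "x \<in> C" "y \<in> C" "m \<in> C" using A'(4) x y m by auto
      have "0 < \<sigma> (m, y)" using m(2)[OF y(1)] nz[OF C(3,2) y(2)] \<sigma>[of m y] by linarith
      then have "(sphere_emb m, sphere_emb y) \<in> right_pairs \<sigma>" using C by (auto simp: right_pairs_def)
      moreover have "0 < \<sigma> (m, x)" using m(2)[OF x(1)] nz[OF C(1,3) x(2)] \<sigma>[of m x] by linarith
      then have "(sphere_emb m, sphere_emb x) \<in> right_pairs \<sigma>" using C by (auto simp: right_pairs_def)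
      moreover have "(sphere_emb m, sphere_emb x) \<in> prod.swap ` \<A>" using x(2) by force
      ultimately show "\<A> \<inter> right_pairs \<sigma> \<noteq> {} \<and> prod.swap ` \<A> \<inter> right_pairs \<sigma> \<noteq> {}" using y(2) by blast
    qed
  qed
qed

end

section \<open>The Fatou set of a disjoint-type function is an attracting basin\<close>

lemma norm_sphere_emb: "norm (sphere_emb z) = 1"
proof -
  have "sphere_emb z \<in> sphere 0 1 - {sphere_infty}"
    by (rule bij_betw_apply[OF bij_betw_sphere_emb UNIV_I])
  then show ?thesis by simp
qed

lemma inner_sphere_emb: "\<bar>sphere_emb z \<bullet> sphere_emb w\<bar> \<le> 1"
  using Cauchy_Schwarz_ineq2[of "sphere_emb z" "sphere_emb w"] by (simp add: norm_sphere_emb)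

lemma isCont_sphere_emb: "isCont sphere_emb z"
  using continuous_on_sphere_emb[of UNIV] by (simp add: continuous_on_eq_continuous_at)

lemma tendsto_spherical_dist:
  assumes "(f \<longlongrightarrow> a) F" "(g \<longlongrightarrow> b) F"
  shows "((\<lambda>x. spherical_dist (f x) (g x)) \<longlongrightarrow> spherical_dist a b) F"
  unfolding spherical_dist_def
proof (rule continuous_on_tendsto_compose[OF continuous_on_arccos'])
  show "((\<lambda>x. sphere_emb (f x) \<bullet> sphere_emb (g x)) \<longlongrightarrow> sphere_emb a \<bullet> sphere_emb b) F"
    by (intro tendsto_inner isCont_tendsto_compose[OF isCont_sphere_emb] assms)
qed (use inner_sphere_emb in \<open>auto simp: abs_le_iff intro!: always_eventually\<close>)

lemma spherical_dist_refl: "spherical_dist z z = 0"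
  by (simp add: spherical_dist_def dot_square_norm norm_sphere_emb)

lemma spherical_dist_nonneg: "0 \<le> spherical_dist z w"
  using inner_sphere_emb[of z w] by (simp add: spherical_dist_def arccos_lbound abs_le_iff)

lemma spherical_dist_small_on_bounded:
  assumes "\<epsilon> > 0"
  shows "\<exists>\<delta>>0. \<forall>z w. cmod z \<le> M \<longrightarrow> cmod w \<le> M \<longrightarrow> dist z w < \<delta> \<longrightarrow> spherical_dist z w < \<epsilon>"
proof (rule ccontr)
  assume "\<not> ?thesis"
  then have "\<exists>z w. cmod z \<le> M \<and> cmod w \<le> M \<and> dist z w < 1 / real (Suc n) \<and> \<epsilon> \<le> spherical_dist z w" for n
    by (metis not_le divide_pos_pos of_nat_0_less_iff zero_less_Suc zero_less_one)
  then obtain z w where zw: "\<And>n. cmod (z n) \<le> M" "\<And>n. cmod (w n) \<le> M"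
    "\<And>n. dist (z n) (w n) < 1 / real (Suc n)" "\<And>n. \<epsilon> \<le> spherical_dist (z n) (w n)" by metis
  have "\<forall>n. z n \<in> cball 0 M" using zw by simp
  then obtain l r where l: "strict_mono r" "(z \<circ> r) \<longlonglongrightarrow> l"
    by (rule seq_compactE[OF compact_imp_seq_compact[OF compact_cball]]) blast
  have "(\<lambda>n. dist (z n) (w n)) \<longlonglongrightarrow> 0"
  proof (rule tendsto_sandwich[where f = "\<lambda>_. 0" and h = "\<lambda>n. 1 / real (Suc n)"])
    show "(\<lambda>n. 1 / real (Suc n)) \<longlonglongrightarrow> 0" by real_asymp
  qed (use zw(3) in \<open>auto intro: always_eventually less_imp_le\<close>)
  then have d: "(\<lambda>n. dist (z (r n)) (w (r n))) \<longlonglongrightarrow> 0"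
    using LIMSEQ_subseq_LIMSEQ[OF _ l(1)] by (force simp: o_def)
  have lz: "(\<lambda>n. z (r n)) \<longlonglongrightarrow> l" using l(2) by (simp add: o_def)
  have "(\<lambda>n. w (r n) - z (r n)) \<longlonglongrightarrow> 0"
    using d by (simp add: dist_norm norm_minus_commute[of "z _"] tendsto_norm_zero_iff)
  then have lw: "(\<lambda>n. w (r n)) \<longlonglongrightarrow> l" by (rule Lim_transform[OF lz])
  have "(\<lambda>n. spherical_dist (z (r n)) (w (r n))) \<longlonglongrightarrow> spherical_dist l l"
    by (rule tendsto_spherical_dist[OF lz lw])
  then have "\<epsilon> \<le> spherical_dist l l"
    by (rule tendsto_lowerbound) (use zw(4) in auto)
  then show False using assms by (simp add: spherical_dist_refl)
qed

text \<open>This transfers equicontinuity in the spherical metric to entering a Euclidean disc around an attracting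
  point.\<close>

lemma spherical_dist_controls_dist:
  assumes r: "r > 0"
  shows "\<exists>\<epsilon>>0. \<forall>a b. spherical_dist a b < \<epsilon> \<longrightarrow> dist b p \<le> r / 2 \<longrightarrow> dist a p < r"
proof (rule ccontr)
  assume "\<not> ?thesis"
  then have "\<exists>a b. spherical_dist a b < 1 / real (Suc n) \<and> dist b p \<le> r / 2 \<and> r \<le> dist a p" for n
    by (metis not_le divide_pos_pos of_nat_0_less_iff zero_less_Suc zero_less_one)
  then obtain a b where ab: "\<And>n. spherical_dist (a n) (b n) < 1 / real (Suc n)"
    "\<And>n. dist (b n) p \<le> r / 2" "\<And>n. r \<le> dist (a n) p" by metis
  have "\<forall>n. b n \<in> cball p (r / 2)" using ab by (simp add: dist_commute)
  then obtain l s where l: "strict_mono s" "(b \<circ> s) \<longlonglongrightarrow> l"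
    by (rule seq_compactE[OF compact_imp_seq_compact[OF compact_cball]]) blast
  have "(\<lambda>n. spherical_dist (a n) (b n)) \<longlonglongrightarrow> 0"
  proof (rule tendsto_sandwich[where f = "\<lambda>_. 0" and h = "\<lambda>n. 1 / real (Suc n)"])
    show "(\<lambda>n. 1 / real (Suc n)) \<longlonglongrightarrow> 0" by real_asymp
  qed (use ab(1) spherical_dist_nonneg in \<open>auto intro: always_eventually less_imp_le\<close>)
  then have "(\<lambda>n. cos (spherical_dist (a n) (b n))) \<longlonglongrightarrow> cos 0" by (rule tendsto_cos)
  moreover have "cos (spherical_dist z w) = sphere_emb z \<bullet> sphere_emb w" for z w
    unfolding spherical_dist_def using inner_sphere_emb[of z w] by (intro cos_arccos) (auto simp: abs_le_iff)
  ultimately have "(\<lambda>n. sphere_emb (a n) \<bullet> sphere_emb (b n)) \<longlonglongrightarrow> 1" by simp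
  moreover have "norm (sphere_emb z - sphere_emb w) ^ 2 = 2 - 2 * (sphere_emb z \<bullet> sphere_emb w)" for z w
    using norm_sphere_emb[of z] norm_sphere_emb[of w]
    by (simp add: power2_norm_eq_inner inner_diff_left inner_diff_right inner_commute norm_eq_1)
  ultimately have "(\<lambda>n. norm (sphere_emb (a n) - sphere_emb (b n)) ^ 2) \<longlonglongrightarrow> 2 - 2 * 1"
    by (simp only:) (intro tendsto_intros)
  then have "(\<lambda>n. sqrt (norm (sphere_emb (a n) - sphere_emb (b n)) ^ 2)) \<longlonglongrightarrow> sqrt (2 - 2 * 1)"
    by (rule tendsto_real_sqrt)
  then have "(\<lambda>n. norm (sphere_emb (a n) - sphere_emb (b n))) \<longlonglongrightarrow> 0" by simp
  then have "(\<lambda>n. norm (sphere_emb (a (s n)) - sphere_emb (b (s n)))) \<longlonglongrightarrow> 0"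
    using LIMSEQ_subseq_LIMSEQ[OF _ l(1)] by (force simp: o_def)
  then have diff: "(\<lambda>n. sphere_emb (a (s n)) - sphere_emb (b (s n))) \<longlonglongrightarrow> 0" by (rule tendsto_norm_zero_cancel)
  have lb: "(\<lambda>n. b (s n)) \<longlonglongrightarrow> l" using l(2) by (simp add: o_def)
  then have "(\<lambda>n. sphere_emb (b (s n))) \<longlonglongrightarrow> sphere_emb l" by (rule isCont_tendsto_compose[OF isCont_sphere_emb])
  then have "(\<lambda>n. sphere_emb (a (s n))) \<longlonglongrightarrow> sphere_emb l"
    using tendsto_add[OF diff] by fastforce
  then have "(\<lambda>n. a (s n)) \<longlonglongrightarrow> l" by (simp add: tendsto_sphere_emb_iff)
  then have "(\<lambda>n. dist (a (s n)) p) \<longlonglongrightarrow> dist l p" by (intro tendsto_intros)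
  then have "r \<le> dist l p" by (rule tendsto_lowerbound) (use ab(3) in auto)
  moreover have "(\<lambda>n. dist (b (s n)) p) \<longlonglongrightarrow> dist l p" using lb by (intro tendsto_intros)
  then have "dist l p \<le> r / 2" by (rule tendsto_upperbound) (use ab(2) in auto)
  ultimately show False using r by simp
qed

lemma open_Fatou_set: "open (Fatou_set f)"
  unfolding open_subopen[of "Fatou_set f"] by (auto simp: Fatou_set_def)

lemma closed_Julia_set: "closed (Julia_set f)"
  unfolding Julia_set_def by (rule closed_Compl[OF open_Fatou_set])

lemma iterate_continuous: "f holomorphic_on UNIV \<Longrightarrow> continuous_on S (f ^^ n)"
  using holomorphic_power_iterate holomorphic_on_imp_continuous_on continuous_on_subset by blast

lemma iterate_isCont: "f holomorphic_on UNIV \<Longrightarrow> isCont (f ^^ n) z"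
  using iterate_continuous[of f UNIV n] by (simp add: continuous_on_eq_continuous_at)

text \<open>Uniformly bounded iterates are equicontinuous, by Cauchy's estimate.\<close>

lemma bounded_orbits_in_Fatou_set:
  assumes f: "f holomorphic_on UNIV" and U: "open U" "\<And>n z. z \<in> U \<Longrightarrow> cmod ((f ^^ n) z) \<le> M"
  shows "U \<subseteq> Fatou_set f"
proof -
  have "spherically_equicontinuous_on U (range (\<lambda>n. f ^^ n))"
    unfolding spherically_equicontinuous_on_def
  proof (intro ballI allI impI)
    fix z \<epsilon> assume z: "z \<in> U" and \<epsilon>: "(0::real) < \<epsilon>"
    obtain R where R: "R > 0" "ball z R \<subseteq> U" using U(1) z openE by blast
    define \<rho> where "\<rho> = R / 3"
    have \<rho>: "\<rho> > 0" using R by (simp add: \<rho>_def)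
    have M: "0 \<le> M" using U(2)[OF z] norm_ge_zero order_trans by blast
    have lip: "cmod ((f ^^ n) z - (f ^^ n) w) \<le> M / \<rho> * cmod (z - w)" if w: "w \<in> ball z \<rho>" for n w
    proof (rule field_differentiable_bound[of "ball z \<rho>" _ "deriv (f ^^ n)"])
      have hol: "(f ^^ n) holomorphic_on S" for S
        using holomorphic_power_iterate[OF f] holomorphic_on_subset by blast
      show "((f ^^ n) has_field_derivative deriv (f ^^ n) x) (at x within ball z \<rho>)" for x
        by (rule has_field_derivative_at_within[OF holomorphic_derivI[OF hol[of UNIV] open_UNIV UNIV_I]])
      show "cmod (deriv (f ^^ n) x) \<le> M / \<rho>" if x: "x \<in> ball z \<rho>" for x
      proof -
        have "cmod ((deriv ^^ 1) (f ^^ n) x) \<le> fact 1 * M / \<rho> ^ 1"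
        proof (rule Cauchy_inequality[OF hol holomorphic_on_imp_continuous_on[OF hol] \<rho>])
          fix y assume "cmod (x - y) = \<rho>"
          then have "dist z y < R" using x \<rho> dist_triangle[of z y x] by (simp add: \<rho>_def dist_norm)
          then show "cmod ((f ^^ n) y) \<le> M" using R U(2) by (simp add: subset_iff)
        qed
        then show ?thesis by simp
      qed
    qed (use w \<rho> in auto)
    obtain \<delta> where \<delta>: "\<delta> > 0" "\<And>a b. cmod a \<le> M \<Longrightarrow> cmod b \<le> M \<Longrightarrow> dist a b < \<delta> \<Longrightarrow> spherical_dist a b < \<epsilon>"
      using spherical_dist_small_on_bounded[OF \<epsilon>] by blast
    define \<eta> where "\<eta> = min \<rho> (\<delta> * \<rho> / (M + 1))"
    have "\<eta> > 0" using \<rho> \<delta> M by (simp add: \<eta>_def)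
    moreover have "spherical_dist ((f ^^ n) z) ((f ^^ n) w) < \<epsilon>" if w: "w \<in> U" "dist z w < \<eta>" for w n
    proof (rule \<delta>(2))
      have "cmod ((f ^^ n) z - (f ^^ n) w) \<le> M / \<rho> * cmod (z - w)" using w by (intro lip) (simp add: \<eta>_def)
      also have "\<dots> \<le> (M / \<rho>) * (\<delta> * \<rho> / (M + 1))"
        using w M \<rho> by (intro mult_left_mono) (auto simp: \<eta>_def dist_norm)
      also have "\<dots> = \<delta> * (M / (M + 1))" using \<rho> by simp
      also have "\<dots> < \<delta> * 1" using \<delta>(1) M by (intro mult_strict_left_mono) auto
      finally show "dist ((f ^^ n) z) ((f ^^ n) w) < \<delta>" by (simp add: dist_norm)
    qed (use U(2) z w in auto)
    ultimately show "\<exists>\<delta>>0. \<forall>w\<in>U. dist z w < \<delta> \<longrightarrow> (\<forall>g\<in>range (\<lambda>n. f ^^ n). spherical_dist (g z) (g w) < \<epsilon>)"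
      by blast
  qed
  then show ?thesis using U(1) by (auto simp: Fatou_set_def)
qed

lemma Fatou_set_backward:
  assumes f: "f holomorphic_on UNIV" and z: "(f ^^ k) z \<in> Fatou_set f"
  shows "z \<in> Fatou_set f"
proof -
  obtain U where U: "open U" "(f ^^ k) z \<in> U" "spherically_equicontinuous_on U (range (\<lambda>n. f ^^ n))"
    using z by (auto simp: Fatou_set_def)
  define V where "V = (f ^^ k) -` U"
  have "spherically_equicontinuous_on V (range (\<lambda>n. f ^^ n))"
    unfolding spherically_equicontinuous_on_def
  proof (intro ballI allI impI)
    fix x \<epsilon> assume x: "x \<in> V" and \<epsilon>: "(0::real) < \<epsilon>"
    obtain \<delta> where \<delta>: "\<delta> > 0"
      "\<And>w n. w \<in> U \<Longrightarrow> dist ((f ^^ k) x) w < \<delta> \<Longrightarrow> spherical_dist ((f ^^ n) ((f ^^ k) x)) ((f ^^ n) w) < \<epsilon>"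
      using U(3) x \<epsilon> unfolding spherically_equicontinuous_on_def V_def by (metis rangeI vimageD)
    have "\<forall>\<^sub>F w in nhds x. dist ((f ^^ k) w) ((f ^^ k) x) < \<delta>"
      using iterate_isCont[OF f, where n = k and z = x] \<delta>(1) unfolding isCont_def tendsto_at_iff_tendsto_nhds by (rule tendstoD)
    moreover have "\<forall>\<^sub>F w in nhds x. \<forall>n\<in>{..<k}. spherical_dist ((f ^^ n) x) ((f ^^ n) w) < \<epsilon>"
    proof (rule eventually_ball_finite)
      show "\<forall>n\<in>{..<k}. \<forall>\<^sub>F w in nhds x. spherical_dist ((f ^^ n) x) ((f ^^ n) w) < \<epsilon>"
      proof
        fix n
        have "((f ^^ n) \<longlongrightarrow> (f ^^ n) x) (nhds x)"
          using iterate_isCont[OF f, where n = n and z = x] unfolding isCont_def tendsto_at_iff_tendsto_nhds .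
        then have "((\<lambda>w. spherical_dist ((f ^^ n) x) ((f ^^ n) w)) \<longlongrightarrow> spherical_dist ((f ^^ n) x) ((f ^^ n) x)) (nhds x)"
          by (intro tendsto_spherical_dist tendsto_const)
        then show "\<forall>\<^sub>F w in nhds x. spherical_dist ((f ^^ n) x) ((f ^^ n) w) < \<epsilon>"
          using \<epsilon> by (intro order_tendstoD(2)) (auto simp: spherical_dist_refl)
      qed
    qed simp
    ultimately have "\<forall>\<^sub>F w in nhds x. dist ((f ^^ k) w) ((f ^^ k) x) < \<delta> \<and>
        (\<forall>n\<in>{..<k}. spherical_dist ((f ^^ n) x) ((f ^^ n) w) < \<epsilon>)" by (rule eventually_conj)
    then obtain d where d: "d > 0" "\<And>w. dist w x < d \<Longrightarrow> dist ((f ^^ k) w) ((f ^^ k) x) < \<delta>"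
      "\<And>w n. dist w x < d \<Longrightarrow> n < k \<Longrightarrow> spherical_dist ((f ^^ n) x) ((f ^^ n) w) < \<epsilon>"
      unfolding eventually_nhds_metric by auto
    have "spherical_dist ((f ^^ n) x) ((f ^^ n) w) < \<epsilon>" if w: "w \<in> V" "dist x w < d" for w n
    proof (cases "n < k")
      case True
      then show ?thesis using d(3)[of w n] w by (simp add: dist_commute)
    next
      case False
      have split: "(f ^^ n) y = (f ^^ (n - k)) ((f ^^ k) y)" for y
        using False by (metis comp_apply funpow_add le_add_diff_inverse2 not_less)
      show ?thesis unfolding split using w d(2)[of w] by (intro \<delta>(2)) (auto simp: V_def dist_commute)
    qed
    then show "\<exists>\<delta>>0. \<forall>w\<in>V. dist x w < \<delta> \<longrightarrow> (\<forall>g\<in>range (\<lambda>n. f ^^ n). spherical_dist (g x) (g w) < \<epsilon>)"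
      using d(1) by blast
  qed
  moreover have "open V" unfolding V_def by (rule open_vimage[OF U(1) iterate_continuous[OF f]])
  ultimately show ?thesis using U(2) by (auto simp: Fatou_set_def V_def)
qed

lemma attracting_fixed_point:
  assumes g: "g holomorphic_on UNIV" "g p = p" "cmod (deriv g p) < 1"
  obtains r \<mu> where "r > 0" "0 \<le> \<mu>" "\<mu> < 1"
    "\<And>z k. z \<in> cball p r \<Longrightarrow> cmod ((g ^^ k) z - p) \<le> \<mu> ^ k * cmod (z - p)"
proof -
  obtain \<mu> where \<mu>: "cmod (deriv g p) < \<mu>" "\<mu> < 1" using g(3) dense by blast
  have \<mu>0: "0 \<le> \<mu>" using \<mu>(1) norm_ge_zero[of "deriv g p"] by linarith
  have "(g has_field_derivative deriv g p) (at p)" using g(1) by (intro holomorphic_derivI) auto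
  then have "((\<lambda>z. (g z - g p) / (z - p)) \<longlongrightarrow> deriv g p) (at p)" by (simp add: has_field_derivative_iff)
  then have "\<forall>\<^sub>F z in at p. cmod ((g z - g p) / (z - p)) < \<mu>"
    using \<mu>(1) by (intro order_tendstoD(2)[OF tendsto_norm])
  then obtain d where d: "d > 0" "\<And>z. z \<noteq> p \<Longrightarrow> dist z p < d \<Longrightarrow> cmod ((g z - g p) / (z - p)) < \<mu>"
    unfolding eventually_at by auto
  have step: "cmod (g z - p) \<le> \<mu> * cmod (z - p)" if "dist z p < d" for z
  proof (cases "z = p")
    case False
    then show ?thesis using d(2)[OF False that] g(2) by (simp add: norm_divide divide_simps)
  qed (simp add: g(2))
  have "cmod ((g ^^ k) z - p) \<le> \<mu> ^ k * cmod (z - p)" if z: "z \<in> cball p (d / 2)" for z k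
  proof (induction k)
    case (Suc k)
    have "\<mu> ^ k * cmod (z - p) \<le> 1 * (d / 2)"
      using z \<mu> \<mu>0 by (intro mult_mono power_le_one) (auto simp: dist_norm norm_minus_commute)
    then have "dist ((g ^^ k) z) p < d" using Suc d(1) by (simp add: dist_norm)
    then have "cmod (g ((g ^^ k) z) - p) \<le> \<mu> * cmod ((g ^^ k) z - p)" by (rule step)
    also have "\<dots> \<le> \<mu> * (\<mu> ^ k * cmod (z - p))" using Suc \<mu>0 by (rule mult_left_mono)
    finally show ?case by (simp add: mult_ac)
  qed simp
  then show thesis using d(1) \<mu> \<mu>0 by (intro that[of "d / 2" \<mu>]) auto
qed

lemma attracting_fixed_point_tendsto:
  assumes "0 \<le> \<mu>" "\<mu> < 1" "\<And>k. cmod ((g ^^ k) z - p) \<le> \<mu> ^ k * c"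
  shows "(\<lambda>k. (g ^^ k) z) \<longlonglongrightarrow> p"
proof -
  have "(\<lambda>k. \<mu> ^ k * c) \<longlonglongrightarrow> 0 * c" using assms by (intro tendsto_intros LIMSEQ_power_zero) simp
  then have "(\<lambda>k. \<mu> ^ k * c) \<longlonglongrightarrow> 0" by simp
  then have "(\<lambda>k. (g ^^ k) z - p) \<longlonglongrightarrow> 0"
    by (rule Lim_null_comparison[rotated]) (use assms(3) in \<open>auto intro: always_eventually\<close>)
  then show ?thesis by (simp add: LIM_zero_iff)
qed

lemma funpow_funpow:
  fixes f :: "'a \<Rightarrow> 'a"
  shows "((f ^^ n) ^^ k) z = (f ^^ (n * k)) z"
  by (induction k) (simp_all add: funpow_add)

lemma attracting_cycle_in_Fatou_set:
  assumes f: "f holomorphic_on UNIV" and p: "n > 0" "(f ^^ n) p = p" "cmod (deriv (f ^^ n) p) < 1"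
  shows "(f ^^ j) p \<in> Fatou_set f"
proof -
  define g where "g = f ^^ n"
  have g: "g holomorphic_on UNIV" unfolding g_def by (rule holomorphic_power_iterate[OF f])
  obtain r \<mu> where r: "r > 0" "0 \<le> \<mu>" "\<mu> < 1"
    "\<And>z k. z \<in> cball p r \<Longrightarrow> cmod ((g ^^ k) z - p) \<le> \<mu> ^ k * cmod (z - p)"
    by (rule attracting_fixed_point[OF g]) (use p g_def in auto)
  have gball: "(g ^^ k) z \<in> cball p r" if "z \<in> cball p r" for z k
  proof -
    have "\<mu> ^ k * cmod (z - p) \<le> 1 * cmod (z - p)" using r by (intro mult_right_mono power_le_one) auto
    then show ?thesis using r(4)[OF that, of k] that by (simp add: dist_norm norm_minus_commute)
  qed
  have "compact (\<Union>j\<in>{..<n}. (f ^^ j) ` cball p r)"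
    by (intro compact_UN compact_continuous_image iterate_continuous[OF f]) auto
  then have "bounded (\<Union>j\<in>{..<n}. (f ^^ j) ` cball p r)" by (rule compact_imp_bounded)
  then obtain M where M: "\<forall>z\<in>(\<Union>j\<in>{..<n}. (f ^^ j) ` cball p r). cmod z \<le> M"
    unfolding bounded_iff by (rule exE)
  have "ball p r \<subseteq> Fatou_set f"
  proof (rule bounded_orbits_in_Fatou_set[OF f open_ball])
    fix m z assume z: "z \<in> ball p r"
    have "(f ^^ m) z = (f ^^ (m mod n)) ((g ^^ (m div n)) z)"
      unfolding g_def funpow_funpow by (metis comp_apply funpow_add mod_mult_div_eq)
    moreover have "(g ^^ (m div n)) z \<in> cball p r" using z by (intro gball) auto
    moreover have "m mod n < n" using p(1) by simp
    ultimately show "cmod ((f ^^ m) z) \<le> M" using M by (metis UN_I imageI lessThan_iff)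
  qed
  then have pF: "p \<in> Fatou_set f" using r(1) by auto
  have "(f ^^ (n * j - j)) ((f ^^ j) p) = p"
  proof -
    have "j \<le> n * j" using p(1) by simp
    then have "(f ^^ (n * j - j)) ((f ^^ j) p) = (f ^^ (n * j)) p"
      by (metis comp_apply funpow_add le_add_diff_inverse2)
    also have "\<dots> = (g ^^ j) p" by (simp add: g_def funpow_funpow)
    also have "\<dots> = p" using p(2) by (induction j) (auto simp: g_def)
    finally show ?thesis .
  qed
  then show ?thesis using Fatou_set_backward[OF f, of "n * j - j"] pF by simp
qed

text \<open>The basin of an attracting periodic point is open, and it is closed in the Fatou set by
  equicontinuity.\<close>

proposition connected_Fatou_set_eq_basin:
  assumes f: "f holomorphic_on UNIV" and conn: "connected (Fatou_set f)"
    and p: "n > 0" "(f ^^ n) p = p" "cmod (deriv (f ^^ n) p) < 1"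
  shows "Fatou_set f = {z. (\<lambda>k. ((f ^^ n) ^^ k) z) \<longlonglongrightarrow> p}"
proof -
  define g where "g = f ^^ n"
  have g: "g holomorphic_on UNIV" unfolding g_def by (rule holomorphic_power_iterate[OF f])
  obtain r \<mu> where r: "r > 0" "0 \<le> \<mu>" "\<mu> < 1"
    "\<And>z k. z \<in> cball p r \<Longrightarrow> cmod ((g ^^ k) z - p) \<le> \<mu> ^ k * cmod (z - p)"
    by (rule attracting_fixed_point[OF g]) (use p g_def in auto)
  have pF: "p \<in> Fatou_set f" using attracting_cycle_in_Fatou_set[OF f p, of 0] by simp
  obtain r' where r': "r' > 0" "ball p r' \<subseteq> Fatou_set f" using open_Fatou_set pF openE by blast
  define \<rho> where "\<rho> = min r r'"
  have \<rho>: "\<rho> > 0" using r r' by (simp add: \<rho>_def)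
  define B where "B = {z. (\<lambda>k. (g ^^ k) z) \<longlonglongrightarrow> p}"
  have B_iff: "z \<in> B \<longleftrightarrow> (\<exists>k. (g ^^ k) z \<in> ball p \<rho>)" for z
  proof
    assume "z \<in> B"
    then have "\<forall>\<^sub>F k in sequentially. dist ((g ^^ k) z) p < \<rho>" using \<rho> by (auto simp: B_def intro: tendstoD)
    then obtain k where "dist ((g ^^ k) z) p < \<rho>" using eventually_happens'[OF sequentially_bot] by blast
    then show "\<exists>k. (g ^^ k) z \<in> ball p \<rho>" by (auto simp: dist_commute)
  next
    assume "\<exists>k. (g ^^ k) z \<in> ball p \<rho>"
    then obtain k where k: "(g ^^ k) z \<in> ball p \<rho>" by blast
    then have "(g ^^ k) z \<in> cball p r" by (simp add: \<rho>_def)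
    then have "(\<lambda>j. (g ^^ j) ((g ^^ k) z)) \<longlonglongrightarrow> p"
      by (intro attracting_fixed_point_tendsto[OF r(2,3)]) (rule r(4))
    then have "(\<lambda>j. (g ^^ (j + k)) z) \<longlonglongrightarrow> p" by (simp add: funpow_add)
    then have "(\<lambda>j. (g ^^ j) z) \<longlonglongrightarrow> p" by (rule LIMSEQ_offset)
    then show "z \<in> B" by (simp add: B_def)
  qed
  have BF: "B \<subseteq> Fatou_set f"
  proof
    fix z assume "z \<in> B"
    then obtain k where "(g ^^ k) z \<in> ball p \<rho>" using B_iff by blast
    then have "(g ^^ k) z \<in> Fatou_set f" using r'(2) by (auto simp: \<rho>_def)
    then show "z \<in> Fatou_set f" unfolding g_def funpow_funpow by (rule Fatou_set_backward[OF f])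
  qed
  have "B = (\<Union>k. (g ^^ k) -` ball p \<rho>)" using B_iff by auto
  then have "open B" by (simp add: open_vimage[OF open_ball iterate_continuous[OF g]] open_UN)
  then have op: "openin (top_of_set (Fatou_set f)) B" using BF by (simp add: openin_open_eq open_Fatou_set)
  have cl: "closedin (top_of_set (Fatou_set f)) B"
    unfolding closedin_limpt
  proof (intro conjI allI impI BF)
    fix z assume z: "z islimpt B \<and> z \<in> Fatou_set f"
    obtain \<epsilon> where \<epsilon>: "\<epsilon> > 0" "\<And>a b. spherical_dist a b < \<epsilon> \<Longrightarrow> dist b p \<le> \<rho> / 2 \<Longrightarrow> dist a p < \<rho>"
      using spherical_dist_controls_dist[OF \<rho>] by blast
    obtain U where U: "open U" "z \<in> U" "spherically_equicontinuous_on U (range (\<lambda>n. f ^^ n))"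
      using z by (auto simp: Fatou_set_def)
    obtain \<delta> where \<delta>: "\<delta> > 0"
      "\<And>w n. w \<in> U \<Longrightarrow> dist z w < \<delta> \<Longrightarrow> spherical_dist ((f ^^ n) z) ((f ^^ n) w) < \<epsilon>"
      using U(2,3) \<epsilon>(1) unfolding spherically_equicontinuous_on_def by (metis rangeI)
    have "open (U \<inter> ball z \<delta>)" "z \<in> U \<inter> ball z \<delta>" using U \<delta> by auto
    then obtain b where b: "b \<in> B" "b \<in> U \<inter> ball z \<delta>" using z unfolding islimpt_def by blast
    have "(\<lambda>k. (g ^^ k) b) \<longlonglongrightarrow> p" using b(1) by (simp add: B_def)
    then have "\<forall>\<^sub>F k in sequentially. dist ((g ^^ k) b) p < \<rho> / 2" by (rule tendstoD) (use \<rho> in simp)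
    then obtain k where k: "dist ((g ^^ k) b) p < \<rho> / 2" using eventually_happens'[OF sequentially_bot] by blast
    have "spherical_dist ((g ^^ k) z) ((g ^^ k) b) < \<epsilon>"
      unfolding g_def funpow_funpow using b(2) by (intro \<delta>(2)) auto
    then have "dist ((g ^^ k) z) p < \<rho>" using k by (intro \<epsilon>(2)) auto
    then show "z \<in> B" using B_iff by (auto simp: dist_commute)
  qed
  have "p \<in> B" using B_iff[of p] \<rho> by (metis centre_in_ball funpow_0)
  moreover have "B = {} \<or> B = Fatou_set f"
    by (rule connected_clopen[THEN iffD1, rule_format, OF conn conjI[OF op cl]])
  ultimately show ?thesis by (auto simp: B_def g_def)
qed

lemma deriv_iterate_fixed_point:
  assumes f: "f holomorphic_on UNIV" "f p = p"
  shows "deriv (f ^^ n) p = deriv f p ^ n"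
proof (induction n)
  case (Suc n)
  have fd: "h field_differentiable at x" if "h holomorphic_on UNIV" for h and x :: complex
    using that by (simp add: holomorphic_on_imp_differentiable_at)
  have fp: "(f ^^ n) p = p" using f(2) by (induction n) auto
  have "deriv (f \<circ> (f ^^ n)) p = deriv f ((f ^^ n) p) * deriv (f ^^ n) p"
    by (rule deriv_chain) (auto intro: fd f holomorphic_power_iterate)
  then show ?case using Suc fp by (simp add: o_def)
qed simp

text \<open>The point \<open>f p\<close> is in the same basin as \<open>p\<close>, but it is fixed by \<open>f ^^ n\<close>.\<close>

lemma connected_Fatou_set_attracting_fixed_point:
  assumes f: "f holomorphic_on UNIV" and conn: "connected (Fatou_set f)"
    and p: "n > 0" "(f ^^ n) p = p" "cmod (deriv (f ^^ n) p) < 1"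
  shows "f p = p" "cmod (deriv f p) < 1" "Fatou_set f = {z. (\<lambda>k. (f ^^ k) z) \<longlonglongrightarrow> p}"
proof -
  have F: "Fatou_set f = {z. (\<lambda>k. ((f ^^ n) ^^ k) z) \<longlonglongrightarrow> p}"
    by (rule connected_Fatou_set_eq_basin[OF f conn p])
  have "((f ^^ n) ^^ k) (f p) = f p" for k
  proof (induction k)
    case (Suc k)
    moreover have "(f ^^ n) (f p) = f p" using funpow_swap1[of f n p] p(2) by simp
    ultimately show ?case by simp
  qed simp
  moreover have "f p \<in> Fatou_set f" using attracting_cycle_in_Fatou_set[OF f p, of 1] by simp
  ultimately have "(\<lambda>k::nat. f p) \<longlonglongrightarrow> p" unfolding F by simp
  then show fp: "f p = p" by (simp add: LIMSEQ_const_iff)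
  have "cmod (deriv f p) ^ n < 1 ^ n"
    using p(3) deriv_iterate_fixed_point[OF f fp, of n] by (simp add: norm_power)
  then show d: "cmod (deriv f p) < 1" by (rule power_less_imp_less_base) simp
  show "Fatou_set f = {z. (\<lambda>k. (f ^^ k) z) \<longlonglongrightarrow> p}"
    using connected_Fatou_set_eq_basin[OF f conn, of 1 p] fp d by simp
qed

text \<open>A function without singular values would have global inverse branches, and would be a proper map.\<close>

lemma singular_set_nonempty:
  assumes f: "transcendental_entire f"
  shows "singular_set f \<noteq> {}"
proof
  assume "singular_set f = {}"
  then have reg: "regular_values f = UNIV"
    by (auto simp: singular_set_def regular_values_def)
  have hol: "f holomorphic_on UNIV" using f by (simp add: transcendental_entire_def)
  have nc: "\<not> f constant_on UNIV" by (rule transcendental_entire_not_constant[OF f])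
  have "\<exists>g. holomorphic_lift f (\<lambda>w. w) (ball (f 0) (real (Suc n))) g \<and> g (f 0) = 0" for n
    by (rule holomorphic_lift_exists_ball[OF hol nc, of "\<lambda>w. w" "f 0" "real (Suc n)" 0])
      (auto simp: reg intro: holomorphic_intros)
  then obtain g where g: "\<And>n. holomorphic_lift f (\<lambda>w. w) (ball (f 0) (real (Suc n))) (g n)" "\<And>n. g n (f 0) = 0"
    by metis
  have gf: "g n (f z) = z" if n: "\<And>t. cmod t \<le> cmod z \<Longrightarrow> cmod (f t - f 0) < real (Suc n)" for n z
  proof (rule holomorphic_lifts_agree[where G = "\<lambda>t. g n (f t)" and G' = "\<lambda>t. t" and Q = f and a = 0
        and U = "{t. cmod t \<le> cmod z}", OF hol])
    show "connected {t. cmod t \<le> cmod z}" using convex_connected[OF convex_cball[of 0 "cmod z"]]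
      by (simp add: cball_def dist_norm)
    have fin: "f t \<in> ball (f 0) (real (Suc n))" if "cmod t \<le> cmod z" for t
      using n[OF that] by (simp add: dist_norm norm_minus_commute)
    have "(g n \<circ> f) holomorphic_on {t. cmod t \<le> cmod z}"
      by (rule holomorphic_on_compose_gen[OF holomorphic_on_subset[OF hol]])
        (use g(1)[of n] fin in \<open>auto simp: holomorphic_lift_def\<close>)
    then show "holomorphic_lift f f {t. cmod t \<le> cmod z} (\<lambda>t. g n (f t))"
      using g(1)[of n] fin by (auto simp: holomorphic_lift_def o_def)
    show "holomorphic_lift f f {t. cmod t \<le> cmod z} (\<lambda>t. t)" by (auto simp: holomorphic_lift_def intro: holomorphic_intros)
  qed (auto simp: reg g)
  have ex_n: "\<exists>n\<ge>N. \<forall>t. cmod t \<le> cmod z \<longrightarrow> cmod (f t - f 0) < real (Suc n)" for N z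
  proof -
    have "compact ((\<lambda>t. f t - f 0) ` cball 0 (cmod z))"
      by (intro compact_continuous_image continuous_intros holomorphic_on_imp_continuous_on holomorphic_on_subset[OF hol]) auto
    then have "bounded ((\<lambda>t. f t - f 0) ` cball 0 (cmod z))" by (rule compact_imp_bounded)
    then obtain b where b: "\<forall>w\<in>(\<lambda>t. f t - f 0) ` cball 0 (cmod z). cmod w \<le> b" unfolding bounded_iff by (rule exE)
    obtain m :: nat where m: "b < real m" using reals_Archimedean2 by blast
    have "cmod (f t - f 0) < real (Suc (max N m))" if "cmod t \<le> cmod z" for t
    proof -
      have "cmod (f t - f 0) \<le> b" using b that by simp
      also have "\<dots> < real m" by (rule m)
      also have "real m \<le> real (Suc (max N m))" by simp
      finally show ?thesis .
    qed
    then show ?thesis by (intro exI[of _ "max N m"]) simp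
  qed
  have "\<exists>B. \<forall>z. B < cmod z \<longrightarrow> R < cmod (f z)" for R
  proof -
    obtain N :: nat where N: "\<bar>R\<bar> + cmod (f 0) < real N" using reals_Archimedean2 by blast
    have RN: "w \<in> ball (f 0) (real (Suc N))" if "cmod w \<le> R" for w
      using that N norm_triangle_ineq4[of "f 0" w] by (simp add: dist_norm)
    have "compact (g N ` cball 0 R)"
      using g(1)[of N] RN unfolding holomorphic_lift_def
      by (intro compact_continuous_image continuous_on_subset[OF holomorphic_on_imp_continuous_on]) auto
    then have "bounded (g N ` cball 0 R)" by (rule compact_imp_bounded)
    then obtain B where B: "\<forall>w\<in>g N ` cball 0 R. cmod w \<le> B" unfolding bounded_iff by (rule exE)
    have "cmod z \<le> B" if z: "cmod (f z) \<le> R" for z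
    proof -
      obtain n where n: "n \<ge> N" "\<And>t. cmod t \<le> cmod z \<Longrightarrow> cmod (f t - f 0) < real (Suc n)"
        using ex_n by blast
      have "g n (f z) = g N (f z)"
      proof (rule holomorphic_lifts_agree[where G = "g n" and G' = "g N" and Q = "\<lambda>w. w" and a = "f 0"
            and U = "ball (f 0) (real (Suc N))", OF hol])
        show "holomorphic_lift f (\<lambda>w. w) (ball (f 0) (real (Suc N))) (g n)"
          by (rule holomorphic_lift_subset[OF g(1)]) (use n(1) in auto)
      qed (use g RN[OF z] in \<open>auto simp: reg\<close>)
      then have "z = g N (f z)" using gf[OF n(2)] by simp
      then show ?thesis using B z by (metis imageI mem_cball_0)
    qed
    then show ?thesis by (meson not_le)
  qed
  then show False by (rule transcendental_not_tending_to_infinity[OF f])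
qed

text \<open>The orbit of a singular value enters the neighbourhood of an attracting cycle and thus the Fatou set,
  which is invariant under preimages.\<close>

proposition disjoint_type_basin:
  assumes "disjoint_type f"
  obtains p where "f p = p" "cmod (deriv f p) < 1" "Fatou_set f = {z. (\<lambda>k. (f ^^ k) z) \<longlonglongrightarrow> p}"
    "compact (singular_set f)" "singular_set f \<subseteq> Fatou_set f"
proof -
  have tr: "transcendental_entire f" and conn: "connected (Fatou_set f)" and bdd: "bounded (singular_set f)"
    and hyp: "\<And>s. s \<in> singular_set f \<Longrightarrow> \<exists>Z. attracting_cycle f Z \<and> (\<lambda>k. infdist ((f ^^ k) s) Z) \<longlonglongrightarrow> 0"
    using assms by (auto simp: disjoint_type_def hyperbolic_def)
  have f: "f holomorphic_on UNIV" using tr by (simp add: transcendental_entire_def)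
  have SF: "singular_set f \<subseteq> Fatou_set f"
  proof
    fix s assume "s \<in> singular_set f"
    then obtain Z where Z: "attracting_cycle f Z" "(\<lambda>k. infdist ((f ^^ k) s) Z) \<longlonglongrightarrow> 0" using hyp by blast
    then obtain p n where p: "n > 0" "(f ^^ n) p = p" "cmod (deriv (f ^^ n) p) < 1" "Z = (\<lambda>k. (f ^^ k) p) ` {..<n}"
      by (auto simp: attracting_cycle_def)
    have "finite Z" "Z \<noteq> {}" using p by auto
    moreover have "Z \<subseteq> Fatou_set f" unfolding p(4) using attracting_cycle_in_Fatou_set[OF f p(1-3)] by auto
    ultimately obtain e where e: "e > 0" "(\<Union>x\<in>Z. ball x e) \<subseteq> Fatou_set f"
      using compact_subset_open_imp_ball_epsilon_subset[OF finite_imp_compact open_Fatou_set] by metis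
    have "\<forall>\<^sub>F k in sequentially. infdist ((f ^^ k) s) Z < e"
      using Z(2) e(1) by (rule order_tendstoD(2))
    then obtain k where k: "infdist ((f ^^ k) s) Z < e" using eventually_happens'[OF sequentially_bot] by blast
    obtain x where "x \<in> Z" "infdist ((f ^^ k) s) Z = dist ((f ^^ k) s) x"
      using infdist_attains_inf[OF finite_imp_closed[OF \<open>finite Z\<close>] \<open>Z \<noteq> {}\<close>] by metis
    then have "(f ^^ k) s \<in> ball x e" using k by (simp add: dist_commute)
    then have "(f ^^ k) s \<in> Fatou_set f" using e(2) \<open>x \<in> Z\<close> by blast
    then show "s \<in> Fatou_set f" by (rule Fatou_set_backward[OF f])
  qed
  obtain s where "s \<in> singular_set f" using singular_set_nonempty[OF tr] by blast
  then obtain Z where "attracting_cycle f Z" using hyp by blast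
  then obtain p n where p: "n > 0" "(f ^^ n) p = p" "cmod (deriv (f ^^ n) p) < 1"
    by (auto simp: attracting_cycle_def)
  have "closed (singular_set f)" unfolding singular_set_def by (rule closed_closure)
  then have "compact (singular_set f)" using bdd by (simp add: compact_eq_bounded_closed)
  then show thesis using that connected_Fatou_set_attracting_fixed_point[OF f conn p] SF by blast
qed

section \<open>A trapping continuum\<close>

text \<open>The maximum principle in a topological form: for an open map, the boundary of \<open>g ` U\<close> comes from the
  boundary of \<open>U\<close>, and \<open>T\<close> cannot be contained in the bounded set \<open>g ` U\<close>.\<close>

lemma unbounded_connected_avoids_image:
  fixes g :: "complex \<Rightarrow> complex"
  assumes g: "continuous_on (closure U) g" "open (g ` U)" and U: "open U" "bounded U"
    and T: "connected T" "\<not> bounded T" "T \<inter> g ` frontier U = {}"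
  shows "T \<inter> g ` U = {}"
proof (rule ccontr)
  assume meet: "T \<inter> g ` U \<noteq> {}"
  have cpt: "compact (g ` closure U)"
    using g(1) U(2) by (intro compact_continuous_image) (auto simp: compact_closure)
  have sub: "g ` U \<subseteq> g ` closure U" using closure_subset by (rule image_mono)
  have "bounded (g ` U)" using compact_imp_bounded[OF cpt] sub by (rule bounded_subset)
  then have "T - g ` U \<noteq> {}" using T(2) bounded_subset by blast
  then obtain y where y: "y \<in> T" "y \<in> frontier (g ` U)" using connected_Int_frontier[OF T(1) meet] by blast
  have "closure (g ` U) \<subseteq> g ` closure U" using sub compact_imp_closed[OF cpt] by (rule closure_minimal)
  then have "y \<in> g ` closure U" "y \<notin> g ` U" using y(2) g(2) by (auto simp: frontier_def interior_open)
  then obtain x where "y = g x" "x \<in> closure U" "x \<notin> U" by blast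
  then have "y \<in> g ` frontier U" using U(1) by (auto simp: frontier_def interior_open)
  then show False using T(3) y(1) by blast
qed

lemma bounded_open_neighbourhood:
  fixes L :: "complex set"
  assumes L: "compact L" and B: "open B" "L \<subseteq> B"
  obtains V where "open V" "bounded V" "L \<subseteq> V" "closure V \<subseteq> B" "connected L \<Longrightarrow> connected V"
proof -
  obtain e where e: "e > 0" "(\<Union>x\<in>L. cball x e) \<subseteq> B"
    by (rule compact_subset_open_imp_cball_epsilon_subset[OF L B])
  define V where "V = (\<Union>x\<in>L. ball x e)"
  define M where "M = {x + y | x y. x \<in> L \<and> y \<in> cball 0 e}"
  have M: "compact M" unfolding M_def by (rule compact_sums[OF L compact_cball])
  have VM: "V \<subseteq> M"
  proof
    fix z assume "z \<in> V"
    then obtain x where "x \<in> L" "z \<in> ball x e" by (auto simp: V_def)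
    then have "z = x + (z - x)" "z - x \<in> cball 0 e" by (auto simp: dist_norm norm_minus_commute)
    then show "z \<in> M" using \<open>x \<in> L\<close> unfolding M_def by blast
  qed
  have MB: "M \<subseteq> B"
  proof
    fix z assume "z \<in> M"
    then obtain x y where "x \<in> L" "y \<in> cball 0 e" "z = x + y" unfolding M_def by blast
    then have "z \<in> cball x e" by (simp add: dist_norm)
    then show "z \<in> B" using e(2) \<open>x \<in> L\<close> by blast
  qed
  have LV: "L \<subseteq> V" using e(1) by (auto simp: V_def)
  show thesis
  proof
    show "open V" by (auto simp: V_def)
    show "bounded V" using compact_imp_bounded[OF M] VM by (rule bounded_subset)
    show "closure V \<subseteq> B" using closure_minimal[OF VM compact_imp_closed[OF M]] MB by blast
    show "connected V" if conn: "connected L"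
    proof (cases "L = {}")
      case False
      have "V = \<Union>((\<lambda>x. L \<union> ball x e) ` L)" using LV by (auto simp: V_def)
      moreover have "connected (\<Union>((\<lambda>x. L \<union> ball x e) ` L))"
      proof (rule connected_Union)
        show "connected s" if "s \<in> (\<lambda>x. L \<union> ball x e) ` L" for s
          using that e(1) conn by (auto intro!: connected_Un)
        show "\<Inter>((\<lambda>x. L \<union> ball x e) ` L) \<noteq> {}" using False by auto
      qed
      ultimately show ?thesis by simp
    qed (simp add: V_def)
  qed (rule LV)
qed

text \<open>Cover \<open>S\<close> by finitely many discs and join them to \<open>p\<close> by paths.\<close>

lemma compact_connected_superset:
  fixes S U :: "complex set"
  assumes U: "open U" "connected U" and S: "compact S" "S \<subseteq> U" and p: "p \<in> U"
  obtains L where "compact L" "connected L" "S \<subseteq> L" "p \<in> L" "L \<subseteq> U"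
proof -
  obtain e where e: "e > 0" "(\<Union>x\<in>S. cball x e) \<subseteq> U"
    by (rule compact_subset_open_imp_cball_epsilon_subset[OF S(1) U(1) S(2)])
  have cov: "S \<subseteq> (\<Union>x\<in>S. ball x e)" using e(1) by auto
  obtain D where D: "D \<subseteq> S" "finite D" "S \<subseteq> (\<Union>x\<in>D. ball x e)"
    by (rule compactE_image[OF S(1) _ cov]) (rule open_ball, (rule that; assumption))
  have "path_connected U" using U connected_open_path_connected by blast
  then have "\<forall>x\<in>S. \<exists>g. path g \<and> path_image g \<subseteq> U \<and> pathstart g = p \<and> pathfinish g = x"
    using p S(2) unfolding path_connected_def by blast
  then obtain \<gamma> where \<gamma>: "\<And>x. x \<in> S \<Longrightarrow> path (\<gamma> x)" "\<And>x. x \<in> S \<Longrightarrow> path_image (\<gamma> x) \<subseteq> U"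
    "\<And>x. x \<in> S \<Longrightarrow> pathstart (\<gamma> x) = p" "\<And>x. x \<in> S \<Longrightarrow> pathfinish (\<gamma> x) = x" by metis
  define \<L> where "\<L> = insert {p} ((\<lambda>x. path_image (\<gamma> x) \<union> cball x e) ` D)"
  have mem: "p \<in> path_image (\<gamma> x)" "x \<in> path_image (\<gamma> x)" if "x \<in> D" for x
    using \<gamma>(3,4)[of x] that D(1) by (metis pathstart_in_path_image subsetD, metis pathfinish_in_path_image subsetD)
  show thesis
  proof
    show "compact (\<Union>\<L>)" unfolding \<L>_def
      using D \<gamma>(1) by (intro compact_Union) (auto intro!: compact_Un compact_path_image)
    show "connected (\<Union>\<L>)"
    proof (rule connected_Union)
      show "connected s" if s: "s \<in> \<L>" for s
      proof (cases "s = {p}")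
        case False
        then obtain x where x: "x \<in> D" "s = path_image (\<gamma> x) \<union> cball x e" using s by (auto simp: \<L>_def)
        have "x \<in> path_image (\<gamma> x) \<inter> cball x e" using mem(2)[OF x(1)] e(1) by simp
        then have "path_image (\<gamma> x) \<inter> cball x e \<noteq> {}" by blast
        moreover have "connected (path_image (\<gamma> x))" using \<gamma>(1) x(1) D(1) by (intro connected_path_image) auto
        ultimately show ?thesis unfolding x(2) by (intro connected_Un) auto
      qed simp
      have "p \<in> \<Inter>\<L>" using mem(1) by (auto simp: \<L>_def)
      then show "\<Inter>\<L> \<noteq> {}" by blast
    qed
    show "S \<subseteq> \<Union>\<L>"
    proof
      fix z assume "z \<in> S"
      then obtain x where "x \<in> D" "z \<in> ball x e" using D(3) by blast
      then have "z \<in> path_image (\<gamma> x) \<union> cball x e" "path_image (\<gamma> x) \<union> cball x e \<in> \<L>"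
        by (simp_all add: \<L>_def)
      then show "z \<in> \<Union>\<L>" by blast
    qed
    show "p \<in> \<Union>\<L>" by (simp add: \<L>_def)
    show "\<Union>\<L> \<subseteq> U"
    proof
      fix z assume "z \<in> \<Union>\<L>"
      then consider "z = p" | x where "x \<in> D" "z \<in> path_image (\<gamma> x)" | x where "x \<in> D" "z \<in> cball x e"
        by (auto simp: \<L>_def)
      then show "z \<in> U"
      proof cases
        case 2 then show ?thesis using \<gamma>(2) D(1) by blast
      next
        case 3 then show ?thesis using e(2) D(1) by blast
      qed (use p in simp)
    qed
  qed
qed

text \<open>A continuum in the basin is surrounded by a trapping domain: take a neighbourhood of the continuum,
  of its image, and so on, until the images have entered a trapping disc.\<close>

lemma trapping_domain:
  fixes f :: "complex \<Rightarrow> complex"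
  assumes f: "continuous_on UNIV f" "f p = p" and r: "r > 0" "f ` cball p r \<subseteq> ball p r"
    and L: "compact L" "connected L" "p \<in> L" "(f ^^ N) ` L \<subseteq> ball p r"
  shows "\<exists>D. open D \<and> bounded D \<and> connected D \<and> L \<subseteq> D \<and> ball p r \<subseteq> D \<and> f ` closure D \<subseteq> D"
  using L
proof (induction N arbitrary: L)
  case 0
  then show ?case using r by (intro exI[of _ "ball p r"]) auto
next
  case (Suc N)
  have fL: "continuous_on L f" using f(1) continuous_on_subset by blast
  have "(f ^^ N) ` f ` L \<subseteq> ball p r" using Suc.prems(4) by (auto simp: funpow_swap1)
  moreover have "p \<in> f ` L" using Suc.prems(3) f(2) by (metis imageI)
  ultimately obtain D where D: "open D" "bounded D" "connected D" "f ` L \<subseteq> D" "ball p r \<subseteq> D" "f ` closure D \<subseteq> D"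
    using Suc.IH[OF compact_continuous_image[OF fL Suc.prems(1)] connected_continuous_image[OF fL Suc.prems(2)]]
    by blast
  have "open (f -` D)" using f(1) D(1) by (simp add: open_vimage)
  moreover have "L \<subseteq> f -` D" using D(4) by blast
  ultimately obtain V where V: "open V" "bounded V" "L \<subseteq> V" "closure V \<subseteq> f -` D" "connected L \<Longrightarrow> connected V"
    by (rule bounded_open_neighbourhood[OF Suc.prems(1)]) (rule that; assumption)
  have "p \<in> D" "p \<in> V" using D(5) r(1) V(3) Suc.prems(3) by auto
  then have "D \<inter> V \<noteq> {}" by blast
  then have "connected (D \<union> V)" using D(3) V(5)[OF Suc.prems(2)] by (rule connected_Un[rotated 2])
  moreover have "f ` closure (D \<union> V) \<subseteq> D \<union> V" using D(6) V(4) by (auto simp: closure_Un)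
  ultimately show ?case using D V by (intro exI[of _ "D \<union> V"]) auto
qed

lemma compact_covered_by_increasing_preimages:
  fixes f :: "complex \<Rightarrow> complex"
  assumes L: "compact L" and f: "f holomorphic_on UNIV" and B: "open B" "f ` B \<subseteq> B"
    and ex: "\<And>z. z \<in> L \<Longrightarrow> \<exists>k. (f ^^ k) z \<in> B"
  obtains N where "(f ^^ N) ` L \<subseteq> B"
proof -
  have cov: "L \<subseteq> (\<Union>k\<in>UNIV. (f ^^ k) -` B)" using ex by auto
  have op: "open ((f ^^ k) -` B)" for k by (rule open_vimage[OF B(1) iterate_continuous[OF f]])
  obtain C' where C': "finite C'" "L \<subseteq> (\<Union>k\<in>C'. (f ^^ k) -` B)"
    by (rule compactE_image[OF L _ cov]) (rule op, (rule that; assumption))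
  have iter: "(f ^^ k) z \<in> B" if "z \<in> B" for k z
    using that B(2) by (induction k) auto
  have "(f ^^ Max (insert 0 C')) z \<in> B" if z: "z \<in> L" for z
  proof -
    obtain k where k: "k \<in> C'" "(f ^^ k) z \<in> B" using C'(2) z by blast
    have "k \<le> Max (insert 0 C')" using C'(1) k(1) by simp
    then have "(f ^^ Max (insert 0 C')) z = (f ^^ (Max (insert 0 C') - k)) ((f ^^ k) z)"
      by (metis comp_apply funpow_add le_add_diff_inverse2)
    then show ?thesis using iter[OF k(2)] by simp
  qed
  then show thesis by (intro that[of "Max (insert 0 C')"]) auto
qed

lemma open_iterate_image:
  assumes f: "f holomorphic_on UNIV" "\<not> f constant_on UNIV" and U: "open U"
  shows "open ((f ^^ n) ` U)"
proof (induction n)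
  case (Suc n)
  have "open (f ` (f ^^ n) ` U)"
    by (rule open_mapping_thm[OF f(1) open_UNIV connected_UNIV Suc subset_UNIV f(2)])
  then show ?case by (simp add: image_comp o_def)
qed (simp add: U)

text \<open>The closure of a trapping domain \<open>D\<close> around the singular values, with the holes filled in. The
  maximum principle shows that filling the holes does not destroy the trapping property. Orbits in the basin
  enter \<open>D\<close>, and orbits that enter \<open>K\<close> are bounded, so that \<open>K\<close> decides about membership in the Fatou set.\<close>

proposition disjoint_type_trap:
  assumes dt: "disjoint_type f"
  obtains K p where "compact K" "connected K" "connected (- K)" "p \<in> interior K"
    "singular_set f \<subseteq> K" "f ` K \<subseteq> interior K" "Julia_set f = {z. \<forall>n. (f ^^ n) z \<notin> K}"
proof -
  have tr: "transcendental_entire f" and conn: "connected (Fatou_set f)"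
    using dt by (auto simp: disjoint_type_def hyperbolic_def)
  have f: "f holomorphic_on UNIV" using tr by (simp add: transcendental_entire_def)
  have fcont: "continuous_on S f" for S using iterate_continuous[OF f, of S 1] by simp
  have nc: "\<not> f constant_on UNIV" by (rule transcendental_entire_not_constant[OF tr])
  obtain p where p: "f p = p" "cmod (deriv f p) < 1" and F: "Fatou_set f = {z. (\<lambda>k. (f ^^ k) z) \<longlonglongrightarrow> p}"
    and S: "compact (singular_set f)" "singular_set f \<subseteq> Fatou_set f"
    by (rule disjoint_type_basin[OF dt])
  obtain r \<mu> where r: "r > 0" "0 \<le> \<mu>" "\<mu> < 1"
    "\<And>z k. z \<in> cball p r \<Longrightarrow> cmod ((f ^^ k) z - p) \<le> \<mu> ^ k * cmod (z - p)"
    by (rule attracting_fixed_point[OF f p]) (rule that; assumption)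
  have disc: "f ` cball p r \<subseteq> ball p r"
  proof clarify
    fix z assume z: "z \<in> cball p r"
    have "cmod (f z - p) \<le> \<mu> * cmod (z - p)" using r(4)[OF z, of 1] by simp
    also have "\<dots> \<le> \<mu> * r" using z r(2) by (intro mult_left_mono) (auto simp: dist_norm norm_minus_commute)
    also have "\<dots> < 1 * r" using r by (intro mult_strict_right_mono) auto
    finally show "f z \<in> ball p r" by (simp add: dist_norm norm_minus_commute)
  qed
  have fp: "(f ^^ k) p = p" for k using p(1) by (induction k) auto
  have pF: "p \<in> Fatou_set f" unfolding F using fp by simp
  obtain L where L: "compact L" "connected L" "singular_set f \<subseteq> L" "p \<in> L" "L \<subseteq> Fatou_set f"
    by (rule compact_connected_superset[OF open_Fatou_set conn S pF])
  have "\<exists>k. (f ^^ k) z \<in> ball p r" if "z \<in> L" for z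
  proof -
    have "(\<lambda>k. (f ^^ k) z) \<longlonglongrightarrow> p" using that L(5) F by blast
    then have "\<forall>\<^sub>F k in sequentially. dist ((f ^^ k) z) p < r" using r(1) by (rule tendstoD)
    then obtain k where "dist ((f ^^ k) z) p < r" using eventually_happens'[OF sequentially_bot] by blast
    then show ?thesis by (auto simp: dist_commute)
  qed
  moreover have "f ` ball p r \<subseteq> ball p r" using disc ball_subset_cball by blast
  ultimately obtain N where N: "(f ^^ N) ` L \<subseteq> ball p r"
    using compact_covered_by_increasing_preimages[OF L(1) f open_ball] by metis
  obtain D where D: "open D" "bounded D" "connected D" "L \<subseteq> D" "ball p r \<subseteq> D" "f ` closure D \<subseteq> D"
    using trapping_domain[OF fcont p(1) r(1) disc L(1,2,4) N] by blast
  define I where "I = inside (closure D)"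
  define K where "K = closure D \<union> I"
  define W where "W = outside (closure D)"
  have bdd: "bounded (closure D)" using D(2) by (rule bounded_closure)
  have KW: "K = - W" unfolding K_def I_def W_def by (rule union_with_inside)
  have W: "open W" "connected W" "\<not> bounded W"
    unfolding W_def using bdd unbounded_outside[OF bdd] by (simp_all add: open_outside connected_outside)
  have DK: "D \<subseteq> interior K"
  proof (rule interior_maximal[OF _ D(1)])
    show "D \<subseteq> K" using closure_subset by (auto simp: K_def)
  qed
  have I: "open I" "bounded I" "frontier I \<subseteq> closure D"
    unfolding I_def using bdd by (simp_all add: open_inside bounded_inside frontier_inside_subset)
  have intK: "interior K = - closure W" by (simp add: KW interior_complement)
  have cW: "connected (closure W)" "\<not> bounded (closure W)"
    using connected_imp_connected_closure[OF W(2)] W(3) bounded_subset[OF _ closure_subset] by blast+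
  have "closure W \<inter> D = {}" using DK intK by blast
  then have disj: "closure W \<inter> f ` frontier I = {}" using I(3) D(6) by blast
  have "open (f ` I)" by (rule open_mapping_thm[OF f open_UNIV connected_UNIV I(1) subset_UNIV nc])
  then have "closure W \<inter> f ` I = {}"
    by (rule unbounded_connected_avoids_image[OF fcont _ I(1,2) cW disj])
  then have fK: "f ` K \<subseteq> interior K" using D(6) DK intK by (auto simp: K_def)
  have iK: "interior K \<subseteq> K" by (rule interior_subset)
  have K_cpt: "compact K"
  proof -
    have "closed K" using W(1) KW by (simp add: closed_def)
    moreover have "bounded K" unfolding K_def using bdd I(2) by simp
    ultimately show ?thesis by (simp add: compact_eq_bounded_closed)
  qed
  have "interior K \<subseteq> Fatou_set f"
  proof -
    obtain M where M: "\<forall>z\<in>K. cmod z \<le> M"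
      using compact_imp_bounded[OF K_cpt] unfolding bounded_iff by (rule exE)
    have "(f ^^ n) z \<in> K" if "z \<in> interior K" for n z
      using that fK iK by (induction n) auto
    then show ?thesis using M by (intro bounded_orbits_in_Fatou_set[OF f open_interior]) blast
  qed
  have J: "Julia_set f = {z. \<forall>n. (f ^^ n) z \<notin> K}"
  proof -
    have "z \<in> Fatou_set f \<longleftrightarrow> (\<exists>n. (f ^^ n) z \<in> K)" for z
    proof
      assume "z \<in> Fatou_set f"
      then have "(\<lambda>k. (f ^^ k) z) \<longlonglongrightarrow> p" using F by blast
      then have "\<forall>\<^sub>F k in sequentially. (f ^^ k) z \<in> D"
        using D(1,5) r(1) by (intro topological_tendstoD) auto
      then obtain k where "(f ^^ k) z \<in> D" using eventually_happens'[OF sequentially_bot] by blast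
      then show "\<exists>n. (f ^^ n) z \<in> K" using DK iK by blast
    next
      assume "\<exists>n. (f ^^ n) z \<in> K"
      then obtain n where "(f ^^ n) z \<in> K" by blast
      then have "(f ^^ Suc n) z \<in> interior K" using fK by auto
      then have "(f ^^ Suc n) z \<in> Fatou_set f" using \<open>interior K \<subseteq> Fatou_set f\<close> by blast
      then show "z \<in> Fatou_set f" by (rule Fatou_set_backward[OF f])
    qed
    then show ?thesis by (auto simp: Julia_set_def)
  qed
  show thesis
  proof (rule that[OF K_cpt _ _ _ _ fK J])
    show "connected K" unfolding K_def I_def
      by (rule connected_with_inside[OF closed_closure connected_imp_connected_closure[OF D(3)]])
    show "connected (- K)" using W(2) KW by simp
    have "p \<in> ball p r" using r(1) by simp
    then show "p \<in> interior K" using D(5) DK by blast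
    show "singular_set f \<subseteq> K" using L(3) D(4) DK iK by blast
  qed
qed

text \<open>A bounded component would lie in a bounded open set whose boundary is contained in the Fatou set. Some
  iterate maps this boundary into the trapping continuum, and by the maximum principle the component would be
  mapped there as well.\<close>

lemma Julia_component_unbounded:
  assumes f: "f holomorphic_on UNIV" "\<not> f constant_on UNIV"
    and K: "compact K" "connected (- K)" "f ` K \<subseteq> interior K"
    and J: "Julia_set f = {z. \<forall>n. (f ^^ n) z \<notin> K}" and C: "C \<in> components (Julia_set f)"
  shows "\<not> bounded C"
proof
  assume "bounded C"
  then have "compact C" using closed_components[OF closed_Julia_set C] by (simp add: compact_eq_bounded_closed)
  then obtain K1 where K1: "openin (top_of_set (Julia_set f)) K1" "compact K1" "C \<subseteq> K1"
    by (rule Sura_Bura_clopen_subset[OF closed_imp_locally_compact[OF closed_Julia_set] C _ open_UNIV subset_UNIV])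
      (rule that; assumption)
  obtain A where A: "open A" "K1 = Julia_set f \<inter> A" using K1(1) by (auto simp: openin_open)
  have "open (- (Julia_set f - A))" 
  proof -
    have "- (Julia_set f - A) = - Julia_set f \<union> A" by blast
    then show ?thesis by (simp only: open_Un[OF open_Compl[OF closed_Julia_set] A(1)])
  qed
  moreover have "K1 \<subseteq> - (Julia_set f - A)" using A(2) by blast
  ultimately obtain U where U: "open U" "bounded U" "K1 \<subseteq> U" "closure U \<subseteq> - (Julia_set f - A)"
    using bounded_open_neighbourhood[OF K1(2)] by metis
  have fr: "frontier U \<inter> Julia_set f = {}"
    using U A(2) by (auto simp: frontier_def interior_open)
  have iK: "interior K \<subseteq> K" by (rule interior_subset)
  have "\<exists>k. (f ^^ k) z \<in> interior K" if "z \<in> frontier U" for z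
  proof -
    have "z \<notin> Julia_set f" using that fr by blast
    then obtain n where "(f ^^ n) z \<in> K" unfolding J by blast
    then have "(f ^^ Suc n) z \<in> interior K" using K(3) by auto
    then show ?thesis by blast
  qed
  moreover have "compact (frontier U)" using U(2) by (rule compact_frontier_bounded)
  moreover have "f ` interior K \<subseteq> interior K" using K(3) iK by blast
  ultimately obtain N where N: "(f ^^ N) ` frontier U \<subseteq> interior K"
    using compact_covered_by_increasing_preimages[OF _ f(1) open_interior] by metis
  have "- K \<inter> (f ^^ N) ` U = {}"
  proof (rule unbounded_connected_avoids_image[OF iterate_continuous[OF f(1)] open_iterate_image[OF f U(1)] U(1,2) K(2)])
    show "\<not> bounded (- K)" using K(1) compact_imp_bounded cobounded_imp_unbounded by (metis double_compl)
    show "- K \<inter> (f ^^ N) ` frontier U = {}" using N iK by blast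
  qed
  moreover obtain z where "z \<in> C" using in_components_nonempty[OF C] by blast
  moreover have "z \<in> Julia_set f" using \<open>z \<in> C\<close> in_components_subset[OF C] by blast
  moreover have "z \<in> U" using \<open>z \<in> C\<close> K1(3) U(3) by blast
  ultimately show False unfolding J by blast
qed

theorem theorem1p4:
  fixes f :: "complex \<Rightarrow> complex" and K :: "(complex \<times> real) set"
  assumes "disjoint_type f"
    and "K \<in> Julia_continua f"
  shows "span_zero K \<and> terminal_point K sphere_infty"
proof -
  have tr: "transcendental_entire f" using assms(1) by (auto simp: disjoint_type_def hyperbolic_def)
  have f: "f holomorphic_on UNIV" using tr by (simp add: transcendental_entire_def)
  obtain T p where T: "compact T" "connected T" "connected (- T)" "p \<in> interior T"
    "singular_set f \<subseteq> T" "f ` T \<subseteq> interior T" and J: "Julia_set f = {z. \<forall>n. (f ^^ n) z \<notin> T}"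
    by (rule disjoint_type_trap[OF assms(1)])
  obtain P where P: "exponential_cover (- T) P" by (rule exists_exponential_cover[OF T(1-4)])
  interpret log_tracts "- T" P f
  proof (intro log_tracts.intro P log_tracts_axioms.intro tr)
    have "critical_values f \<union> asymptotic_values f \<subseteq> T"
      using T(5) closure_subset unfolding singular_set_def by blast
    then show "- T \<subseteq> regular_values f" by (auto simp: regular_values_def)
    show "z \<in> - T" if "f z \<in> - T" for z using that T(6) interior_subset by blast
  qed
  obtain C where C: "C \<in> components (Julia_set f)" "K = insert sphere_infty (sphere_emb ` C)"
    using assms(2) by (auto simp: Julia_continua_def)
  have CJ: "C \<subseteq> Julia_set f" by (rule in_components_subset[OF C(1)])
  have orbit: "(f ^^ n) z \<in> Julia_set f" if "z \<in> C" for n z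
  proof -
    have "(f ^^ m) ((f ^^ n) z) = (f ^^ (m + n)) z" for m by (simp add: funpow_add)
    then show ?thesis using that CJ unfolding J by auto
  qed
  have JT: "Julia_set f \<subseteq> - T"
  proof
    fix z assume "z \<in> Julia_set f"
    then have "(f ^^ 0) z \<notin> T" unfolding J by blast
    then show "z \<in> - T" by simp
  qed
  obtain G X where GX:
    "\<And>n. G n holomorphic_on right_half_plane"
    "\<And>n u. 0 < Re u \<Longrightarrow> 0 < Re (G n u)"
    "\<And>n. inverse_branch (\<lambda>u. P (G n u))"
    "\<And>n. continuous_on C (X n)"
    "\<And>n z. z \<in> C \<Longrightarrow> 0 < Re (X n z)"
    "\<And>n z. z \<in> C \<Longrightarrow> P (X n z) = (f ^^ n) z"
    "\<And>n z. z \<in> C \<Longrightarrow> G n (X (Suc n) z) = X n z"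
  proof (rule itinerary[of C])
    show "connected C" "C \<noteq> {}" using C(1) in_components_connected in_components_nonempty by auto
    show "(f ^^ n) z \<in> - T" if "z \<in> C" for n z using orbit[OF that] JT by blast
  qed (rule that; assumption)
  obtain c where c: "c > 0" "\<And>u. 0 < Re u \<Longrightarrow> P u \<in> Julia_set f \<Longrightarrow> c \<le> Re u"
    using Re_bounded_below[OF closed_Julia_set JT] by blast
  interpret lifted_continuum "- T" P f C G X c
  proof
    show "closed C" by (rule closed_components[OF closed_Julia_set C(1)])
    show "c \<le> Re (X n z)" if "z \<in> C" for n z
      using c(2)[OF GX(5)[OF that]] GX(6)[OF that] orbit[OF that] by simp
    show "P (X 0 z) = z" if "z \<in> C" for z using GX(6)[OF that, of 0] by simp
  qed (use GX c in auto)
  have "continuum (insert sphere_infty (sphere_emb ` C))"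
  proof (rule continuum_sphere_closure[OF closed_C])
    show "connected C" by (rule in_components_connected[OF C(1)])
    show "\<not> bounded C"
      by (rule Julia_component_unbounded[OF f transcendental_entire_not_constant[OF tr] T(1,3,6) J C(1)])
  qed
  then show ?thesis using span_zero_sphere_closure terminal_point_infinity unfolding C(2) by blast
qed

end
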